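(* Let $(A_N)_{N\ge 1}$ be a sequence of deterministic real symmetric $N\times N$ matrices such that, for some $\delta>0$, $k_N:=\operatorname{rank}(A_N)=O(N^{1/2-\delta})$, and $\sup_N\|A_N\|<\infty$. For each $N$ let $\mathbf{u}_1,\dots,\mathbf{u}_N$ be the $\ell^2$-normalized eigenvectors of an $N\times N$ GOE matrix, and let $\mathbf{y}_1,\dots,\mathbf{y}_N$ be i.i.d. standard Gaussian vectors in $\mathbb{R}^N$ (i.e. $\mathbf{y}_i\sim\mathcal N(0,\mathrm{Id}_{N})$). \begin{enumerate} \item If deterministic real sequences $(c_N)$, $(d_N)$ with $\sup_N|c_N|<\infty$ and a probability distribution $\chi$ are such that $c_N\max_{i=1}^N\langle\mathbf{y}_i,A_N\mathbf{y}_i\rangle+d_N\to\chi$ in distribution as $N\to\infty$, then $c_N\max_{i=1}^N N\langle\mathbf{u}_i,A_N\mathbf{u}_i\rangle+d_N\to\chi$ in distribution. \item If deterministic real sequences $(c'_N)$, $(d'_N)$ with $\sup_N|c'_N|<\infty$ and a probability distribution $\chi'$ are such that $c'_N\max_{i=1}^N|\langle\mathbf{y}_i,A_N\mathbf{y}_i\rangle|+d'_N\to\chi'$ in distribution, then $c'_N\max_{i=1}^N N|\langle\mathbf{u}_i,A_N\mathbf{u}_i\rangle|+d'_N\to\chi'$ in distribution. \end{enumerate}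
   Context: The $N\times N$ GOE consists of real symmetric random matrices $H_N$ whose entries are centered Gaussians, independent up to symmetry, with $\mathbb{E}[(H_N)_{ij}^2]=\frac1N(1+\delta_{ij})$. $\|\cdot\|$ denotes the operator norm. *)

theory Defs
  imports "HOL-Probability.Probability" "HOL-Library.Landau_Symbols" "Jordan_Normal_Form.DL_Rank"
begin

text \<open>Real N x N matrices are represented by functions nat => nat => real,
  only the entries with indices < N being relevant.\<close>

definition to_mat :: "nat \<Rightarrow> (nat \<Rightarrow> nat \<Rightarrow> real) \<Rightarrow> real mat" where
  "to_mat N M = mat N N (\<lambda>(i,j). M i j)"

definition mrank :: "nat \<Rightarrow> (nat \<Rightarrow> nat \<Rightarrow> real) \<Rightarrow> nat" where
  "mrank N M = vec_space.rank N (to_mat N M)"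

definition op_norm :: "nat \<Rightarrow> (nat \<Rightarrow> nat \<Rightarrow> real) \<Rightarrow> real" where
  "op_norm N M = Sup {sqrt (\<Sum>i<N. (\<Sum>j<N. M i j * x j)\<^sup>2) | x. (\<Sum>j<N. (x j)\<^sup>2) = 1}"

definition qform :: "nat \<Rightarrow> (nat \<Rightarrow> nat \<Rightarrow> real) \<Rightarrow> (nat \<Rightarrow> real) \<Rightarrow> real" where
  "qform N M v = (\<Sum>i<N. \<Sum>j<N. v i * M i j * v j)"

definition is_eigvec :: "nat \<Rightarrow> (nat \<Rightarrow> nat \<Rightarrow> real) \<Rightarrow> real \<Rightarrow> (nat \<Rightarrow> real) \<Rightarrow> bool" where
  "is_eigvec N H lam v \<longleftrightarrow> (\<exists>i<N. v i \<noteq> 0) \<and> (\<forall>i<N. (\<Sum>j<N. H i j * v j) = lam * v i)"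

definition eigenvalues :: "nat \<Rightarrow> (nat \<Rightarrow> nat \<Rightarrow> real) \<Rightarrow> real set" where
  "eigenvalues N H = {lam. \<exists>v. is_eigvec N H lam v}"

definition unit_eigvecs :: "nat \<Rightarrow> (nat \<Rightarrow> nat \<Rightarrow> real) \<Rightarrow> (nat \<Rightarrow> real) set" where
  "unit_eigvecs N H = {v. (\<exists>lam. is_eigvec N H lam v) \<and> (\<forall>i\<ge>N. v i = 0) \<and> (\<Sum>i<N. (v i)\<^sup>2) = 1}"

text \<open>max_i N <u_i, A u_i> over the normalised eigenvectors u_1..u_N of H.  When H has
  N distinct eigenvalues (probability one for the GOE) the unit eigenvectors are exactly
  +-u_1,...,+-u_N, so this is well defined; on the null set of matrices with a repeated
  eigenvalue we set the value to 0.\<close>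
definition eig_max :: "nat \<Rightarrow> (nat \<Rightarrow> nat \<Rightarrow> real) \<Rightarrow> (nat \<Rightarrow> nat \<Rightarrow> real) \<Rightarrow> real" where
  "eig_max N A H = (if card (eigenvalues N H) = N
     then Max ((\<lambda>v. real N * qform N A v) ` unit_eigvecs N H) else 0)"

definition eig_max_abs :: "nat \<Rightarrow> (nat \<Rightarrow> nat \<Rightarrow> real) \<Rightarrow> (nat \<Rightarrow> nat \<Rightarrow> real) \<Rightarrow> real" where
  "eig_max_abs N A H = (if card (eigenvalues N H) = N
     then Max ((\<lambda>v. real N * \<bar>qform N A v\<bar>) ` unit_eigvecs N H) else 0)"

text \<open>GOE: independent centred Gaussian entries H_ij, i <= j < N, with variance (1+delta_ij)/N.
  The sample space is the upper triangle; the symmetric matrix is read off by goe_mat.\<close>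
definition goe_index :: "nat \<Rightarrow> (nat \<times> nat) set" where
  "goe_index N = {(i,j). i \<le> j \<and> j < N}"

definition goe :: "nat \<Rightarrow> ((nat \<times> nat) \<Rightarrow> real) measure" where
  "goe N = PiM (goe_index N)
     (\<lambda>(i,j). density lborel (normal_density 0 (sqrt ((if i = j then 2 else 1) / real N))))"

definition goe_mat :: "((nat \<times> nat) \<Rightarrow> real) \<Rightarrow> nat \<Rightarrow> nat \<Rightarrow> real" where
  "goe_mat g i j = g (min i j, max i j)"

text \<open>N i.i.d. standard Gaussian vectors y_1..y_N in R^N: y_i has coordinates y (i,j), j<N
  (indices shifted to start at 0).\<close>
definition gauss_vecs :: "nat \<Rightarrow> ((nat \<times> nat) \<Rightarrow> real) measure" where
  "gauss_vecs N = PiM ({..<N} \<times> {..<N}) (\<lambda>_. density lborel std_normal_density)"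

definition gauss_max :: "nat \<Rightarrow> (nat \<Rightarrow> nat \<Rightarrow> real) \<Rightarrow> ((nat \<times> nat) \<Rightarrow> real) \<Rightarrow> real" where
  "gauss_max N A y = Max ((\<lambda>i. qform N A (\<lambda>j. y (i,j))) ` {..<N})"

definition gauss_max_abs :: "nat \<Rightarrow> (nat \<Rightarrow> nat \<Rightarrow> real) \<Rightarrow> ((nat \<times> nat) \<Rightarrow> real) \<Rightarrow> real" where
  "gauss_max_abs N A y = Max ((\<lambda>i. \<bar>qform N A (\<lambda>j. y (i,j))\<bar>) ` {..<N})"

end

(*
  By the spectral theorem A may be replaced by a diagonal matrix Lam with k nonzero entries, all of
  them among the first k.  The GOE is invariant under conjugation by an independent orthogonal
  matrix, so its eigenvector matrix may be replaced by the Gram-Schmidt orthonormalisation Q of the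
  rows of an N x N Gaussian matrix Y = L Q (L lower triangular), and Y also provides the vectors y_i,
  its columns.  In this coupling
    N <q_i, Lam q_i> - <y_i, Lam y_i> = N <q_i, M q_i>,   M = Lam - L^T Lam L / N.
  M is a function of Y Y^T, hence unchanged under Y -> Y O for O orthogonal.  So for fixed i the unit
  vector q_i is uniform and independent of M, and a chi-square exponential moment bound controls
  <q_i, M q_i> in terms of tr M and the Frobenius norm of M, well enough for a union bound over i.
  Both quantities are explicit in the inner products of the rows of Y and the entries of L, and
  second moments give E (tr M)^2 = O(k^2 / N) and E |M|_F^2 = O(k^2 / N), which is O(N^(-2 delta)).
  Since the maxima are then close in probability, Slutsky's theorem transfers the limit law.
*)
theory Submission
  imports Defs "HOL-Real_Asymp.Real_Asymp"
begin

section \<open>Rotation invariance of the Gaussian product measure\<close>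


text \<open>The maximum runs over N indices, so Markov's inequality applied index by index would
  lose a factor N. Hence the split: what is controlled only in second moment, the trace and the
  Frobenius norm of M, depends on L alone and fails once for all i; what depends on i is a quadratic
  form in an independent direction, with a tail of order exp (- \<epsilon> / (16 \<eta>)) once the
  Frobenius norm is at most \<eta>. The choice \<eta> = N^(-\<delta>/2) leaves room on both sides:
  k^2 / (N \<eta>^2) still tends to 0, and the tail beats the factor N. The rank enters as k^2
  because the nonzero entries of Lam come first and L is lower triangular: M then lives in its
  leading k x k block, whose entries have size about N^(-1/2). Both parts of the theorem are the
  case of a 1-Lipschitz f applied before taking the maximum (the identity, or the absolute value).
  Eigenvectors are determined only up to sign, and only for a simple spectrum, so almost sure
  simplicity and measurability of the statistic have to be established on the way.\<close>

definition gauss :: "'i set \<Rightarrow> ('i \<Rightarrow> real) measure" where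
  "gauss I = PiM I (\<lambda>_. density lborel std_normal_density)"

definition orthogonal_on :: "'i set \<Rightarrow> ('i \<Rightarrow> 'i \<Rightarrow> real) \<Rightarrow> bool" where
  "orthogonal_on I T \<longleftrightarrow> (\<forall>i\<in>I. \<forall>j\<in>I. (\<Sum>k\<in>I. T i k * T j k) = of_bool (i = j))"

definition lin :: "'i set \<Rightarrow> ('i \<Rightarrow> 'i \<Rightarrow> real) \<Rightarrow> ('i \<Rightarrow> real) \<Rightarrow> 'i \<Rightarrow> real" where
  "lin I T x = (\<lambda>i\<in>I. \<Sum>j\<in>I. T i j * x j)"

interpretation std: product_prob_space "\<lambda>_. density lborel (\<lambda>x. ennreal (std_normal_density x))" I for I
  by (intro product_prob_spaceI prob_space_normal_density) simp

lemma prob_space_gauss: "prob_space (gauss I)"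
  unfolding gauss_def by (intro prob_space_PiM prob_space_normal_density) simp

lemma sets_gauss [measurable_cong]: "sets (gauss I) = sets (PiM I (\<lambda>_. borel))"
  unfolding gauss_def by (intro sets_PiM_cong) auto

lemma space_gauss: "space (gauss I) = PiE I (\<lambda>_. UNIV)"
  unfolding gauss_def by (simp add: space_PiM)

lemma nn_integral_gauss_insert:
  assumes "finite I" "i \<notin> I" "f \<in> borel_measurable (gauss (insert i I))"
  shows "(\<integral>\<^sup>+x. f x \<partial>gauss (insert i I)) =
    (\<integral>\<^sup>+x. (\<integral>\<^sup>+y. f (x(i := y)) \<partial>density lborel std_normal_density) \<partial>gauss I)"
  using assms unfolding gauss_def by (rule std.product_nn_integral_insert)

lemma nn_integral_gauss_insert_rev:
  assumes "finite I" "i \<notin> I" "f \<in> borel_measurable (gauss (insert i I))"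
  shows "(\<integral>\<^sup>+x. f x \<partial>gauss (insert i I)) =
    (\<integral>\<^sup>+y. (\<integral>\<^sup>+x. f (x(i := y)) \<partial>gauss I) \<partial>density lborel std_normal_density)"
  using assms unfolding gauss_def by (rule std.product_nn_integral_insert_rev)

section \<open>Rotations of the Gaussian plane\<close>

lemma plane_rotation_inner:
  fixes c s :: real
  assumes "c\<^sup>2 + s\<^sup>2 = 1"
  shows "(c * a - s * b) * (c * a' - s * b') + (s * a + c * b) * (s * a' + c * b') = a * a' + b * b'"
proof -
  have "(c * a - s * b) * (c * a' - s * b') + (s * a + c * b) * (s * a' + c * b')
      = (c\<^sup>2 + s\<^sup>2) * (a * a' + b * b')"
    by (simp add: power2_eq_square algebra_simps)
  then show ?thesis using assms by simp
qed

text \<open>For fixed y the shear is a translation in x. Fubini moves the x-integral inside, where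
  translation invariance of Lebesgue measure applies.\<close>

lemma nn_integral_shear:
  fixes f :: "real \<times> real \<Rightarrow> ennreal"
  assumes [measurable]: "f \<in> borel_measurable (borel \<Otimes>\<^sub>M borel)"
  shows "(\<integral>\<^sup>+x. (\<integral>\<^sup>+y. f (x + t * y, y) \<partial>lborel) \<partial>lborel) = (\<integral>\<^sup>+x. (\<integral>\<^sup>+y. f (x, y) \<partial>lborel) \<partial>lborel)"
proof -
  have "(\<integral>\<^sup>+x. (\<integral>\<^sup>+y. f (x + t * y, y) \<partial>lborel) \<partial>lborel) = (\<integral>\<^sup>+y. (\<integral>\<^sup>+x. f (x + t * y, y) \<partial>lborel) \<partial>lborel)"
    by (rule lborel_pair.Fubini') simp
  also have "\<dots> = (\<integral>\<^sup>+y. (\<integral>\<^sup>+x. f (x, y) \<partial>lborel) \<partial>lborel)"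
  proof (rule nn_integral_cong)
    fix y :: real
    show "(\<integral>\<^sup>+x. f (x + t * y, y) \<partial>lborel) = (\<integral>\<^sup>+x. f (x, y) \<partial>lborel)"
      by (subst (2) nn_integral_real_affine[where c = 1 and t = "t * y"]) (auto simp: add.commute)
  qed
  also have "\<dots> = (\<integral>\<^sup>+x. (\<integral>\<^sup>+y. f (x, y) \<partial>lborel) \<partial>lborel)"
    by (rule lborel_pair.Fubini'[symmetric]) simp
  finally show ?thesis .
qed

lemma nn_integral_shear':
  fixes f :: "real \<times> real \<Rightarrow> ennreal"
  assumes [measurable]: "f \<in> borel_measurable (borel \<Otimes>\<^sub>M borel)"
  shows "(\<integral>\<^sup>+x. (\<integral>\<^sup>+y. f (x, y + t * x) \<partial>lborel) \<partial>lborel) = (\<integral>\<^sup>+x. (\<integral>\<^sup>+y. f (x, y) \<partial>lborel) \<partial>lborel)"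
proof (rule nn_integral_cong)
  fix x :: real
  show "(\<integral>\<^sup>+y. f (x, y + t * x) \<partial>lborel) = (\<integral>\<^sup>+y. f (x, y) \<partial>lborel)"
    by (subst (2) nn_integral_real_affine[where c = 1 and t = "t * x"]) (auto simp: add.commute)
qed

text \<open>A plane rotation by an angle other than a multiple of \<open>\<pi>\<close> is a product of three shears.\<close>

lemma nn_integral_rotation:
  fixes f :: "real \<times> real \<Rightarrow> ennreal"
  assumes [measurable]: "f \<in> borel_measurable (borel \<Otimes>\<^sub>M borel)"
    and cs: "c\<^sup>2 + s\<^sup>2 = 1" "s \<noteq> 0"
  shows "(\<integral>\<^sup>+x. (\<integral>\<^sup>+y. f (c * x - s * y, s * x + c * y) \<partial>lborel) \<partial>lborel)
    = (\<integral>\<^sup>+x. (\<integral>\<^sup>+y. f (x, y) \<partial>lborel) \<partial>lborel)"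
proof -
  \<comment> \<open>For c = cos a and s = sin a this is - tan (a / 2). The shears with coefficients
    t, s, t compose to the rotation; the two identities t s = c - 1 and t (c + 1) = - s are all that
    the composition needs.\<close>
  define t where "t = (c - 1) / s"
  define g where "g = (\<lambda>(x, y). f (x + t * y, y))"
  define h where "h = (\<lambda>(x, y). g (x, y + s * x))"
  have [measurable]: "g \<in> borel_measurable (borel \<Otimes>\<^sub>M borel)" "h \<in> borel_measurable (borel \<Otimes>\<^sub>M borel)"
    unfolding h_def g_def by measurable
  have ts: "t * s = c - 1" using cs by (simp add: t_def)
  have "s * (t * (c + 1)) = (t * s) * (c + 1)" by simp
  also have "\<dots> = c\<^sup>2 - 1" unfolding ts by (simp add: power2_eq_square algebra_simps)
  also have "\<dots> = s * (- s)" using cs by (simp add: power2_eq_square)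
  finally have "s * (t * (c + 1) + s) = 0" by (simp add: distrib_left)
  then have tc: "t * (c + 1) = - s" using cs(2) by simp
  have "f (c * x - s * y, s * x + c * y) = h (x + t * y, y)" for x y
  proof -
    have "y + s * (x + t * y) = s * x + c * y"
      using arg_cong[OF ts, of "\<lambda>u. u * y"] by (simp add: algebra_simps)
    moreover have "x + t * y + t * (s * x + c * y) = c * x - s * y"
      using arg_cong[OF ts, of "\<lambda>u. u * x"] arg_cong[OF tc, of "\<lambda>u. u * y"] by (simp add: algebra_simps)
    ultimately show ?thesis by (simp add: h_def g_def)
  qed
  then have "(\<integral>\<^sup>+x. (\<integral>\<^sup>+y. f (c * x - s * y, s * x + c * y) \<partial>lborel) \<partial>lborel)
      = (\<integral>\<^sup>+x. (\<integral>\<^sup>+y. h (x + t * y, y) \<partial>lborel) \<partial>lborel)" by simp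
  also have "\<dots> = (\<integral>\<^sup>+x. (\<integral>\<^sup>+y. h (x, y) \<partial>lborel) \<partial>lborel)"
    by (rule nn_integral_shear) simp
  also have "\<dots> = (\<integral>\<^sup>+x. (\<integral>\<^sup>+y. g (x, y + s * x) \<partial>lborel) \<partial>lborel)"
    by (simp add: h_def)
  also have "\<dots> = (\<integral>\<^sup>+x. (\<integral>\<^sup>+y. g (x, y) \<partial>lborel) \<partial>lborel)"
    by (rule nn_integral_shear') simp
  also have "\<dots> = (\<integral>\<^sup>+x. (\<integral>\<^sup>+y. f (x + t * y, y) \<partial>lborel) \<partial>lborel)"
    by (simp add: g_def)
  also have "\<dots> = (\<integral>\<^sup>+x. (\<integral>\<^sup>+y. f (x, y) \<partial>lborel) \<partial>lborel)"
    by (rule nn_integral_shear) simp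
  finally show ?thesis .
qed

text \<open>Merges the two densities into one function of x^2 + y^2, which a rotation leaves alone,
  so that only the Lebesgue integral has to be transformed.\<close>

lemma nn_integral_normal_pair:
  fixes f :: "real \<times> real \<Rightarrow> ennreal"
  assumes [measurable]: "f \<in> borel_measurable (borel \<Otimes>\<^sub>M borel)"
  shows "(\<integral>\<^sup>+x. (\<integral>\<^sup>+y. f (x, y) \<partial>density lborel std_normal_density) \<partial>density lborel std_normal_density)
    = (\<integral>\<^sup>+x. (\<integral>\<^sup>+y. ennreal (exp (- (x\<^sup>2 + y\<^sup>2) / 2) / (2 * pi)) * f (x, y) \<partial>lborel) \<partial>lborel)"
proof -
  have e: "ennreal (std_normal_density x) * (ennreal (std_normal_density y) * z)
      = ennreal (exp (- (x\<^sup>2 + y\<^sup>2) / 2) / (2 * pi)) * z" for x y z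
  proof -
    have "std_normal_density x * std_normal_density y = exp (- (x\<^sup>2 + y\<^sup>2) / 2) / (2 * pi)"
      by (simp add: std_normal_density_def exp_add[symmetric] add_divide_distrib)
    then show ?thesis
      by (simp add: mult.assoc[symmetric] ennreal_mult[symmetric])
  qed
  have "(\<integral>\<^sup>+x. (\<integral>\<^sup>+y. f (x, y) \<partial>density lborel std_normal_density) \<partial>density lborel std_normal_density)
     = (\<integral>\<^sup>+x. std_normal_density x * (\<integral>\<^sup>+y. std_normal_density y * f (x, y) \<partial>lborel) \<partial>lborel)"
    by (simp add: nn_integral_density)
  also have "\<dots> = (\<integral>\<^sup>+x. (\<integral>\<^sup>+y. ennreal (std_normal_density x) * (std_normal_density y * f (x, y)) \<partial>lborel) \<partial>lborel)"
    by (intro nn_integral_cong nn_integral_cmult[symmetric]) simp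
  finally show ?thesis by (simp only: e)
qed

lemma nn_integral_normal_rotation:
  fixes f :: "real \<times> real \<Rightarrow> ennreal"
  assumes [measurable]: "f \<in> borel_measurable (borel \<Otimes>\<^sub>M borel)"
    and cs: "c\<^sup>2 + s\<^sup>2 = 1" "s \<noteq> 0"
  shows "(\<integral>\<^sup>+x. (\<integral>\<^sup>+y. f (c * x - s * y, s * x + c * y)
      \<partial>density lborel std_normal_density) \<partial>density lborel std_normal_density)
    = (\<integral>\<^sup>+x. (\<integral>\<^sup>+y. f (x, y) \<partial>density lborel std_normal_density) \<partial>density lborel std_normal_density)"
proof -
  define h where "h = (\<lambda>(x, y). ennreal (exp (- (x\<^sup>2 + y\<^sup>2) / 2) / (2 * pi)) * f (x, y))"
  have [measurable]: "h \<in> borel_measurable (borel \<Otimes>\<^sub>M borel)"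
    unfolding h_def by measurable
  have r: "(c * x - s * y)\<^sup>2 + (s * x + c * y)\<^sup>2 = x\<^sup>2 + y\<^sup>2" for x y
    using plane_rotation_inner[OF cs(1), of x y x y] by (simp add: power2_eq_square)
  have "(\<integral>\<^sup>+x. (\<integral>\<^sup>+y. f (c * x - s * y, s * x + c * y)
      \<partial>density lborel std_normal_density) \<partial>density lborel std_normal_density)
    = (\<integral>\<^sup>+x. (\<integral>\<^sup>+y. h (c * x - s * y, s * x + c * y) \<partial>lborel) \<partial>lborel)"
    by (subst nn_integral_normal_pair[where f = "\<lambda>(x, y). f (c * x - s * y, s * x + c * y)", simplified])
       (simp_all only: h_def prod.case r, simp)
  also have "\<dots> = (\<integral>\<^sup>+x. (\<integral>\<^sup>+y. h (x, y) \<partial>lborel) \<partial>lborel)"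
    by (rule nn_integral_rotation) (use cs in simp_all)
  finally show ?thesis by (simp add: nn_integral_normal_pair h_def)
qed

text \<open>The one-dimensional orthogonal maps: the density is even. This handles the single
  diagonal entry left over in the induction below.\<close>

lemma nn_integral_normal_sign:
  fixes f :: "real \<Rightarrow> ennreal"
  assumes [measurable]: "f \<in> borel_measurable borel" and e: "e\<^sup>2 = (1::real)"
  shows "(\<integral>\<^sup>+x. f (e * x) \<partial>density lborel std_normal_density) = (\<integral>\<^sup>+x. f x \<partial>density lborel std_normal_density)"
proof -
  have e1: "\<bar>e\<bar> = 1" and e0: "e \<noteq> 0" using e by (auto simp: power2_eq_1_iff)
  have "(\<integral>\<^sup>+x. f x \<partial>density lborel std_normal_density) = (\<integral>\<^sup>+x. std_normal_density x * f x \<partial>lborel)"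
    by (simp add: nn_integral_density)
  also have "\<dots> = (\<integral>\<^sup>+x. std_normal_density (e * x) * f (e * x) \<partial>lborel)"
    by (subst nn_integral_real_affine[where c = e and t = 0]) (use e0 e1 in auto)
  also have "\<dots> = (\<integral>\<^sup>+x. std_normal_density x * f (e * x) \<partial>lborel)"
    by (simp add: std_normal_density_def power_mult_distrib e)
  finally show ?thesis by (simp add: nn_integral_density)
qed

section \<open>Orthogonal maps in finitely many coordinates\<close>

lemma measurable_upd_gauss [measurable]:
  "(\<lambda>(x, y). x(i := y)) \<in> gauss I \<Otimes>\<^sub>M borel \<rightarrow>\<^sub>M gauss (insert i I)"
proof -
  have "(\<lambda>(x, y). x(i := y)) \<in> PiM I (\<lambda>_. borel) \<Otimes>\<^sub>M (borel :: real measure) \<rightarrow>\<^sub>M PiM (insert i I) (\<lambda>_. borel)"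
    using measurable_add_dim[of i I "\<lambda>_. borel :: real measure"] by simp
  then show ?thesis by measurable
qed

text \<open>With all coordinates except i and j integrated last, the inner double integral is the
  planar case.\<close>

lemma nn_integral_gauss_givens:
  assumes fin: "finite I" and ij: "i \<in> I" "j \<in> I" "i \<noteq> j"
    and f[measurable]: "f \<in> borel_measurable (gauss I)"
    and cs: "c\<^sup>2 + s\<^sup>2 = 1" "s \<noteq> 0"
  shows "(\<integral>\<^sup>+x. f (x(i := c * x i - s * x j, j := s * x i + c * x j)) \<partial>gauss I) = (\<integral>\<^sup>+x. f x \<partial>gauss I)"
proof -
  define J where "J = I - {i, j}"
  have I: "I = insert j (insert i J)" and J: "finite J" "i \<notin> J" "j \<notin> insert i J"
    using ij fin by (auto simp: J_def)
  have f'[measurable]: "f \<in> borel_measurable (gauss (insert j (insert i J)))"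
    using f unfolding I .
  let ?N = "density lborel std_normal_density"
  have m: "(\<lambda>x. x(i := c * x i - s * x j, j := s * x i + c * x j)) \<in> gauss I \<rightarrow>\<^sub>M gauss I"
  proof -
    have "(\<lambda>x. x(i := c * x i - s * x j, j := s * x i + c * x j)) \<in> PiM I (\<lambda>_. borel) \<rightarrow>\<^sub>M PiM I (\<lambda>_. borel)"
    proof (rule measurable_PiM_single')
      fix k assume "k \<in> I"
      show "(\<lambda>x. (x(i := c * x i - s * x j, j := s * x i + c * x j)) k) \<in> borel_measurable (Pi\<^sub>M I (\<lambda>_. borel))"
        using ij \<open>k \<in> I\<close> by (cases "k = j"; cases "k = i") auto
    qed (use ij in \<open>auto simp: space_PiM PiE_def extensional_def\<close>)
    then show ?thesis by measurable
  qed
  have m1: "(\<lambda>y. (x(i := fst y, j := snd y))) \<in> borel \<Otimes>\<^sub>M borel \<rightarrow>\<^sub>M gauss (insert j (insert i J))" if "x \<in> space (gauss J)" for x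
  proof -
    note that[measurable]
    have "(\<lambda>y. (\<lambda>(x, y). x(j := y)) ((\<lambda>(x, y). x(i := y)) (x, fst y), snd y)) \<in> borel \<Otimes>\<^sub>M borel \<rightarrow>\<^sub>M gauss (insert j (insert i J))"
      by measurable
    then show ?thesis by simp
  qed
  have e: "(\<integral>\<^sup>+x. g x \<partial>gauss I) = (\<integral>\<^sup>+x. (\<integral>\<^sup>+a. (\<integral>\<^sup>+b. g (x(i := a, j := b)) \<partial>?N) \<partial>?N) \<partial>gauss J)"
    if [measurable]: "g \<in> borel_measurable (gauss (insert j (insert i J)))" for g
    unfolding I using J
    by (subst nn_integral_gauss_insert, simp, simp, simp, subst nn_integral_gauss_insert) auto
  have "(\<integral>\<^sup>+x. f (x(i := c * x i - s * x j, j := s * x i + c * x j)) \<partial>gauss I)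
     = (\<integral>\<^sup>+x. (\<integral>\<^sup>+a. (\<integral>\<^sup>+b. f (x(i := c * a - s * b, j := s * a + c * b)) \<partial>?N) \<partial>?N) \<partial>gauss J)"
    using e[OF measurable_compose[OF m[unfolded I] f']] ij by (simp add: fun_upd_twist)
  also have "\<dots> = (\<integral>\<^sup>+x. (\<integral>\<^sup>+a. (\<integral>\<^sup>+b. f (x(i := a, j := b)) \<partial>?N) \<partial>?N) \<partial>gauss J)"
  proof (rule nn_integral_cong)
    fix x assume "x \<in> space (gauss J)"
    note m1[OF this, measurable]
    show "(\<integral>\<^sup>+a. (\<integral>\<^sup>+b. f (x(i := c * a - s * b, j := s * a + c * b)) \<partial>?N) \<partial>?N)
       = (\<integral>\<^sup>+a. (\<integral>\<^sup>+b. f (x(i := a, j := b)) \<partial>?N) \<partial>?N)"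
      using nn_integral_normal_rotation[where f = "\<lambda>y. f (x(i := fst y, j := snd y))", OF _ cs]
      by simp
  qed
  also have "\<dots> = (\<integral>\<^sup>+x. f x \<partial>gauss I)" by (rule e[symmetric]) simp
  finally show ?thesis .
qed

lemma measurable_lin [measurable]: "lin I T \<in> gauss I \<rightarrow>\<^sub>M gauss I"
proof -
  have "lin I T \<in> PiM I (\<lambda>_. borel) \<rightarrow>\<^sub>M PiM I (\<lambda>_. borel)"
    unfolding lin_def by (intro measurable_restrict borel_measurable_sum) auto
  then show ?thesis by measurable
qed

text \<open>Outer induction on the index set, inner induction on the set K of entries of row p not
  yet known to vanish. Each inner step clears one entry by a Givens rotation, which changes T, hence
  T is kept arbitrary. Once row p is reduced to its diagonal entry, T is block diagonal: a sign on p
  and an orthogonal matrix on J.\<close>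

proposition nn_integral_gauss_orthogonal:
  assumes "finite I" "orthogonal_on I T" "f \<in> borel_measurable (gauss I)"
  shows "(\<integral>\<^sup>+x. f (lin I T x) \<partial>gauss I) = (\<integral>\<^sup>+x. f x \<partial>gauss I)"
  using assms
proof (induction I arbitrary: T f rule: finite_induct)
  case empty
  then show ?case
    by (intro nn_integral_cong) (simp add: lin_def space_gauss)
next
  case (insert p J)
  let ?I = "insert p J"
  let ?N = "density lborel std_normal_density"
  note f[measurable] = insert.prems(2)
  have "(\<integral>\<^sup>+x. f (lin ?I T x) \<partial>gauss ?I) = (\<integral>\<^sup>+x. f x \<partial>gauss ?I)"
    if "finite K" "K \<subseteq> J" "orthogonal_on ?I T" "\<And>j. j \<in> J - K \<Longrightarrow> T p j = 0" for K T
    using that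
  proof (induction K arbitrary: T rule: finite_induct)
    case empty
    have or: "(\<Sum>k\<in>?I. T i k * T j k) = of_bool (i = j)" if "i \<in> ?I" "j \<in> ?I" for i j
      using empty that unfolding orthogonal_on_def by blast
    have z: "T p j = 0" if "j \<in> J" for j using empty that by simp
    have e: "(T p p)\<^sup>2 = 1"
      using or[of p p] insert.hyps z by (simp add: power2_eq_square)
    \<comment> \<open>Row p is now T p p times a unit coordinate vector, so orthogonality of row i
      to row p clears column p as well.\<close>
    have z': "T i p = 0" if "i \<in> J" for i
    proof -
      have "i \<noteq> p" using that insert.hyps by auto
      then have "T i p * T p p = 0" using or[of i p] insert.hyps z that by simp
      then show ?thesis using e by auto
    qed
    have oJ: "orthogonal_on J T"
      unfolding orthogonal_on_def
    proof (intro ballI)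
      fix i j assume "i \<in> J" "j \<in> J"
      then show "(\<Sum>k\<in>J. T i k * T j k) = of_bool (i = j)"
        using or[of i j] insert.hyps z' by simp
    qed
    have l: "lin ?I T (x(p := y)) = (lin J T x)(p := T p p * y)" if "x \<in> space (gauss J)" for x y
    proof
      fix i
      have "(\<Sum>j\<in>J. T i j * (x(p := y)) j) = (\<Sum>j\<in>J. T i j * x j)"
        using insert.hyps by (intro sum.cong) auto
      moreover have "(\<Sum>j\<in>J. T p j * (x(p := y)) j) = 0" using z by simp
      ultimately show "lin ?I T (x(p := y)) i = ((lin J T x)(p := T p p * y)) i"
        using insert.hyps z' by (auto simp: lin_def)
    qed
    have "(\<integral>\<^sup>+x. f (lin ?I T x) \<partial>gauss ?I)
        = (\<integral>\<^sup>+y. (\<integral>\<^sup>+x. f (lin ?I T (x(p := y))) \<partial>gauss J) \<partial>?N)"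
      using insert.hyps by (intro nn_integral_gauss_insert_rev) auto
    also have "\<dots> = (\<integral>\<^sup>+y. (\<integral>\<^sup>+x. f ((lin J T x)(p := T p p * y)) \<partial>gauss J) \<partial>?N)"
      by (intro nn_integral_cong) (simp add: l)
    also have "\<dots> = (\<integral>\<^sup>+y. (\<integral>\<^sup>+x. f (x(p := T p p * y)) \<partial>gauss J) \<partial>?N)"
    proof (rule nn_integral_cong)
      fix y :: real
      have "(\<lambda>x. (\<lambda>(x, y). x(p := y)) (x, T p p * y)) \<in> gauss J \<rightarrow>\<^sub>M gauss ?I" by measurable
      then have "(\<lambda>x. f (x(p := T p p * y))) \<in> borel_measurable (gauss J)" by simp
      from insert.IH[OF oJ this]
      show "(\<integral>\<^sup>+x. f ((lin J T x)(p := T p p * y)) \<partial>gauss J) = (\<integral>\<^sup>+x. f (x(p := T p p * y)) \<partial>gauss J)" .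
    qed
    also have "\<dots> = (\<integral>\<^sup>+y. (\<integral>\<^sup>+x. f (x(p := y)) \<partial>gauss J) \<partial>?N)"
    proof -
      interpret J: prob_space "gauss J" by (rule prob_space_gauss)
      have "(\<lambda>y. \<integral>\<^sup>+x. f ((\<lambda>(x, y). x(p := y)) (x, y)) \<partial>gauss J) \<in> borel_measurable borel"
        by measurable
      then have "(\<lambda>y. \<integral>\<^sup>+x. f (x(p := y)) \<partial>gauss J) \<in> borel_measurable borel" by simp
      from nn_integral_normal_sign[OF this e] show ?thesis .
    qed
    also have "\<dots> = (\<integral>\<^sup>+x. f x \<partial>gauss ?I)"
      using insert.hyps by (intro nn_integral_gauss_insert_rev[symmetric]) auto
    finally show ?case .
  next
    case (insert q K)
    show ?case
    proof (cases "T p q = 0")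
      case True
      then show ?thesis
        using insert.prems by (intro insert.IH) auto
    next
      case False
      define u w where "u = T p p" and "w = T p q"
      define r where "r = sqrt (u\<^sup>2 + w\<^sup>2)"
      \<comment> \<open>Givens coefficients: columns p and q of T are rotated so that the new (p, q)
        entry, s * u + c * w, vanishes. Since w is nonzero, so is s, as the shear decomposition
        requires.\<close>
      define c s where "c = u / r" and "s = - w / r"
      have w: "w \<noteq> 0" using False by (simp add: w_def)
      then have r: "r > 0" and r2: "r\<^sup>2 = u\<^sup>2 + w\<^sup>2"
        by (auto simp: r_def sum_power2_gt_zero_iff)
      have cs: "c\<^sup>2 + s\<^sup>2 = 1" and s: "s \<noteq> 0"
        using r w r2 by (auto simp: c_def s_def power_divide add_divide_distrib[symmetric])
      define T' where "T' = (\<lambda>i. (T i)(p := c * T i p - s * T i q, q := s * T i p + c * T i q))"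
      have q: "q \<in> J" and pq: "p \<noteq> q" using insert \<open>p \<notin> J\<close> by auto
      define R where "R = J - {q}"
      have I: "?I = insert p (insert q R)" and R: "finite R" "p \<notin> R" "q \<notin> R"
        using q \<open>finite J\<close> \<open>p \<notin> J\<close> by (auto simp: R_def)
      have inner: "(\<Sum>k\<in>?I. T' i k * v k) = (\<Sum>k\<in>R. T i k * v k)
          + (c * T i p - s * T i q) * v p + (s * T i p + c * T i q) * v q" for i v
      proof -
        have "(\<Sum>k\<in>R. T' i k * v k) = (\<Sum>k\<in>R. T i k * v k)"
          using R by (intro sum.cong) (auto simp: T'_def)
        then show ?thesis unfolding I using R pq by (simp add: T'_def algebra_simps)
      qed
      have "orthogonal_on ?I T'"
        unfolding orthogonal_on_def
      proof (intro ballI)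
        fix i j assume ij: "i \<in> ?I" "j \<in> ?I"
        have "(\<Sum>k\<in>?I. T' i k * T' j k) = (\<Sum>k\<in>R. T i k * T' j k)
          + (c * T i p - s * T i q) * T' j p + (s * T i p + c * T i q) * T' j q"
          by (rule inner)
        also have "(\<Sum>k\<in>R. T i k * T' j k) = (\<Sum>k\<in>R. T i k * T j k)"
          using R by (intro sum.cong) (auto simp: T'_def)
        also have "\<dots> + (c * T i p - s * T i q) * T' j p + (s * T i p + c * T i q) * T' j q
            = (\<Sum>k\<in>R. T i k * T j k) + T i p * T j p + T i q * T j q"
          using plane_rotation_inner[OF cs] pq by (simp add: T'_def add.assoc)
        also have "\<dots> = (\<Sum>k\<in>?I. T i k * T j k)" unfolding I using R pq by simp
        also have "\<dots> = of_bool (i = j)" using insert.prems(2) ij by (auto simp: orthogonal_on_def)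
        finally show "(\<Sum>k\<in>?I. T' i k * T' j k) = of_bool (i = j)" .
      qed
      moreover have "T' p j = 0" if "j \<in> J - K" for j
      proof (cases "j = q")
        case True
        have "s * u + c * w = 0" by (simp add: s_def c_def)
        then show ?thesis using True by (simp add: T'_def u_def w_def)
      next
        case False
        then show ?thesis using that insert.prems(3)[of j] \<open>p \<notin> J\<close> by (auto simp: T'_def)
      qed
      ultimately have IH: "(\<integral>\<^sup>+x. f (lin ?I T' x) \<partial>gauss ?I) = (\<integral>\<^sup>+x. f x \<partial>gauss ?I)"
        using insert.prems by (intro insert.IH) auto
      \<comment> \<open>Rotating columns p, q of T and coordinates p, q of x by the same rotation
        preserves the inner product of each row with x.\<close>
      have "lin ?I T' (x(p := c * x p - s * x q, q := s * x p + c * x q)) = lin ?I T x" for x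
      proof
        fix i
        let ?y = "x(p := c * x p - s * x q, q := s * x p + c * x q)"
        have "(\<Sum>k\<in>?I. T' i k * ?y k) = (\<Sum>k\<in>R. T i k * ?y k)
          + (c * T i p - s * T i q) * ?y p + (s * T i p + c * T i q) * ?y q" by (rule inner)
        also have "(\<Sum>k\<in>R. T i k * ?y k) = (\<Sum>k\<in>R. T i k * x k)"
          using R by (intro sum.cong) auto
        also have "\<dots> + (c * T i p - s * T i q) * ?y p + (s * T i p + c * T i q) * ?y q
          = (\<Sum>k\<in>R. T i k * x k) + T i p * x p + T i q * x q"
          using plane_rotation_inner[OF cs, of "T i p" "T i q" "x p" "x q"] pq by (simp add: add.assoc)
        also have "\<dots> = (\<Sum>k\<in>?I. T i k * x k)" unfolding I using R pq by simp
        finally show "lin ?I T' ?y i = lin ?I T x i" by (auto simp: lin_def simp del: fun_upd_apply)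
      qed
      then have "(\<integral>\<^sup>+x. f (lin ?I T x) \<partial>gauss ?I)
          = (\<integral>\<^sup>+x. f (lin ?I T' (x(p := c * x p - s * x q, q := s * x p + c * x q))) \<partial>gauss ?I)" by simp
      also have "\<dots> = (\<integral>\<^sup>+x. f (lin ?I T' x) \<partial>gauss ?I)"
        by (rule nn_integral_gauss_givens[where f = "\<lambda>x. f (lin ?I T' x)"]) (use \<open>finite J\<close> q pq cs s in auto)
      finally show ?thesis using IH by simp
    qed
  qed
  from this[OF \<open>finite J\<close> subset_refl insert.prems(1)] show ?case by simp
qed

section \<open>Spectral theorem for symmetric matrices\<close>


definition ip :: "nat \<Rightarrow> (nat \<Rightarrow> real) \<Rightarrow> (nat \<Rightarrow> real) \<Rightarrow> real" where
  "ip N u v = (\<Sum>i<N. u i * v i)"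

definition mv :: "nat \<Rightarrow> (nat \<Rightarrow> nat \<Rightarrow> real) \<Rightarrow> (nat \<Rightarrow> real) \<Rightarrow> nat \<Rightarrow> real" where
  "mv N M v i = (\<Sum>j<N. M i j * v j)"

lemma ip_commute: "ip N u v = ip N v u"
  unfolding ip_def by (simp add: mult.commute)

lemma ip_add_right: "ip N u (\<lambda>i. v i + w i) = ip N u v + ip N u w"
  unfolding ip_def by (simp add: distrib_left sum.distrib)

lemma ip_diff_right: "ip N u (\<lambda>i. v i - w i) = ip N u v - ip N u w"
  unfolding ip_def by (simp add: right_diff_distrib sum_subtractf)

lemma ip_scale_right: "ip N u (\<lambda>i. c * v i) = c * ip N u v"
  unfolding ip_def by (simp add: sum_distrib_left algebra_simps)

lemma ip_sum_right: "ip N u (\<lambda>i. \<Sum>b\<in>B. f b i) = (\<Sum>b\<in>B. ip N u (f b))"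
  unfolding ip_def by (subst sum.swap) (simp add: sum_distrib_left)

lemma ip_add_left: "ip N (\<lambda>i. v i + w i) u = ip N v u + ip N w u"
  and ip_diff_left: "ip N (\<lambda>i. v i - w i) u = ip N v u - ip N w u"
  and ip_scale_left: "ip N (\<lambda>i. c * v i) u = c * ip N v u"
  and ip_sum_left: "ip N (\<lambda>i. \<Sum>b\<in>B. f b i) u = (\<Sum>b\<in>B. ip N (f b) u)"
  by (simp_all add: ip_commute[of N _ u] ip_add_right ip_diff_right ip_scale_right ip_sum_right)

lemmas ip_simps = ip_add_left ip_add_right ip_diff_left ip_diff_right ip_scale_left ip_scale_right
  ip_sum_left ip_sum_right

lemma ip_nonneg: "0 \<le> ip N u u"
  unfolding ip_def by (intro sum_nonneg) simp

lemma ip_self_eq_0_iff: "ip N u u = 0 \<longleftrightarrow> (\<forall>i<N. u i = 0)"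
  unfolding ip_def by (subst sum_nonneg_eq_0_iff) auto

lemma ip_cong: "(\<And>i. i < N \<Longrightarrow> u i = u' i) \<Longrightarrow> (\<And>i. i < N \<Longrightarrow> v i = v' i) \<Longrightarrow> ip N u v = ip N u' v'"
  unfolding ip_def by (intro sum.cong) auto

lemma orthogonal_on_ip:
  "orthogonal_on {..<N} v \<longleftrightarrow> (\<forall>i<N. \<forall>j<N. ip N (v i) (v j) = of_bool (i = j))"
  unfolding orthogonal_on_def ip_def by auto

lemma ip_mv_sym:
  assumes "\<And>i j. i < N \<Longrightarrow> j < N \<Longrightarrow> M i j = M j i"
  shows "ip N u (mv N M v) = ip N (mv N M u) v"
proof -
  have "ip N u (mv N M v) = (\<Sum>i<N. \<Sum>j<N. M i j * u i * v j)"
    unfolding ip_def mv_def by (simp add: sum_distrib_left algebra_simps)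
  also have "\<dots> = (\<Sum>j<N. \<Sum>i<N. M j i * u i * v j)"
    by (subst sum.swap) (intro sum.cong refl, use assms in auto)
  also have "\<dots> = ip N (mv N M u) v"
    unfolding ip_def mv_def by (simp add: sum_distrib_right)
  finally show ?thesis .
qed

lemma qform_ip: "qform N A v = ip N v (mv N A v)"
  unfolding qform_def ip_def mv_def by (simp add: sum_distrib_left algebra_simps)

lemma qform_cong:
  assumes "\<And>i. i < N \<Longrightarrow> v i = w i" shows "qform N A v = qform N A w"
  unfolding qform_def by (intro sum.cong refl) (use assms in auto)

text \<open>A right inverse of a square matrix is also a left inverse. This is the source of
  completeness: expansion in an orthonormal basis and Parseval's identity both rest on it.\<close>

lemma orthogonal_on_transpose:
  fixes N :: nat
  assumes "orthogonal_on {..<N} v"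
  shows "orthogonal_on {..<N} (\<lambda>i j. v j i)"
proof -
  define B where "B = mat N N (\<lambda>(i,j). v i j)"
  have B: "B \<in> carrier_mat N N" "transpose_mat B \<in> carrier_mat N N" by (auto simp: B_def)
  have e: "(B * transpose_mat B) $$ (i, j) = (\<Sum>k<N. v i k * v j k)" if "i < N" "j < N" for i j
    using that by (simp add: B_def scalar_prod_def atLeast0LessThan)
  have "B * transpose_mat B = 1\<^sub>m N"
  proof (rule eq_matI)
    fix i j assume "i < dim_row (1\<^sub>m N)" "j < dim_col (1\<^sub>m N)"
    then show "(B * transpose_mat B) $$ (i, j) = 1\<^sub>m N $$ (i, j)"
      using assms e[of i j] by (auto simp: orthogonal_on_def)
  qed (use B in auto)
  then have t: "transpose_mat B * B = 1\<^sub>m N"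
    using mat_mult_left_right_inverse[OF B] by simp
  have "(transpose_mat B * B) $$ (i, j) = (\<Sum>k<N. v k i * v k j)" if "i < N" "j < N" for i j
    using that by (simp add: B_def scalar_prod_def atLeast0LessThan)
  then show ?thesis unfolding t orthogonal_on_def by (auto simp: of_bool_def)
qed

lemma orthonormal_expand:
  fixes N :: nat
  assumes o: "orthogonal_on {..<N} v" and i: "i < N"
  shows "x i = (\<Sum>b<N. ip N (v b) x * v b i)"
proof -
  have "(\<Sum>b<N. ip N (v b) x * v b i) = (\<Sum>j<N. x j * (\<Sum>b<N. v b j * v b i))"
    unfolding ip_def sum_distrib_left sum_distrib_right
    by (subst sum.swap) (simp add: algebra_simps)
  also have "\<dots> = (\<Sum>j<N. if j = i then x j else 0)"
    using orthogonal_on_transpose[OF o] i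
    by (intro sum.cong refl) (auto simp: orthogonal_on_def)
  also have "\<dots> = x i" using i by simp
  finally show ?thesis by simp
qed

lemma parseval:
  assumes o: "orthogonal_on {..<N} v"
  shows "ip N x y = (\<Sum>b<N. ip N (v b) x * ip N (v b) y)"
proof -
  have "ip N x y = ip N x (\<lambda>i. \<Sum>b<N. ip N (v b) y * v b i)"
    by (rule ip_cong[OF refl orthonormal_expand[OF o]])
  also have "\<dots> = (\<Sum>b<N. ip N (v b) y * ip N x (v b))" by (simp add: ip_simps)
  finally show ?thesis by (simp add: ip_commute mult.commute)
qed

text \<open>Dimension count by a trace: let r i be the i-th standard basis vector minus its
  projection on the span of the given vectors. The squared lengths of r 0, ..., r (N - 1) add up to
  N - m > 0, so one residual is nonzero, and normalising it gives the new vector.\<close>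

lemma bessel_strict:
  assumes "m < N" and o: "\<And>a b. a < m \<Longrightarrow> b < m \<Longrightarrow> ip N (v a) (v b) = of_bool (a = b)"
  shows "\<exists>w. (\<forall>i\<ge>N. w i = 0) \<and> ip N w w = 1 \<and> (\<forall>b<m. ip N (v b) w = 0)"
proof -
  define r where "r = (\<lambda>i j. if j < N then of_bool (j = i) - (\<Sum>b<m. v b i * v b j) else (0::real))"
  define e :: "nat \<Rightarrow> nat \<Rightarrow> real" where "e = (\<lambda>i j. of_bool (j = i))"
  have ip_e: "ip N x (e i) = x i" if "i < N" for x i
    unfolding ip_def e_def using that by (simp add: if_distrib[of "(*) _"] of_bool_def cong: if_cong)
  have r: "ip N x (r i) = x i - (\<Sum>b<m. v b i * ip N x (v b))" if "i < N" for x i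
  proof -
    have "ip N x (r i) = ip N x (\<lambda>j. e i j - (\<Sum>b<m. v b i * v b j))"
      by (rule ip_cong) (auto simp: r_def e_def)
    then show ?thesis using that by (simp add: ip_simps ip_e)
  qed
  have orth: "ip N (v a) (r i) = 0" if "a < m" "i < N" for a i
  proof -
    have "(\<Sum>b<m. v b i * ip N (v a) (v b)) = (\<Sum>b<m. if b = a then v b i else 0)"
      using o that by (intro sum.cong) auto
    then show ?thesis using that by (simp add: r)
  qed
  have rr: "ip N (r i) (r i) = 1 - (\<Sum>b<m. (v b i)\<^sup>2)" if "i < N" for i
  proof -
    have "(\<Sum>b<m. v b i * ip N (r i) (v b)) = 0"
      using orth that by (intro sum.neutral) (auto simp: ip_commute)
    then have "ip N (r i) (r i) = r i i" using that by (simp add: r)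
    also have "\<dots> = 1 - (\<Sum>b<m. (v b i)\<^sup>2)" using that by (simp add: r_def power2_eq_square)
    finally show ?thesis .
  qed
  have "(\<Sum>i<N. ip N (r i) (r i)) = real N - (\<Sum>i<N. \<Sum>b<m. (v b i)\<^sup>2)"
    using rr by (simp add: sum_subtractf)
  also have "(\<Sum>i<N. \<Sum>b<m. (v b i)\<^sup>2) = (\<Sum>b<m. ip N (v b) (v b))"
    unfolding ip_def by (subst sum.swap) (simp add: power2_eq_square)
  also have "\<dots> = real m" using o by simp
  finally have "(\<Sum>i<N. ip N (r i) (r i)) \<noteq> 0" using assms(1) by simp
  then obtain i where i: "i < N" "ip N (r i) (r i) \<noteq> 0"
    by (metis (no_types, lifting) lessThan_iff sum.neutral)
  define c where "c = sqrt (ip N (r i) (r i))"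
  have c: "c > 0" "c * c = ip N (r i) (r i)" using i ip_nonneg[of N "r i"] by (auto simp: c_def)
  define w where "w = (\<lambda>j. inverse c * r i j)"
  have "ip N w w = inverse c * inverse c * (c * c)" unfolding w_def c(2) by (simp add: ip_simps)
  then have "ip N w w = 1" using c(1) by (simp add: field_simps)
  moreover have "\<forall>j\<ge>N. w j = 0" by (simp add: w_def r_def)
  moreover have "\<forall>b<m. ip N (v b) w = 0" using orth i by (simp add: w_def ip_simps)
  ultimately show ?thesis by blast
qed

section \<open>Compactness of the sphere in a function space\<close>

lemma continuous_on_coord [continuous_intros]: "continuous_on S (\<lambda>x::'i \<Rightarrow> real. x i)"
  by (rule continuous_on_subset[OF continuous_on_product_coordinates]) simp

text \<open>Tychonoff: pinning the coordinates from N on to 0 makes the N-dimensional cube compact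
  in the product topology, so that N can stay a variable instead of a type.\<close>

lemma compact_box:
  "compact {x::nat \<Rightarrow> real. (\<forall>i\<ge>N. x i = 0) \<and> (\<forall>i<N. \<bar>x i\<bar> \<le> 1)}"
proof -
  have "compactin (product_topology (\<lambda>_. euclidean) UNIV)
      (PiE UNIV (\<lambda>i. if i < N then {-1..1::real} else {0}))"
    by (subst compactin_PiE) auto
  then have "compact (PiE UNIV (\<lambda>i. if i < N then {-1..1::real} else {0}))"
    by (simp add: euclidean_product_topology)
  moreover have "PiE UNIV (\<lambda>i. if i < N then {-1..1::real} else {0})
      = {x. (\<forall>i\<ge>N. x i = 0) \<and> (\<forall>i<N. \<bar>x i\<bar> \<le> 1)}"
  proof (rule Set.set_eqI, rule iffI)
    fix x :: "nat \<Rightarrow> real"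
    assume "x \<in> PiE UNIV (\<lambda>i. if i < N then {-1..1::real} else {0})"
    then have x: "x i \<in> (if i < N then {-1..1::real} else {0})" for i by (auto simp: PiE_def Pi_def)
    have "x i = 0" if "i \<ge> N" for i using x[of i] that by simp
    moreover have "\<bar>x i\<bar> \<le> 1" if "i < N" for i using x[of i] that by (simp add: abs_le_iff)
    ultimately show "x \<in> {x. (\<forall>i\<ge>N. x i = 0) \<and> (\<forall>i<N. \<bar>x i\<bar> \<le> 1)}" by simp
  next
    fix x :: "nat \<Rightarrow> real"
    assume x: "x \<in> {x. (\<forall>i\<ge>N. x i = 0) \<and> (\<forall>i<N. \<bar>x i\<bar> \<le> 1)}"
    have "x i \<in> (if i < N then {-1..1::real} else {0})" for i
      using x by (cases "i < N") (auto simp: abs_le_iff minus_le_iff)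
    then show "x \<in> PiE UNIV (\<lambda>i. if i < N then {-1..1::real} else {0})" by (auto simp: PiE_def Pi_def)
  qed
  ultimately show ?thesis by simp
qed

lemma abs_le_1_if_ip_1:
  assumes "ip N x x = 1" "i < N" shows "\<bar>x i\<bar> \<le> 1"
proof -
  have "x i * x i \<le> ip N x x" unfolding ip_def by (rule member_le_sum) (use assms in auto)
  then show ?thesis using assms abs_square_le_1[of "x i"] by (simp add: power2_eq_square)
qed

lemma continuous_on_ip [continuous_intros]:
  assumes "\<And>i. continuous_on S (\<lambda>x. f x i)" "\<And>i. continuous_on S (\<lambda>x. g x i)"
  shows "continuous_on S (\<lambda>x. ip N (f x) (g x))"
  unfolding ip_def by (intro continuous_intros assms)

lemma compact_sphere_Int_closed:
  assumes "closed T"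
  shows "compact {x::nat \<Rightarrow> real. (\<forall>i\<ge>N. x i = 0) \<and> ip N x x = 1 \<and> x \<in> T}"
proof -
  have eq: "{x. (\<forall>i\<ge>N. x i = 0) \<and> ip N x x = 1 \<and> x \<in> T}
     = {x::nat \<Rightarrow> real. (\<forall>i\<ge>N. x i = 0) \<and> (\<forall>i<N. \<bar>x i\<bar> \<le> 1)} \<inter> ({x. ip N x x = 1} \<inter> T)"
    using abs_le_1_if_ip_1 by auto
  have "closed {x. ip N x x = 1}"
    by (intro closed_Collect_eq continuous_intros)
  then show ?thesis
    unfolding eq by (intro compact_Int_closed[OF compact_box] closed_Int assms)
qed

text \<open>First-order condition at a maximum: a linear term in t cannot be dominated by a
  quadratic one near 0. The value t = a / b already gives the contradiction.\<close>

lemma quadratic_nonneg_imp: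
  fixes a b :: real
  assumes "\<And>t. 2 * t * a \<le> t\<^sup>2 * b" "a \<ge> 0" shows "a = 0"
proof (rule ccontr)
  assume "a \<noteq> 0"
  then have a: "a > 0" using assms by simp
  have b: "b > 0" using assms(1)[of 1] a by simp
  have "2 * (a / b) * a \<le> (a / b)\<^sup>2 * b" by (rule assms)
  then have "2 * a\<^sup>2 \<le> a\<^sup>2" using b by (simp add: power2_eq_square field_simps)
  then show False using a by simp
qed

text \<open>Variational argument: maximise the quadratic form over the unit vectors orthogonal to
  the eigenvectors found so far. A maximiser exists by compactness, and perturbing it along its
  residual shows that it is an eigenvector.\<close>

lemma next_eigenvector:
  assumes sym: "\<And>i j. i < N \<Longrightarrow> j < N \<Longrightarrow> M i j = M j i"
    and "m < N" and o: "\<And>a b. a < m \<Longrightarrow> b < m \<Longrightarrow> ip N (v a) (v b) = of_bool (a = b)"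
    and e: "\<And>b i. b < m \<Longrightarrow> i < N \<Longrightarrow> mv N M (v b) i = lam b * v b i"
  shows "\<exists>w l. (\<forall>i\<ge>N. w i = 0) \<and> ip N w w = 1 \<and> (\<forall>b<m. ip N (v b) w = 0) \<and> (\<forall>i<N. mv N M w i = l * w i)"
proof -
  define S where "S = {x. (\<forall>i\<ge>N. x i = 0) \<and> ip N x x = 1 \<and> (\<forall>b<m. ip N (v b) x = 0)}"
  let ?q = "\<lambda>x. ip N x (mv N M x)"
  have cq: "continuous_on S ?q" unfolding mv_def by (intro continuous_intros)
  have "closed {x. \<forall>b<m. ip N (v b) x = 0}"
    by (intro closed_Collect_all closed_Collect_imp open_Collect_const closed_Collect_eq continuous_intros)
  from compact_sphere_Int_closed[OF this, of N] have cS: "compact S"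
    by (simp add: S_def)
  obtain w0 where "w0 \<in> S" using bessel_strict[of m N v] assms unfolding S_def by auto
  then obtain w where w: "w \<in> S" and max: "\<And>x. x \<in> S \<Longrightarrow> ?q x \<le> ?q w"
    using continuous_attains_sup[OF cS _ cq] by auto
  define l where "l = ?q w"
  have max': "?q x \<le> l * ip N x x" if x: "\<forall>b<m. ip N (v b) x = 0" for x
  proof (cases "ip N x x = 0")
    case True
    then have "\<forall>i<N. x i = 0" by (simp add: ip_self_eq_0_iff)
    then have "?q x = 0" unfolding ip_def by simp
    then show ?thesis using True by simp
  next
    case False
    define c where "c = sqrt (ip N x x)"
    have c: "c > 0" "ip N x x = c * c" using False ip_nonneg[of N x] by (auto simp: c_def)
    \<comment> \<open>Normalised and also cut off at N, since members of S vanish from N on.\<close>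
    define y where "y = (\<lambda>i. if i < N then inverse c * x i else 0)"
    have y: "ip N y u = inverse c * ip N x u" for u
    proof -
      have "ip N y u = ip N (\<lambda>i. inverse c * x i) u" by (rule ip_cong) (auto simp: y_def)
      then show ?thesis by (simp add: ip_simps)
    qed
    have m: "mv N M y = (\<lambda>i. inverse c * mv N M x i)"
      by (rule ext) (simp add: mv_def y_def sum_distrib_left algebra_simps)
    have yv: "ip N (v b) y = inverse c * ip N (v b) x" for b
      using y[of "v b"] by (simp add: ip_commute)
    have "ip N y y = 1" unfolding y ip_commute[of N x y] y using c by (simp add: field_simps)
    then have "y \<in> S"
      unfolding S_def using x y by (auto simp: yv) (simp add: y_def)
    from max[OF this] have "inverse c * (inverse c * ?q x) \<le> l"
      unfolding m y l_def by (simp add: ip_simps)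
    then have "?q x \<le> l * (c * c)" using c(1) by (simp add: field_simps)
    then show ?thesis by (simp add: c(2))
  qed
  \<comment> \<open>The residual is orthogonal to w because l is the Rayleigh quotient, and to each
    v b because v b is an eigenvector of a symmetric matrix. So w + t z remains admissible for
    \<open>max'\<close>.\<close>
  define z where "z = (\<lambda>i. mv N M w i - l * w i)"
  have w1: "ip N w w = 1" and wv: "\<And>b. b < m \<Longrightarrow> ip N (v b) w = 0" using w by (auto simp: S_def)
  have zw: "ip N w z = 0" unfolding z_def ip_simps w1 l_def by simp
  have zv: "ip N (v b) z = 0" if "b < m" for b
  proof -
    have "ip N (v b) (mv N M w) = ip N (mv N M (v b)) w" by (rule ip_mv_sym[OF sym])
    also have "\<dots> = ip N (\<lambda>i. lam b * v b i) w" by (rule ip_cong) (use e that in auto)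
    also have "\<dots> = 0" using wv that by (simp add: ip_simps)
    finally show ?thesis unfolding z_def using wv that by (simp add: ip_simps)
  qed
  have zMw: "ip N z (mv N M w) = ip N z z"
  proof -
    have "ip N z z = ip N z (mv N M w) - l * ip N z w" by (subst (2) z_def) (simp add: ip_simps)
    then show ?thesis using zw by (simp add: ip_commute)
  qed
  \<comment> \<open>Expansion in t of the Rayleigh inequality at w + t z: the terms of order 0
    cancel, and the linear coefficient is twice the squared length of z.\<close>
  have "2 * t * ip N z z \<le> t\<^sup>2 * (l * ip N z z - ?q z)" for t
  proof -
    let ?x = "\<lambda>i. w i + t * z i"
    have "\<forall>b<m. ip N (v b) ?x = 0" using wv zv by (simp add: ip_simps)
    from max'[OF this] have "?q ?x \<le> l * ip N ?x ?x" .
    moreover have "mv N M ?x = (\<lambda>i. mv N M w i + t * mv N M z i)"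
      by (rule ext) (simp add: mv_def sum_distrib_left sum.distrib algebra_simps)
    moreover have "ip N w (mv N M z) = ip N z z"
      using ip_mv_sym[OF sym, where u = w and v = z] zMw by (simp add: ip_commute)
    ultimately show ?thesis using zw zMw w1
      by (simp add: ip_simps ip_commute[of N z w] l_def[symmetric] algebra_simps power2_eq_square)
  qed
  from quadratic_nonneg_imp[OF this ip_nonneg] have "\<forall>i<N. z i = 0" by (simp add: ip_self_eq_0_iff)
  then have "\<forall>i<N. mv N M w i = l * w i" by (simp add: z_def)
  then show ?thesis using w unfolding S_def by blast
qed

text \<open>Iterates \<open>next_eigenvector\<close> up to N vectors. The vanishing beyond N places
  the eigenvectors in the compact sphere used later for measurability.\<close>

theorem spectral_decomposition:
  assumes sym: "\<And>i j. i < N \<Longrightarrow> j < N \<Longrightarrow> M i j = M j i"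
  obtains v lam where "orthogonal_on {..<N} v" "\<And>b i. b < N \<Longrightarrow> i < N \<Longrightarrow> mv N M (v b) i = lam b * v b i"
    "\<And>b i. b < N \<Longrightarrow> N \<le> i \<Longrightarrow> v b i = 0"
proof -
  have "\<exists>v lam. (\<forall>a<m. \<forall>b<m. ip N (v a) (v b) = of_bool (a = b)) \<and>
     (\<forall>b<m. \<forall>i<N. mv N M (v b) i = lam b * v b i) \<and> (\<forall>b<m. \<forall>i\<ge>N. v b i = 0)" if "m \<le> N" for m
    using that
  proof (induction m)
    case (Suc m)
    then obtain v lam where IH: "\<forall>a<m. \<forall>b<m. ip N (v a) (v b) = of_bool (a = b)"
      "\<forall>b<m. \<forall>i<N. mv N M (v b) i = lam b * v b i" "\<forall>b<m. \<forall>i\<ge>N. v b i = 0" by auto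
    obtain w l where w: "\<forall>i\<ge>N. w i = 0" "ip N w w = 1" "\<forall>b<m. ip N (v b) w = 0"
      "\<forall>i<N. mv N M w i = l * w i"
      using next_eigenvector[where N = N and M = M and m = m and v = v and lam = lam] IH Suc.prems sym by auto
    have w': "\<forall>b<m. ip N w (v b) = 0" using w(3) by (simp add: ip_commute)
    define v' lam' where "v' = v(m := w)" and "lam' = lam(m := l)"
    have o: "ip N (v' a) (v' b) = of_bool (a = b)" if "a < Suc m" "b < Suc m" for a b
      using that IH(1) w(2,3) w' by (cases "a = m"; cases "b = m") (auto simp: v'_def)
    have e: "mv N M (v' b) i = lam' b * v' b i" if "b < Suc m" "i < N" for b i
      using that IH(2) w(4) by (cases "b = m") (auto simp: v'_def lam'_def)
    have z: "v' b i = 0" if "b < Suc m" "N \<le> i" for b i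
      using that IH(3) w(1) by (cases "b = m") (auto simp: v'_def)
    show ?case using o e z by blast
  qed auto
  from this[of N] obtain v lam where "\<forall>a<N. \<forall>b<N. ip N (v a) (v b) = of_bool (a = b)"
    "\<forall>b<N. \<forall>i<N. mv N M (v b) i = lam b * v b i" "\<forall>b<N. \<forall>i\<ge>N. v b i = 0" by auto
  then show ?thesis by (intro that[of v lam]) (auto simp: orthogonal_on_ip)
qed

section \<open>Zero sets of polynomials and simple spectrum\<close>


text \<open>Polynomial functions, taken semantically. Two properties matter: determinants with such
  entries stay in the class, and the restriction to a coordinate line is a univariate
  polynomial.\<close>

inductive_set polyfun :: "(('i \<Rightarrow> real) \<Rightarrow> real) set" where
  const: "(\<lambda>x. c) \<in> polyfun"
| coord: "(\<lambda>x. x i) \<in> polyfun"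
| add: "f \<in> polyfun \<Longrightarrow> g \<in> polyfun \<Longrightarrow> (\<lambda>x. f x + g x) \<in> polyfun"
| mult: "f \<in> polyfun \<Longrightarrow> g \<in> polyfun \<Longrightarrow> (\<lambda>x. f x * g x) \<in> polyfun"

lemma polyfun_sum: "(\<And>a. a \<in> S \<Longrightarrow> f a \<in> polyfun) \<Longrightarrow> (\<lambda>x. \<Sum>a\<in>S. f a x) \<in> polyfun"
  by (induction S rule: infinite_finite_induct) (auto intro: polyfun.intros)

lemma polyfun_prod: "(\<And>a. a \<in> S \<Longrightarrow> f a \<in> polyfun) \<Longrightarrow> (\<lambda>x. \<Prod>a\<in>S. f a x) \<in> polyfun"
  by (induction S rule: infinite_finite_induct) (auto intro: polyfun.intros)

lemma polyfun_det:
  assumes "\<And>i j. i < n \<Longrightarrow> j < n \<Longrightarrow> (\<lambda>x. F x i j) \<in> polyfun"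
  shows "(\<lambda>x. Determinant.det (mat n n (\<lambda>(i, j). F x i j))) \<in> polyfun"
proof -
  have "Determinant.det (mat n n (\<lambda>(i, j). F x i j))
      = (\<Sum>p\<in>{p. p permutes {0..<n}}. signof p * (\<Prod>i\<in>{0..<n}. F x i (p i)))" for x
    unfolding Determinant.det_def
    by (auto intro!: sum.cong prod.cong)
  moreover have "(\<lambda>x. \<Sum>p\<in>{p. p permutes {0..<n}}. signof p * (\<Prod>i\<in>{0..<n}. F x i (p i))) \<in> polyfun"
    by (intro polyfun_sum polyfun.mult polyfun.const polyfun_prod assms) (auto simp: permutes_in_image)
  ultimately show ?thesis by simp
qed

lemma polyfun_upd: "f \<in> polyfun \<Longrightarrow> (\<lambda>x. f (x(i := a))) \<in> polyfun"
proof (induction rule: polyfun.induct)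
  case (coord j)
  then show ?case by (cases "j = i") (auto intro: polyfun.intros)
qed (auto intro: polyfun.intros)

lemma polyfun_poly: "f \<in> polyfun \<Longrightarrow> \<exists>q. \<forall>t. f (x(i := t)) = poly q t"
proof (induction rule: polyfun.induct)
  case (const c) show ?case by (rule exI[of _ "[:c:]"]) simp
next
  case (coord j) show ?case
    by (cases "j = i") (rule exI[of _ "if j = i then [:0, 1:] else [:x j:]"], simp)+
next
  case (add f g) then show ?case by (metis poly_add)
next
  case (mult f g) then show ?case by (metis poly_mult)
qed

lemma polyfun_measurable: "f \<in> polyfun \<Longrightarrow> f \<in> borel_measurable (gauss I)"
proof (induction rule: polyfun.induct)
  case (coord i)
  show ?case
  proof (cases "i \<in> I")
    case True
    then have "(\<lambda>x. x i) \<in> borel_measurable (PiM I (\<lambda>_. borel :: real measure))" by simp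
    then show ?thesis by measurable
  next
    \<comment> \<open>Outside I every point of the space takes the value \<open>undefined\<close>,
      so the coordinate is constant there.\<close>
    case False
    have "(\<lambda>x. x i) \<in> borel_measurable (gauss I) \<longleftrightarrow> (\<lambda>x. undefined :: real) \<in> borel_measurable (gauss I)"
      by (rule measurable_cong) (use False in \<open>auto simp: space_gauss PiE_def extensional_def\<close>)
    then show ?thesis by simp
  qed
qed auto

text \<open>Fubini, one coordinate at a time. Freezing coordinate i at its value in the witness p
  gives a polynomial that is almost surely nonzero by induction; then, as a function of coordinate
  i, f is a nonzero univariate polynomial and has only finitely many roots.\<close>

proposition polyfun_AE_nonzero:
  assumes "finite I" "f \<in> polyfun" "p \<in> space (gauss I)" "f p \<noteq> 0"
  shows "AE x in gauss I. f x \<noteq> 0"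
  using assms
proof (induction I arbitrary: f p rule: finite_induct)
  case empty
  then show ?case by (intro AE_I2) (auto simp: space_gauss)
next
  case (insert i J)
  note [measurable] = polyfun_measurable
  define g where "g = (\<lambda>x. f (x(i := p i)))"
  let ?N = "density lborel (\<lambda>x. ennreal (std_normal_density x))"
  have g: "g \<in> polyfun" unfolding g_def by (rule polyfun_upd) fact
  have p': "p(i := undefined) \<in> space (gauss J)"
    using insert.prems(2) insert.hyps by (auto simp: space_gauss PiE_def extensional_def)
  have "g (p(i := undefined)) \<noteq> 0" using insert.prems(3) by (simp add: g_def)
  from insert.IH[OF g p' this] have AEg: "AE x in gauss J. g x \<noteq> 0" .
  have "(\<integral>\<^sup>+x. indicator {x. f x = 0} x \<partial>gauss (insert i J))
      = (\<integral>\<^sup>+x. (\<integral>\<^sup>+y. indicator {x. f x = 0} (x(i := y)) \<partial>?N) \<partial>gauss J)"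
    using insert.hyps by (intro nn_integral_gauss_insert) (use polyfun_measurable[OF insert.prems(1)] in measurable)
  also have "\<dots> = (\<integral>\<^sup>+x. 0 \<partial>gauss J)"
  proof (rule nn_integral_cong_AE)
    show "AE x in gauss J. (\<integral>\<^sup>+y. indicator {x. f x = 0} (x(i := y)) \<partial>?N) = (0::ennreal)"
      using AEg
    proof eventually_elim
      case (elim x)
      obtain q where q: "\<And>t. f (x(i := t)) = poly q t" using polyfun_poly[OF insert.prems(1)] by metis
      have "q \<noteq> 0" using elim q[of "p i"] by (auto simp: g_def)
      then have fin: "finite {t. poly q t = 0}" by (rule poly_roots_finite)
      have "AE t in lborel. t \<notin> {t. poly q t = 0}"
        by (intro AE_not_in finite_imp_null_set_lborel fin)
      then have "AE t in ?N. t \<notin> {t. poly q t = 0}"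
        by (subst AE_density) auto
      then have "(\<integral>\<^sup>+y. indicator {x. f x = 0} (x(i := y)) \<partial>?N) = (\<integral>\<^sup>+y. 0 \<partial>?N)"
        by (intro nn_integral_cong_AE) (auto simp: q)
      then show ?case by simp
    qed
  qed
  finally have "(\<integral>\<^sup>+x. indicator {x. f x = 0} x \<partial>gauss (insert i J)) = 0" by simp
  then have "AE x in gauss (insert i J). indicator {x. f x = 0} x = (0::ennreal)"
    by (subst (asm) nn_integral_0_iff_AE) (use polyfun_measurable[OF insert.prems(1)] in measurable)
  then show ?case by (auto simp: indicator_def)
qed

section \<open>Unit eigenvectors of a matrix with simple spectrum\<close>

lemma eigenbasis_ip:
  assumes o: "orthogonal_on {..<N} u"
    and e: "\<And>b i. b < N \<Longrightarrow> i < N \<Longrightarrow> mv N H (u b) i = lam b * u b i"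
    and v: "\<And>i. i < N \<Longrightarrow> mv N H v i = l * v i" and b: "b < N"
  shows "ip N (u b) v * (lam b - l) = 0"
proof -
  have "mv N H v i = (\<Sum>a<N. ip N (u a) v * (lam a * u a i))" if i: "i < N" for i
  proof -
    have "mv N H v i = (\<Sum>j<N. H i j * (\<Sum>a<N. ip N (u a) v * u a j))"
      unfolding mv_def by (intro sum.cong refl) (metis lessThan_iff o orthonormal_expand)
    also have "\<dots> = (\<Sum>a<N. ip N (u a) v * mv N H (u a) i)"
      unfolding mv_def by (simp add: sum_distrib_left) (subst sum.swap, simp add: algebra_simps)
    finally show ?thesis using e i by simp
  qed
  then have "l * ip N (u b) v = ip N (u b) (\<lambda>i. \<Sum>a<N. ip N (u a) v * (lam a * u a i))"
    unfolding ip_scale_right[symmetric] by (intro ip_cong) (simp_all add: v[symmetric])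
  also have "\<dots> = (\<Sum>a<N. if a = b then ip N (u a) v * lam a else 0)"
    unfolding ip_simps using o b by (intro sum.cong) (auto simp: orthogonal_on_ip)
  finally show ?thesis using b by (auto simp: algebra_simps)
qed

lemma is_eigvec_mv: "is_eigvec N H l v \<longleftrightarrow> (\<exists>i<N. v i \<noteq> 0) \<and> (\<forall>i<N. mv N H v i = l * v i)"
  by (simp add: is_eigvec_def mv_def)

lemma eigenvalues_eigenbasis:
  assumes o: "orthogonal_on {..<N} u"
    and e: "\<And>b i. b < N \<Longrightarrow> i < N \<Longrightarrow> mv N H (u b) i = lam b * u b i"
  shows "eigenvalues N H = lam ` {..<N}"
proof (intro Set.set_eqI iffI)
  fix l assume "l \<in> eigenvalues N H"
  then obtain v where v: "\<exists>i<N. v i \<noteq> 0" "\<And>i. i < N \<Longrightarrow> mv N H v i = l * v i"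
    by (auto simp: eigenvalues_def is_eigvec_mv)
  have "\<exists>b<N. ip N (u b) v \<noteq> 0"
  proof (rule ccontr)
    assume "\<not> ?thesis"
    then have "v i = 0" if "i < N" for i
      using orthonormal_expand[OF o that, of v] by simp
    then show False using v by auto
  qed
  then show "l \<in> lam ` {..<N}"
    using eigenbasis_ip[OF o e v(2)] by force
next
  fix l assume "l \<in> lam ` {..<N}"
  then obtain b where b: "b < N" "l = lam b" by auto
  have "ip N (u b) (u b) = 1" using o b by (simp add: orthogonal_on_ip)
  then have "\<exists>i<N. u b i \<noteq> 0" using ip_self_eq_0_iff[of N "u b"] by auto
  then show "l \<in> eigenvalues N H"
    using e b unfolding eigenvalues_def is_eigvec_mv by blast
qed

text \<open>When the eigenvalues are distinct, every eigenspace is a line, so unit eigenvectors are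
  + or - some u b. A function that ignores the sign and the entries beyond N therefore takes exactly
  the values F (u b); this makes the choice-free set \<open>unit_eigvecs\<close> computable from any
  eigenbasis.\<close>

lemma unit_eigvecs_image:
  assumes o: "orthogonal_on {..<N} u"
    and e: "\<And>b i. b < N \<Longrightarrow> i < N \<Longrightarrow> mv N H (u b) i = lam b * u b i"
    and inj: "inj_on lam {..<N}"
    and F: "\<And>v w. (\<And>i. i < N \<Longrightarrow> v i = w i) \<Longrightarrow> F v = F w" "\<And>v. F (\<lambda>i. - v i) = F v"
  shows "F ` unit_eigvecs N H = (\<lambda>b. F (u b)) ` {..<N}"
proof (intro Set.set_eqI iffI)
  fix y assume "y \<in> F ` unit_eigvecs N H"
  then obtain v l where v: "y = F v" "\<exists>i<N. v i \<noteq> 0" "\<And>i. i < N \<Longrightarrow> mv N H v i = l * v i"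
    "ip N v v = 1" by (auto simp: unit_eigvecs_def is_eigvec_mv ip_def power2_eq_square)
  have "l \<in> eigenvalues N H" using v by (auto simp: eigenvalues_def is_eigvec_mv)
  then obtain b where b: "b < N" "l = lam b" using eigenvalues_eigenbasis[OF o e] by auto
  have z: "ip N (u a) v = 0" if "a < N" "a \<noteq> b" for a
  proof -
    have "lam a \<noteq> lam b" using inj that b by (auto simp: inj_on_def)
    then show ?thesis using eigenbasis_ip[OF o e v(3) that(1)] b by simp
  qed
  define t where "t = ip N (u b) v"
  have vi: "v i = t * u b i" if "i < N" for i
  proof -
    have "v i = (\<Sum>a<N. ip N (u a) v * u a i)" by (rule orthonormal_expand[OF o that])
    also have "\<dots> = (\<Sum>a<N. if a = b then ip N (u a) v * u a i else 0)"
      using z by (intro sum.cong) auto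
    finally show ?thesis using b by (simp add: t_def)
  qed
  have "ip N v v = ip N (\<lambda>i. t * u b i) (\<lambda>i. t * u b i)" by (rule ip_cong) (use vi in auto)
  also have "\<dots> = t\<^sup>2" using o b by (simp add: ip_simps orthogonal_on_ip power2_eq_square)
  finally have "t = 1 \<or> t = -1" using v by (simp add: power2_eq_1_iff)
  then have "F v = F (u b)"
  proof
    assume "t = 1" then show ?thesis using vi by (intro F(1)) simp
  next
    assume "t = -1"
    then have "F v = F (\<lambda>i. - u b i)" using vi by (intro F(1)) simp
    then show ?thesis by (simp add: F(2))
  qed
  then show "y \<in> (\<lambda>b. F (u b)) ` {..<N}" using v b by auto
next
  fix y assume "y \<in> (\<lambda>b. F (u b)) ` {..<N}"
  then obtain b where b: "b < N" "y = F (u b)" by auto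
  define w where "w = (\<lambda>i. if i < N then u b i else 0)"
  have 1: "ip N (u b) (u b) = 1" using o b by (simp add: orthogonal_on_ip)
  have "ip N w w = ip N (u b) (u b)" by (rule ip_cong) (auto simp: w_def)
  moreover have "\<exists>i<N. u b i \<noteq> 0" using 1 ip_self_eq_0_iff[of N "u b"] by auto
  moreover have "mv N H w = mv N H (u b)" unfolding mv_def w_def by (intro ext sum.cong) auto
  ultimately have "w \<in> unit_eigvecs N H"
    using 1 e b unfolding unit_eigvecs_def is_eigvec_mv
    by (auto simp: w_def ip_def power2_eq_square intro!: exI[of _ "lam b"])
  moreover have "F w = y" unfolding b by (rule F(1)) (simp add: w_def)
  ultimately show "y \<in> F ` unit_eigvecs N H" by blast
qed

lemma qform_uminus: "qform N A (\<lambda>i. - v i) = qform N A v"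
  unfolding qform_def by simp

lemma inj_on_eigenbasis_if_card:
  assumes "orthogonal_on {..<N} u"
    and "\<And>b i. b < N \<Longrightarrow> i < N \<Longrightarrow> mv N H (u b) i = lam b * u b i"
    and "card (eigenvalues N H) = N"
  shows "inj_on lam {..<N}"
proof (rule eq_card_imp_inj_on)
  have "eigenvalues N H = lam ` {..<N}" by (rule eigenvalues_eigenbasis[OF assms(1,2)])
  then show "card (lam ` {..<N}) = card {..<N}" using assms(3) by simp
qed simp

text \<open>The vectors H^k 1, with 1 the all-ones vector. Their determinant is a polynomial in the
  entries of H whose nonvanishing certifies a simple spectrum, a role that the discriminant could
  also play.\<close>

primrec krylov :: "nat \<Rightarrow> (nat \<Rightarrow> nat \<Rightarrow> real) \<Rightarrow> nat \<Rightarrow> nat \<Rightarrow> real" where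
  "krylov N H 0 = (\<lambda>i. 1)"
| "krylov N H (Suc k) = mv N H (krylov N H k)"

text \<open>If the all-ones vector is cyclic for a symmetric matrix, then no eigenvector is orthogonal to it,
  so all eigenspaces are lines.\<close>

lemma simple_spectrum_if_cyclic:
  assumes sym: "\<And>i j. i < N \<Longrightarrow> j < N \<Longrightarrow> H i j = H j i"
    and det: "Determinant.det (mat N N (\<lambda>(k, i). krylov N H k i)) \<noteq> 0"
  shows "card (eigenvalues N H) = N"
proof -
  obtain u lam where o: "orthogonal_on {..<N} u"
    and e: "\<And>b i. b < N \<Longrightarrow> i < N \<Longrightarrow> mv N H (u b) i = lam b * u b i"
    using spectral_decomposition[of N H] sym by metis
  \<comment> \<open>An eigenvector orthogonal to the all-ones vector is orthogonal to all of its
    images under powers of H, hence lies in the kernel of the Krylov matrix.\<close>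
  have key: False if w: "\<exists>i<N. w i \<noteq> 0" "\<And>i. i < N \<Longrightarrow> mv N H w i = l * w i" "ip N w (\<lambda>i. 1) = 0" for w l
  proof -
    have k: "ip N w (krylov N H k) = 0" for k
    proof (induction k)
      case (Suc k)
      have "ip N w (krylov N H (Suc k)) = ip N (mv N H w) (krylov N H k)"
        using ip_mv_sym[of N H w "krylov N H k"] sym by simp
      also have "\<dots> = ip N (\<lambda>i. l * w i) (krylov N H k)" by (rule ip_cong) (use w in auto)
      also have "\<dots> = 0" using Suc by (simp add: ip_simps)
      finally show ?case .
    qed (use w in simp)
    let ?K = "mat N N (\<lambda>(k, i). krylov N H k i)"
    have "?K *\<^sub>v vec N w = 0\<^sub>v N"
    proof (rule eq_vecI)
      fix i assume "i < dim_vec (0\<^sub>v N :: real vec)"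
      then show "(?K *\<^sub>v vec N w) $ i = 0\<^sub>v N $ i"
        using k[of i] by (simp add: scalar_prod_def ip_def atLeast0LessThan mult.commute)
    qed simp
    moreover have "vec N w \<noteq> 0\<^sub>v N"
      using w(1) by (metis index_vec index_zero_vec(1))
    moreover have "?K \<in> carrier_mat N N" by simp
    ultimately show False using det det_0_iff_vec_prod_zero[of ?K N] vec_carrier[of N w] by blast
  qed
  have "inj_on lam {..<N}"
  proof (rule inj_onI, rule ccontr)
    fix a b assume ab: "a \<in> {..<N}" "b \<in> {..<N}" "lam a = lam b" "a \<noteq> b"
    define s t where "s = ip N (u a) (\<lambda>i. 1)" and "t = ip N (u b) (\<lambda>i. 1)"
    have nz: "\<exists>i<N. u c i \<noteq> 0" if "c < N" for c
    proof -
      have "ip N (u c) (u c) = 1" using o that by (simp add: orthogonal_on_ip)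
      then show ?thesis using ip_self_eq_0_iff[of N "u c"] by auto
    qed
    show False
    proof (cases "s = 0")
      case True
      show False by (rule key[of "u a" "lam a"]) (use ab nz e True in \<open>auto simp: s_def\<close>)
    next
      case False
      \<comment> \<open>The combination of the two eigenvectors for the common eigenvalue that is
        orthogonal to the all-ones vector; its component along u b is s, so it is nonzero.\<close>
      define w where "w = (\<lambda>i. s * u b i - t * u a i)"
      show False
      proof (rule key[of w "lam b"])
        have "ip N w (u b) = s" unfolding w_def using o ab by (simp add: ip_simps orthogonal_on_ip)
        then show "\<exists>i<N. w i \<noteq> 0" using False unfolding ip_def by (metis (no_types, lifting) lessThan_iff mult_zero_left sum.neutral)
        show "ip N w (\<lambda>i. 1) = 0" unfolding w_def ip_simps by (simp add: s_def t_def)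
        fix i assume i: "i < N"
        have "mv N H w i = s * mv N H (u b) i - t * mv N H (u a) i"
          unfolding mv_def w_def by (simp add: sum_subtractf sum_distrib_left algebra_simps)
        then show "mv N H w i = lam b * w i"
          using e i ab by (simp add: w_def algebra_simps)
      qed
    qed
  qed
  then show ?thesis by (simp add: eigenvalues_eigenbasis[OF o e] card_image)
qed

text \<open>Supplies the point where the Krylov determinant is nonzero: for the diagonal matrix with
  entries 0, ..., N - 1 it is a Vandermonde determinant with distinct nodes.\<close>

lemma krylov_diag:
  assumes "\<And>i j. i < N \<Longrightarrow> j < N \<Longrightarrow> H i j = (if i = j then real i else 0)" "i < N"
  shows "krylov N H k i = real i ^ k"
  using assms(2)
proof (induction k arbitrary: i)
  case (Suc k)
  have "krylov N H (Suc k) i = (\<Sum>j<N. if j = i then real i * real i ^ k else 0)"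
    unfolding krylov.simps mv_def using Suc assms(1) by (intro sum.cong) auto
  then show ?case using Suc.prems by simp
qed simp

text \<open>A kernel vector of the transpose is the coefficient list of a polynomial of degree below
  N that vanishes at the N points 0, ..., N - 1.\<close>

lemma det_vandermonde_nonzero:
  "Determinant.det (mat N N (\<lambda>(k, i). real i ^ k)) \<noteq> 0"
proof
  let ?K = "mat N N (\<lambda>(k, i). real i ^ k)"
  assume "Determinant.det ?K = 0"
  then have "Determinant.det (transpose_mat ?K) = 0"
    by (subst det_transpose[of _ N]) auto
  moreover have "transpose_mat ?K \<in> carrier_mat N N" by simp
  ultimately obtain v where v: "v \<in> carrier_vec N" "v \<noteq> 0\<^sub>v N" "transpose_mat ?K *\<^sub>v v = 0\<^sub>v N"
    using det_0_iff_vec_prod_zero by blast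
  define p where "p = (\<Sum>k<N. monom (v $ k) k)"
  have c: "coeff p k = (if k < N then v $ k else 0)" for k
    by (simp add: p_def coeff_sum)
  have r: "poly p (real i) = 0" if "i < N" for i
  proof -
    have "(transpose_mat ?K *\<^sub>v v) $ i = (\<Sum>k<N. real i ^ k * v $ k)"
      using that v(1) by (simp add: scalar_prod_def atLeast0LessThan)
    then show ?thesis using v(3) that by (simp add: p_def poly_sum poly_monom mult.commute)
  qed
  have "p \<noteq> 0"
  proof
    assume "p = 0"
    then have "v $ k = 0" if "k < N" for k using c[of k] that by simp
    then have "v = 0\<^sub>v N" using v(1) by (intro eq_vecI) auto
    then show False using v(2) by simp
  qed
  have "degree p < N"
  proof (rule ccontr)
    assume "\<not> degree p < N"
    then have "lead_coeff p = 0" using c[of "degree p"] by simp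
    then show False using \<open>p \<noteq> 0\<close> by simp
  qed
  moreover have "card (real ` {..<N}) \<le> card {x. poly p x = 0}"
    using r poly_roots_finite[OF \<open>p \<noteq> 0\<close>] by (intro card_mono) auto
  ultimately show False
    using card_poly_roots_bound[OF \<open>p \<noteq> 0\<close>] by (simp add: card_image)
qed

section \<open>Orthogonal invariance of the GOE\<close>


lemma density_normal_eq_distr:
  assumes "0 < \<sigma>"
  shows "density lborel (normal_density 0 \<sigma>) = distr (density lborel std_normal_density) borel (\<lambda>x. \<sigma> * x)"
proof -
  have "distributed (density lborel std_normal_density) lborel (\<lambda>x. x) std_normal_density"
    unfolding distributed_def by (auto simp: distr_id2)
  from prob_space.normal_density_affine[OF prob_space_normal_density this, of \<sigma> 0] assms
  have "distributed (density lborel std_normal_density) lborel (\<lambda>x. \<sigma> * x) (normal_density 0 \<sigma>)"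
    by simp
  then have "distr (density lborel std_normal_density) lborel (\<lambda>x. \<sigma> * x) = density lborel (normal_density 0 \<sigma>)"
    by (simp add: distributed_def)
  moreover have "distr (density lborel std_normal_density) lborel (\<lambda>x. \<sigma> * x)
      = distr (density lborel std_normal_density) borel (\<lambda>x. \<sigma> * x)"
    by (rule distr_cong) auto
  ultimately show ?thesis by simp
qed

definition scale :: "'i set \<Rightarrow> ('i \<Rightarrow> real) \<Rightarrow> ('i \<Rightarrow> real) \<Rightarrow> 'i \<Rightarrow> real" where
  "scale I \<sigma> z = (\<lambda>i\<in>I. \<sigma> i * z i)"

lemma measurable_scale [measurable]: "scale I \<sigma> \<in> gauss I \<rightarrow>\<^sub>M PiM I (\<lambda>_. borel)"
proof -
  have "scale I \<sigma> \<in> PiM I (\<lambda>_. borel) \<rightarrow>\<^sub>M PiM I (\<lambda>_. borel)"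
    unfolding scale_def by (intro measurable_restrict) auto
  then show ?thesis by measurable
qed

lemma PiM_normal_eq_distr:
  assumes "finite I" and \<sigma>: "\<And>i. 0 < \<sigma> i"
  shows "PiM I (\<lambda>i. density lborel (normal_density 0 (\<sigma> i))) = distr (gauss I) (PiM I (\<lambda>_. borel)) (scale I \<sigma>)"
proof -
  let ?M = "\<lambda>i. density lborel (\<lambda>x. ennreal (normal_density 0 (\<sigma> i) x))"
  interpret M: product_prob_space ?M I
    by (intro product_prob_spaceI prob_space_normal_density \<sigma>)
  have "distr (gauss I) (PiM I (\<lambda>_. borel)) (scale I \<sigma>) = PiM I ?M"
  proof (rule M.PiM_eqI)
    show "sets (distr (gauss I) (PiM I (\<lambda>_. borel)) (scale I \<sigma>)) = sets (PiM I ?M)"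
      by (simp cong: sets_PiM_cong)
    fix A assume "\<And>i. i \<in> I \<Longrightarrow> A i \<in> sets (?M i)"
    then have A: "\<And>i. i \<in> I \<Longrightarrow> A i \<in> sets borel" by simp
    have v: "scale I \<sigma> -` PiE I A \<inter> space (gauss I) = PiE I (\<lambda>i. (\<lambda>x. \<sigma> i * x) -` A i)"
      by (auto simp: scale_def space_gauss PiE_def Pi_def)
    have m: "(\<lambda>x. \<sigma> i * x) -` A i \<in> sets borel" if "i \<in> I" for i
      using measurable_sets[of "\<lambda>x. \<sigma> i * x" borel borel, OF _ A[OF that]] by simp
    have "emeasure (distr (gauss I) (PiM I (\<lambda>_. borel)) (scale I \<sigma>)) (PiE I A)
        = emeasure (gauss I) (PiE I (\<lambda>i. (\<lambda>x. \<sigma> i * x) -` A i))"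
      by (subst emeasure_distr) (use A assms(1) v in \<open>auto intro!: sets_PiM_I_finite\<close>)
    also have "\<dots> = (\<Prod>i\<in>I. emeasure (density lborel std_normal_density) ((\<lambda>x. \<sigma> i * x) -` A i))"
      unfolding gauss_def using m assms(1) by (subst std.emeasure_PiM) auto
    also have "\<dots> = (\<Prod>i\<in>I. emeasure (?M i) (A i))"
      unfolding density_normal_eq_distr[OF \<sigma>] using A
      by (intro prod.cong refl) (subst emeasure_distr; simp)
    finally show "emeasure (distr (gauss I) (PiM I (\<lambda>_. borel)) (scale I \<sigma>)) (PiE I A)
        = (\<Prod>i\<in>I. emeasure (?M i) (A i))" .
  qed (use assms in auto)
  then show ?thesis by simp
qed

section \<open>The GOE as a scaled standard Gaussian vector\<close>

definition goe_sd :: "nat \<Rightarrow> nat \<times> nat \<Rightarrow> real" where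
  "goe_sd N p = sqrt ((if fst p = snd p then 2 else 1) / real N)"

lemma finite_goe_index [simp]: "finite (goe_index N)"
  by (rule finite_subset[of _ "{..<N} \<times> {..<N}"]) (auto simp: goe_index_def)

lemma goe_sd_pos: "1 \<le> N \<Longrightarrow> 0 < goe_sd N p"
  by (simp add: goe_sd_def)

lemma goe_eq_distr:
  assumes "1 \<le> N"
  shows "goe N = distr (gauss (goe_index N)) (PiM (goe_index N) (\<lambda>_. borel)) (scale (goe_index N) (goe_sd N))"
proof -
  have "goe N = PiM (goe_index N) (\<lambda>p. density lborel (normal_density 0 (goe_sd N p)))"
    unfolding goe_def by (intro PiM_cong) (auto simp: goe_sd_def)
  then show ?thesis using PiM_normal_eq_distr[of "goe_index N" "goe_sd N"] goe_sd_pos[OF assms] by simp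
qed

lemma sets_goe [measurable_cong]: "sets (goe N) = sets (PiM (goe_index N) (\<lambda>_. borel))"
  unfolding goe_def by (intro sets_PiM_cong) auto

lemma prob_space_goe: assumes "1 \<le> N" shows "prob_space (goe N)"
proof -
  interpret prob_space "gauss (goe_index N)" by (rule prob_space_gauss)
  show ?thesis unfolding goe_eq_distr[OF assms] by (rule prob_space_distr) simp
qed

text \<open>Translates between formulas for the full matrix, where sums factor, and the sample
  space, which holds only the independent entries on and above the diagonal.\<close>

lemma sum_square_eq_goe_index:
  fixes f :: "nat \<Rightarrow> nat \<Rightarrow> real"
  shows "(\<Sum>k<N. \<Sum>l<N. f k l) = (\<Sum>(k, l)\<in>goe_index N. if k = l then f k k else f k l + f l k)"
proof -
  define L where "L = {(k, l). l < k \<and> k < N}"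
  define U where "U = {(k, l). k < l \<and> l < N}"
  have fin: "finite L" "finite U"
    by (rule finite_subset[of _ "{..<N} \<times> {..<N}"]; auto simp: L_def U_def)+
  have S: "{..<N} \<times> {..<N} = goe_index N \<union> L" "goe_index N \<inter> L = {}"
    by (auto simp: goe_index_def L_def)
  have "(\<Sum>k<N. \<Sum>l<N. f k l) = (\<Sum>(k, l)\<in>goe_index N \<union> L. f k l)"
    by (simp only: sum.cartesian_product S(1))
  also have "\<dots> = (\<Sum>(k, l)\<in>goe_index N. f k l) + (\<Sum>(k, l)\<in>L. f k l)"
    by (rule sum.union_disjoint) (use fin S in auto)
  also have "(\<Sum>(k, l)\<in>L. f k l) = (\<Sum>(k, l)\<in>U. f l k)"
    by (rule sum.reindex_bij_witness[of _ prod.swap prod.swap]) (auto simp: L_def U_def)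
  also have "\<dots> = (\<Sum>(k, l)\<in>goe_index N. if k = l then 0 else f l k)"
    by (rule sum.mono_neutral_cong_left[OF finite_goe_index]) (auto simp: U_def goe_index_def split: if_splits)
  finally show ?thesis
    unfolding sum.distrib[symmetric] by (simp only:) (intro sum.cong refl, auto)
qed

text \<open>The matrix \<open>W H W^T\<close>.\<close>

definition conj_mat :: "nat \<Rightarrow> (nat \<Rightarrow> nat \<Rightarrow> real) \<Rightarrow> (nat \<Rightarrow> nat \<Rightarrow> real) \<Rightarrow> nat \<Rightarrow> nat \<Rightarrow> real" where
  "conj_mat N W H i j = (\<Sum>k<N. \<Sum>l<N. W i k * W j l * H k l)"

definition conj_goe :: "nat \<Rightarrow> (nat \<Rightarrow> nat \<Rightarrow> real) \<Rightarrow> (nat \<times> nat \<Rightarrow> real) \<Rightarrow> nat \<times> nat \<Rightarrow> real" where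
  "conj_goe N W g = (\<lambda>p\<in>goe_index N. conj_mat N W (goe_mat g) (fst p) (snd p))"

lemma goe_mat_sym: "goe_mat g i j = goe_mat g j i"
  by (simp add: goe_mat_def min.commute max.commute)

lemma conj_mat_sym:
  assumes "\<And>i j. i < N \<Longrightarrow> j < N \<Longrightarrow> H i j = H j i"
  shows "conj_mat N W H i j = conj_mat N W H j i"
  unfolding conj_mat_def by (subst sum.swap) (intro sum.cong refl, use assms in auto)

lemma goe_mat_conj_goe:
  assumes "i < N" "j < N"
  shows "goe_mat (conj_goe N W g) i j = conj_mat N W (goe_mat g) i j"
proof -
  have "(min i j, max i j) \<in> goe_index N" using assms by (auto simp: goe_index_def)
  then have "conj_goe N W g (min i j, max i j) = conj_mat N W (goe_mat g) (min i j) (max i j)"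
    by (simp add: conj_goe_def)
  then have "goe_mat (conj_goe N W g) i j = conj_mat N W (goe_mat g) (min i j) (max i j)"
    unfolding goe_mat_def[of "conj_goe N W g"] .
  then show ?thesis
    using conj_mat_sym[of N "goe_mat g" W] goe_mat_sym by (cases "i \<le> j") (auto simp: min_def max_def)
qed

text \<open>Conjugation acts linearly on the independent entries. After rescaling them to unit
  variance their sum of squares is N / 2 times the squared Frobenius norm of H, thanks to the
  doubled variance on the diagonal; conjugation preserves that norm, so the rescaled map T is
  orthogonal and invariance of the standard Gaussian applies.\<close>

lemma nn_integral_goe_conj:
  assumes N: "1 \<le> N" and W: "orthogonal_on {..<N} W"
    and f[measurable]: "f \<in> borel_measurable (PiM (goe_index N) (\<lambda>_. borel))"
  shows "(\<integral>\<^sup>+g. f (conj_goe N W g) \<partial>goe N) = (\<integral>\<^sup>+g. f g \<partial>goe N)"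
proof -
  let ?I = "goe_index N"
  define s where "s = goe_sd N"
  \<comment> \<open>c p q is the coefficient of the independent entry q in entry p of the conjugated
    matrix; T is the same map between the coordinates of unit variance.\<close>
  define c where "c = (\<lambda>(i, j) (k, l). if k = l then W i k * W j k else W i k * W j l + W i l * W j k)"
  define T where "T = (\<lambda>p q. s q / s p * c p q)"
  have s: "s p > 0" for p using N by (simp add: s_def goe_sd_pos)
  have sq: "(s p)\<^sup>2 = (if fst p = snd p then 2 else 1) / real N" for p
    by (simp add: s_def goe_sd_def)
  have WW: "(\<Sum>k<N. W i k * W j k) = of_bool (i = j)" if "i < N" "j < N" for i j
    using W that by (auto simp: orthogonal_on_def)
  have fac: "(\<Sum>k<N. \<Sum>l<N. (a k * b k) * (a' l * b' l)) = (\<Sum>k<N. a k * b k) * (\<Sum>l<N. a' l * b' l)" for a b a' b' :: "nat \<Rightarrow> real"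
    by (rule sum_product[symmetric])
  have "orthogonal_on ?I T"
    unfolding orthogonal_on_def
  proof (intro ballI)
    fix p p' assume p: "p \<in> ?I" and p': "p' \<in> ?I"
    obtain i j i' j' where [simp]: "p = (i, j)" "p' = (i', j')" by (metis surj_pair)
    have ij: "i \<le> j" "j < N" "i < N" "i' \<le> j'" "j' < N" "i' < N" using p p' by (auto simp: goe_index_def)
    \<comment> \<open>Symmetrised summand. Folded onto the upper triangle, as h k k or as h k l + h
      l k, it gives (s q)^2 times c p q times c p' q in both cases, so the sum may be taken over the
      full square, where it factors into inner products of rows of W.\<close>
    define h where "h = (\<lambda>k l. (1 / (2 * real N)) * ((W i k * W j l + W i l * W j k) * (W i' k * W j' l + W i' l * W j' k)))"
    have "(\<Sum>q\<in>?I. T p q * T p' q) = (\<Sum>q\<in>?I. (1 / (s p * s p')) * ((s q)\<^sup>2 * c p q * c p' q))"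
      by (intro sum.cong) (simp_all add: T_def power2_eq_square)
    also have "\<dots> = (1 / (s p * s p')) * (\<Sum>(k, l)\<in>?I. if k = l then h k k else h k l + h l k)"
    proof -
      have "(s q)\<^sup>2 * c p q * c p' q = (case q of (k, l) \<Rightarrow> if k = l then h k k else h k l + h l k)" for q
      proof -
        obtain k l where [simp]: "q = (k, l)" by (metis surj_pair)
        show ?thesis
        proof (cases "k = l")
          case False
          have "h l k = h k l" by (simp add: h_def algebra_simps)
          moreover have "(s q)\<^sup>2 * c p q * c p' q = 2 * h k l" using False N by (simp add: sq c_def h_def)
          ultimately show ?thesis using False by simp
        qed (simp add: sq c_def h_def)
      qed
      then show ?thesis unfolding sum_distrib_left by (simp only:)
    qed
    also have "(\<Sum>(k, l)\<in>?I. if k = l then h k k else h k l + h l k) = (\<Sum>k<N. \<Sum>l<N. h k l)"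
      by (rule sum_square_eq_goe_index[symmetric])
    also have "\<dots> = (1 / (2 * real N)) * (\<Sum>k<N. \<Sum>l<N. (W i k * W i' k) * (W j l * W j' l)
       + (W i k * W j' k) * (W j l * W i' l) + (W j k * W i' k) * (W i l * W j' l)
       + (W j k * W j' k) * (W i l * W i' l))"
    proof -
      have "h k l = (1 / (2 * real N)) * ((W i k * W i' k) * (W j l * W j' l)
       + (W i k * W j' k) * (W j l * W i' l) + (W j k * W i' k) * (W i l * W j' l)
       + (W j k * W j' k) * (W i l * W i' l))" for k l
        unfolding h_def by (rule arg_cong[where f = "(*) _"]) (simp only: distrib_left distrib_right mult.assoc mult.left_commute mult.commute add.assoc add.left_commute add.commute)
      then show ?thesis unfolding sum_distrib_left by (simp only:)
    qed
    also have "\<dots> = (1 / real N) * (of_bool (i = i' \<and> j = j') + of_bool (i = j' \<and> j = i'))"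
      unfolding sum.distrib fac WW[OF ij(3) ij(6)] WW[OF ij(2) ij(5)] WW[OF ij(3) ij(5)] WW[OF ij(2) ij(6)]
      using N by (cases "i = i'"; cases "j = j'"; cases "i = j'"; cases "j = i'") auto
    finally have e: "(\<Sum>q\<in>?I. T p q * T p' q)
        = (1 / (s p * s p')) * ((1 / real N) * (of_bool (i = i' \<and> j = j') + of_bool (i = j' \<and> j = i')))" .
    show "(\<Sum>q\<in>?I. T p q * T p' q) = of_bool (p = p')"
    proof (cases "p = p'")
      case True
      have "1 / (s p * s p') = real N / (if i = j then 2 else 1)"
        using sq[of p] True N by (simp add: power2_eq_square)
      then show ?thesis unfolding e using True N by auto
    next
      case False
      then have "\<not> (i = i' \<and> j = j')" by simp
      \<comment> \<open>Because i \<le> j and i' \<le> j', the crossed match would force p = p'. It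
        contributes only on the diagonal, where it accounts for the doubled variance.\<close>
      moreover have "\<not> (i = j' \<and> j = i')" using calculation ij(1,4) by linarith
      ultimately show ?thesis unfolding e using False by (simp del: de_Morgan_conj)
    qed
  qed
  have e: "scale ?I s (lin ?I T z) = conj_goe N W (scale ?I s z)" for z
  proof
    fix p
    show "scale ?I s (lin ?I T z) p = conj_goe N W (scale ?I s z) p"
    proof (cases "p \<in> ?I")
      case True
      obtain i j where [simp]: "p = (i, j)" by (metis surj_pair)
      let ?H = "goe_mat (scale ?I s z)"
      have "conj_goe N W (scale ?I s z) p = (\<Sum>k<N. \<Sum>l<N. W i k * W j l * ?H k l)"
        using True by (simp add: conj_goe_def conj_mat_def)
      also have "\<dots> = (\<Sum>(k, l)\<in>?I. if k = l then W i k * W j k * ?H k k else W i k * W j l * ?H k l + W i l * W j k * ?H l k)"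
        by (rule sum_square_eq_goe_index)
      also have "\<dots> = (\<Sum>q\<in>?I. c p q * (s q * z q))"
      proof (rule sum.cong[OF refl])
        fix q assume q: "q \<in> ?I"
        obtain k l where [simp]: "q = (k, l)" by (metis surj_pair)
        have "k \<le> l" using q by (auto simp: goe_index_def)
        then have "?H k l = s q * z q" "?H l k = s q * z q"
          using q by (auto simp: goe_mat_def scale_def min_def max_def)
        then show "(case q of (k, l) \<Rightarrow> if k = l then W i k * W j k * ?H k k
            else W i k * W j l * ?H k l + W i l * W j k * ?H l k) = c p q * (s q * z q)"
          by (auto simp: c_def distrib_right)
      qed
      also have "\<dots> = s p * (\<Sum>q\<in>?I. T p q * z q)"
        unfolding sum_distrib_left using s[of p] by (intro sum.cong refl) (simp add: T_def)
      finally show ?thesis using True by (simp add: scale_def lin_def)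
    qed (simp add: scale_def conj_goe_def)
  qed
  have m: "conj_goe N W \<in> PiM ?I (\<lambda>_. borel) \<rightarrow>\<^sub>M PiM ?I (\<lambda>_. borel)"
    unfolding conj_goe_def conj_mat_def goe_mat_def
    by (intro measurable_restrict borel_measurable_sum borel_measurable_times borel_measurable_const measurable_component_singleton)
       (auto simp: goe_index_def)
  have "(\<integral>\<^sup>+g. f (conj_goe N W g) \<partial>goe N) = (\<integral>\<^sup>+z. f (conj_goe N W (scale ?I s z)) \<partial>gauss ?I)"
    unfolding goe_eq_distr[OF N] s_def[symmetric]
    by (rule nn_integral_distr) (use measurable_compose[OF m f] in auto)
  also have "\<dots> = (\<integral>\<^sup>+z. f (scale ?I s (lin ?I T z)) \<partial>gauss ?I)" by (simp add: e)
  also have "\<dots> = (\<integral>\<^sup>+z. f (scale ?I s z) \<partial>gauss ?I)"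
    by (rule nn_integral_gauss_orthogonal[where f = "\<lambda>z. f (scale ?I s z)"]) (use \<open>orthogonal_on ?I T\<close> in auto)
  also have "\<dots> = (\<integral>\<^sup>+g. f g \<partial>goe N)"
    unfolding goe_eq_distr[OF N] s_def[symmetric] by (rule nn_integral_distr[symmetric]) auto
  finally show ?thesis .
qed

section \<open>Almost sure simplicity of the GOE spectrum\<close>

lemma polyfun_krylov:
  assumes "\<And>i j. i < N \<Longrightarrow> j < N \<Longrightarrow> (\<lambda>x. H x i j) \<in> polyfun" "i < N"
  shows "(\<lambda>x. krylov N (H x) k i) \<in> polyfun"
  using assms(2)
proof (induction k arbitrary: i)
  case (Suc k)
  then show ?case
    unfolding krylov.simps mv_def by (intro polyfun_sum polyfun.mult assms(1)) auto
qed (simp add: polyfun.const)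

lemma krylov_cong:
  assumes "\<And>i j. i < N \<Longrightarrow> j < N \<Longrightarrow> H i j = H' i j" "i < N"
  shows "krylov N H k i = krylov N H' k i"
  using assms(2)
proof (induction k arbitrary: i)
  case (Suc k)
  then show ?case unfolding krylov.simps mv_def by (intro sum.cong refl) (use assms(1) in auto)
qed simp

text \<open>The Krylov determinant, read as a polynomial in the underlying standard Gaussians, is
  nonzero at one point and hence almost surely.\<close>

lemma AE_goe_simple_spectrum:
  assumes N: "1 \<le> N"
  shows "AE g in goe N. card (eigenvalues N (goe_mat g)) = N"
proof -
  let ?I = "goe_index N"
  define F where "F = (\<lambda>g. Determinant.det (mat N N (\<lambda>(k, i). krylov N (goe_mat g) k i)))"
  have "F \<in> polyfun" unfolding F_def
    by (intro polyfun_det polyfun_krylov) (simp_all add: goe_mat_def polyfun.coord)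
  then have [measurable]: "F \<in> borel_measurable (gauss ?I)" by (rule polyfun_measurable)
  then have mF[measurable]: "F \<in> borel_measurable (PiM ?I (\<lambda>_. borel))" by measurable
  \<comment> \<open>\<open>scale\<close> also resets coordinates outside the index set, so its
    composition with F is not visibly a polynomial. F reads only indexed coordinates and agrees with
    the unrestricted scaling.\<close>
  have fs: "F (scale ?I (goe_sd N) z) = F (\<lambda>p. goe_sd N p * z p)" for z
  proof -
    have k: "krylov N (goe_mat (scale ?I (goe_sd N) z)) k i = krylov N (goe_mat (\<lambda>p. goe_sd N p * z p)) k i"
      if "i < N" for k i
    proof (rule krylov_cong[OF _ that])
      fix i j assume "i < N" "j < N"
      then have "(min i j, max i j) \<in> ?I" by (auto simp: goe_index_def)
      then show "goe_mat (scale ?I (goe_sd N) z) i j = goe_mat (\<lambda>p. goe_sd N p * z p) i j"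
        by (simp add: goe_mat_def scale_def)
    qed
    have "mat N N (\<lambda>(k, i). krylov N (goe_mat (scale ?I (goe_sd N) z)) k i)
        = mat N N (\<lambda>(k, i). krylov N (goe_mat (\<lambda>p. goe_sd N p * z p)) k i)"
      by (rule eq_matI) (auto simp: k)
    then show ?thesis by (simp add: F_def)
  qed
  have "(\<lambda>z. F (\<lambda>p. goe_sd N p * z p)) \<in> polyfun" unfolding F_def
    by (intro polyfun_det polyfun_krylov) (simp_all add: goe_mat_def polyfun.intros)
  \<comment> \<open>The point that scaling sends to the diagonal matrix with entries 0, ..., N -
    1.\<close>
  moreover define z0 where "z0 = (\<lambda>p\<in>?I. if fst p = snd p then real (fst p) / goe_sd N p else 0)"
  moreover have "F (\<lambda>p. goe_sd N p * z0 p) \<noteq> 0"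
  proof -
    have sd0: "goe_sd N p \<noteq> 0" for p using goe_sd_pos[OF N, of p] by simp
    have H: "goe_mat (\<lambda>p. goe_sd N p * z0 p) i j = (if i = j then real i else 0)" if "i < N" "j < N" for i j
      using that sd0 by (auto simp: goe_mat_def z0_def goe_index_def min_def max_def)
    have "mat N N (\<lambda>(k, i). krylov N (goe_mat (\<lambda>p. goe_sd N p * z0 p)) k i) = mat N N (\<lambda>(k, i). real i ^ k)"
      by (rule eq_matI) (auto simp: krylov_diag[OF H])
    then show ?thesis unfolding F_def using det_vandermonde_nonzero by simp
  qed
  ultimately have "AE z in gauss ?I. F (\<lambda>p. goe_sd N p * z p) \<noteq> 0"
    by (intro polyfun_AE_nonzero[where p = z0]) (auto simp: space_gauss)
  then have "AE z in gauss ?I. F (scale ?I (goe_sd N) z) \<noteq> 0" by (simp add: fs)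
  then have "AE g in goe N. F g \<noteq> 0"
    unfolding goe_eq_distr[OF N] by (subst AE_distr_iff) auto
  then show ?thesis
  proof eventually_elim
    case (elim g)
    then show ?case by (intro simple_spectrum_if_cyclic) (auto simp: goe_mat_sym F_def)
  qed
qed

section \<open>Measurability of the eigenvector statistic\<close>


text \<open>The function f lets one argument serve both parts of the theorem: it will be the
  identity or \<open>abs\<close>. The value 0 for a repeated eigenvalue follows
  \<open>eig_max\<close>.\<close>

definition eig_stat :: "(real \<Rightarrow> real) \<Rightarrow> nat \<Rightarrow> (nat \<Rightarrow> nat \<Rightarrow> real) \<Rightarrow> (nat \<Rightarrow> nat \<Rightarrow> real) \<Rightarrow> real" where
  "eig_stat f N A H = (if card (eigenvalues N H) = N
     then Max ((\<lambda>v. f (real N * qform N A v)) ` unit_eigvecs N H) else 0)"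

lemma eig_max_eq_eig_stat: "eig_max N A H = eig_stat (\<lambda>x. x) N A H"
  by (simp add: eig_max_def eig_stat_def)

lemma eig_max_abs_eq_eig_stat: "eig_max_abs N A H = eig_stat abs N A H"
  by (simp add: eig_max_abs_def eig_stat_def abs_mult)

lemma unit_eigvecs_stat_image:
  assumes "orthogonal_on {..<N} u"
    and "\<And>b i. b < N \<Longrightarrow> i < N \<Longrightarrow> mv N H (u b) i = lam b * u b i"
    and "inj_on lam {..<N}"
  shows "(\<lambda>v. f (real N * qform N A v)) ` unit_eigvecs N H = (\<lambda>b. f (real N * qform N A (u b))) ` {..<N}"
  by (rule unit_eigvecs_image[OF assms]) (auto simp: qform_uminus cong: qform_cong)

lemma eig_stat_eigenbasis:
  assumes "orthogonal_on {..<N} u"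
    and "\<And>b i. b < N \<Longrightarrow> i < N \<Longrightarrow> mv N H (u b) i = lam b * u b i"
    and "inj_on lam {..<N}"
  shows "eig_stat f N A H = Max ((\<lambda>b. f (real N * qform N A (u b))) ` {..<N})"
proof -
  have "card (eigenvalues N H) = N"
    using eigenvalues_eigenbasis[of N u H lam] assms by (simp add: card_image)
  moreover have im: "(\<lambda>v. f (real N * qform N A v)) ` unit_eigvecs N H = (\<lambda>b. f (real N * qform N A (u b))) ` {..<N}"
    by (rule unit_eigvecs_stat_image[OF assms])
  ultimately show ?thesis unfolding eig_stat_def im by simp
qed

lemma mv_cong:
  assumes "\<And>i j. i < N \<Longrightarrow> j < N \<Longrightarrow> H i j = H' i j" "\<And>i. i < N \<Longrightarrow> v i = w i" "i < N"
  shows "mv N H v i = mv N H' w i"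
  unfolding mv_def by (intro sum.cong refl) (use assms in auto)

lemma eig_stat_cong:
  assumes "\<And>i j. i < N \<Longrightarrow> j < N \<Longrightarrow> H i j = H' i j"
  shows "eig_stat f N A H = eig_stat f N A H'"
proof -
  have "is_eigvec N H = is_eigvec N H'"
    unfolding is_eigvec_mv fun_eq_iff using mv_cong[of N H H'] assms by simp
  then show ?thesis by (simp add: eig_stat_def eigenvalues_def unit_eigvecs_def)
qed

lemma ip_mv_orthogonal:
  assumes "orthogonal_on {..<N} W"
  shows "ip N (mv N W x) (mv N W y) = ip N x y"
proof -
  have "orthogonal_on {..<N} (\<lambda>i j. W j i)" by (rule orthogonal_on_transpose[OF assms])
  then have *: "ip N (\<lambda>i. W i k) (\<lambda>i. W i l) = of_bool (k = l)" if "k < N" "l < N" for k l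
    using that by (simp add: orthogonal_on_ip)
  have "ip N (mv N W x) (mv N W y) = ip N (\<lambda>i. \<Sum>k<N. x k * W i k) (\<lambda>i. \<Sum>l<N. y l * W i l)"
    unfolding mv_def by (intro ip_cong sum.cong) (simp_all add: mult.commute)
  also have "\<dots> = (\<Sum>k<N. \<Sum>l<N. if l = k then x k * y l else 0)"
    unfolding ip_simps sum_distrib_left by (intro sum.cong refl) (auto simp: *)
  finally show ?thesis by (simp add: ip_def)
qed

lemma mv_conj_mat:
  assumes W: "orthogonal_on {..<N} W"
  shows "mv N (conj_mat N W H) (mv N W x) i = mv N W (mv N H x) i"
proof -
  have "mv N (conj_mat N W H) (mv N W x) i = (\<Sum>j<N. \<Sum>k<N. \<Sum>l<N. W i k * (H k l * (mv N W x j * W j l)))"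
    unfolding mv_def[of N "conj_mat N W H"] conj_mat_def sum_distrib_right by (simp add: mult_ac)
  also have "\<dots> = (\<Sum>k<N. \<Sum>l<N. \<Sum>j<N. W i k * (H k l * (mv N W x j * W j l)))"
    by (subst sum.swap, rule sum.cong[OF refl], rule sum.swap)
  also have "\<dots> = (\<Sum>k<N. W i k * (\<Sum>l<N. H k l * (\<Sum>j<N. mv N W x j * W j l)))"
    by (simp only: sum_distrib_left)
  also have "\<dots> = (\<Sum>k<N. W i k * (\<Sum>l<N. H k l * x l))"
  proof -
    have "(\<Sum>j<N. mv N W x j * W j l) = x l" if "l < N" for l
      using orthonormal_expand[OF W that, of x] by (simp add: mv_def ip_def)
    then show ?thesis by simp
  qed
  finally show ?thesis by (simp add: mv_def)
qed

lemma mv_scale: "(\<And>i. i < N \<Longrightarrow> v i = c * w i) \<Longrightarrow> mv N H v i = c * mv N H w i"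
  unfolding mv_def sum_distrib_left by (intro sum.cong refl) simp

lemma eig_stat_conj_mat:
  assumes o: "orthogonal_on {..<N} u"
    and e: "\<And>b i. b < N \<Longrightarrow> i < N \<Longrightarrow> mv N H (u b) i = lam b * u b i"
    and inj: "inj_on lam {..<N}" and W: "orthogonal_on {..<N} W"
  shows "eig_stat f N A (conj_mat N W H) = Max ((\<lambda>b. f (real N * qform N A (mv N W (u b)))) ` {..<N})"
proof (rule eig_stat_eigenbasis)
  show "orthogonal_on {..<N} (\<lambda>b. mv N W (u b))"
    using o unfolding orthogonal_on_ip by (simp add: ip_mv_orthogonal[OF W])
  show "mv N (conj_mat N W H) (mv N W (u b)) i = lam b * mv N W (u b) i" if "b < N" "i < N" for b i
    unfolding mv_conj_mat[OF W] by (rule mv_scale) (use e that in auto)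
qed fact

text \<open>Projection along a compact factor is a closed map: witnesses for a convergent sequence
  have a convergent subsequence. This eliminates the existential quantifier over eigenvectors in the
  measurability proof.\<close>

lemma closed_Collect_ex_compact:
  fixes C :: "('a::metric_space \<times> 'b::metric_space) set"
  assumes K: "compact K" and C: "closed C"
  shows "closed {x. \<exists>y\<in>K. (x, y) \<in> C}"
  unfolding closed_sequential_limits
proof (intro allI impI, elim conjE)
  fix x l assume x: "\<forall>n. x n \<in> {x. \<exists>y\<in>K. (x, y) \<in> C}" and l: "x \<longlonglongrightarrow> l"
  from x obtain y where y: "\<And>n. y n \<in> K" "\<And>n. (x n, y n) \<in> C" by simp metis
  obtain m r where m: "m \<in> K" "strict_mono r" "(y \<circ> r) \<longlonglongrightarrow> m"
    using K y(1) unfolding compact_def by metis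
  have "(\<lambda>n. ((x \<circ> r) n, (y \<circ> r) n)) \<longlonglongrightarrow> (l, m)"
    using LIMSEQ_subseq_LIMSEQ[OF l m(2)] m(3) by (rule tendsto_Pair)
  then have "(l, m) \<in> C"
    by (rule closed_sequentially[OF C, rotated]) (simp add: y)
  then show "l \<in> {x. \<exists>y\<in>K. (x, y) \<in> C}" using m(1) by blast
qed

definition sphere_fn :: "nat \<Rightarrow> (nat \<Rightarrow> real) set" where
  "sphere_fn N = {v. (\<forall>i\<ge>N. v i = 0) \<and> ip N v v = 1}"

lemma compact_sphere_fn: "compact (sphere_fn N)"
  using compact_sphere_Int_closed[of UNIV N] by (simp add: sphere_fn_def)

lemma unit_eigvecs_alt:
  "v \<in> unit_eigvecs N H \<longleftrightarrow> v \<in> sphere_fn N \<and> (\<exists>l. \<forall>i<N. mv N H v i = l * v i)"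
proof -
  have "\<exists>i<N. v i \<noteq> 0" if "ip N v v = 1"
    using that ip_self_eq_0_iff[of N v] by auto
  moreover have "(\<Sum>i<N. (v i)\<^sup>2) = ip N v v" by (simp add: ip_def power2_eq_square)
  ultimately show ?thesis unfolding unit_eigvecs_def sphere_fn_def is_eigvec_mv by auto
qed

text \<open>Replacing the eigenvalue by the Rayleigh quotient removes the quantifier over the
  unbounded set of eigenvalues and leaves a closed condition on the pair of matrix and
  vector.\<close>

lemma unit_eigvecs_iff:
  "v \<in> unit_eigvecs N H \<longleftrightarrow> v \<in> sphere_fn N \<and> (\<forall>i<N. mv N H v i = ip N v (mv N H v) * v i)"
proof -
  have "ip N v (mv N H v) = l" if "v \<in> sphere_fn N" "\<forall>i<N. mv N H v i = l * v i" for l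
  proof -
    have "ip N v (mv N H v) = ip N v (\<lambda>i. l * v i)" by (rule ip_cong) (use that in auto)
    then show ?thesis using that(1) by (simp add: ip_simps sphere_fn_def)
  qed
  then show ?thesis unfolding unit_eigvecs_alt by metis
qed

lemma continuous_on_goe_mat [continuous_intros]:
  "continuous_on S h \<Longrightarrow> continuous_on S (\<lambda>x. goe_mat (h x) i j)"
  unfolding goe_mat_def by (rule continuous_on_product_then_coordinatewise)

lemma continuous_on_fst_apply [continuous_intros]:
  "continuous_on S h \<Longrightarrow> continuous_on S (\<lambda>x. fst (h x) (i::nat) :: real)"
  by (rule continuous_on_product_then_coordinatewise[OF continuous_on_fst])

lemma continuous_on_snd_apply [continuous_intros]:
  "continuous_on S h \<Longrightarrow> continuous_on S (\<lambda>x. snd (h x) (i::nat) :: real)"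
  by (rule continuous_on_product_then_coordinatewise[OF continuous_on_snd])

lemma continuous_on_mv [continuous_intros]:
  assumes "\<And>i j. continuous_on S (\<lambda>x. H x i j)" "\<And>i. continuous_on S (\<lambda>x. v x i)"
  shows "continuous_on S (\<lambda>x. mv N (H x) (v x) i)"
  unfolding mv_def by (intro continuous_intros assms)

lemma continuous_on_qform [continuous_intros]:
  assumes "\<And>i. continuous_on S (\<lambda>x. v x i)"
  shows "continuous_on S (\<lambda>x. qform N A (v x))"
  unfolding qform_def by (intro continuous_intros assms)

text \<open>A repeated eigenvalue amounts to an orthogonal pair of unit eigenvectors with a common
  Rayleigh quotient. This is a closed condition over a compact set, so the exceptional matrices form
  a closed set.\<close>

lemma not_simple_iff:
  "card (eigenvalues N (goe_mat g)) \<noteq> N \<longleftrightarrow>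
    (\<exists>p\<in>sphere_fn N \<times> sphere_fn N. ip N (fst p) (snd p) = 0
      \<and> (\<forall>i<N. mv N (goe_mat g) (fst p) i = ip N (fst p) (mv N (goe_mat g) (fst p)) * fst p i)
      \<and> (\<forall>i<N. mv N (goe_mat g) (snd p) i = ip N (fst p) (mv N (goe_mat g) (fst p)) * snd p i))"
proof -
  let ?H = "goe_mat g"
  obtain u lam where o: "orthogonal_on {..<N} u"
    and e: "\<And>b i. b < N \<Longrightarrow> i < N \<Longrightarrow> mv N ?H (u b) i = lam b * u b i"
    and z: "\<And>b i. b < N \<Longrightarrow> N \<le> i \<Longrightarrow> u b i = 0"
    using spectral_decomposition[of N ?H] goe_mat_sym by metis
  have ou: "ip N (u a) (u b) = of_bool (a = b)" if "a < N" "b < N" for a b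
    using o that by (simp add: orthogonal_on_ip)
  show ?thesis (is "?L \<longleftrightarrow> ?R")
  proof
    assume ?L
    then have "\<not> inj_on lam {..<N}" by (auto simp: eigenvalues_eigenbasis[OF o e] card_image)
    then obtain a b where ab: "a < N" "b < N" "lam a = lam b" "a \<noteq> b" by (auto simp: inj_on_def)
    have l: "ip N (u a) (mv N ?H (u a)) = lam a"
    proof -
      have "ip N (u a) (mv N ?H (u a)) = ip N (u a) (\<lambda>i. lam a * u a i)"
        by (rule ip_cong) (use e ab in auto)
      then show ?thesis using ou ab by (simp add: ip_simps)
    qed
    show ?R
      by (rule bexI[of _ "(u a, u b)"]) (use ab e l ou z in \<open>auto simp: sphere_fn_def\<close>)
  next
    assume ?R
    then obtain v w l where vw: "v \<in> sphere_fn N" "w \<in> sphere_fn N" "ip N v w = 0"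
      "\<And>i. i < N \<Longrightarrow> mv N ?H v i = l * v i" "\<And>i. i < N \<Longrightarrow> mv N ?H w i = l * w i" by auto
    show ?L
    proof
      assume card: "card (eigenvalues N ?H) = N"
      have inj: "inj_on lam {..<N}" by (rule inj_on_eigenbasis_if_card[OF o e card])
      have "v \<in> unit_eigvecs N ?H" using vw(1,4) unfolding unit_eigvecs_alt by blast
      then have "l \<in> eigenvalues N ?H"
        using vw(4) unfolding eigenvalues_def unit_eigvecs_def is_eigvec_mv by blast
      then obtain b where b: "b < N" "l = lam b" by (auto simp: eigenvalues_eigenbasis[OF o e])
      \<comment> \<open>If the spectrum were simple, an eigenvector for lam b would have a component
        only along u b; inner products then become products of two numbers, and two unit vectors of
        this kind cannot be orthogonal.\<close>
      have pars: "ip N x y = ip N (u b) x * ip N (u b) y" if x: "\<And>i. i < N \<Longrightarrow> mv N ?H x i = l * x i" for x y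
      proof -
        have "ip N (u a) x = 0" if "a < N" "a \<noteq> b" for a
        proof -
          have "lam a \<noteq> l" using inj that b by (auto simp: inj_on_def)
          then show ?thesis using eigenbasis_ip[OF o e x that(1)] by auto
        qed
        then have "ip N x y = (\<Sum>a<N. if a = b then ip N (u a) x * ip N (u a) y else 0)"
          unfolding parseval[OF o, of x y] by (intro sum.cong) auto
        then show ?thesis using b by simp
      qed
      have "ip N v v = 1" "ip N w w = 1" using vw by (auto simp: sphere_fn_def)
      then show False using pars[OF vw(4), of v] pars[OF vw(4), of w] pars[OF vw(5), of w] vw(3) by auto
    qed
  qed
qed

text \<open>Off the closed set Z of matrices with a repeated eigenvalue, a superlevel set of the
  statistic is the projection of a closed set along the compact sphere. On Z the statistic is 0, so
  Z belongs to the superlevel set exactly for t \<le> 0.\<close>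

lemma borel_measurable_eig_stat:
  assumes N: "1 \<le> N" and f: "continuous_on UNIV f"
  shows "(\<lambda>g. eig_stat f N A (goe_mat g)) \<in> borel_measurable borel"
proof -
  define Z where "Z = {g. card (eigenvalues N (goe_mat g)) \<noteq> N}"
  define C where "C = (\<lambda>t. {(g, v). (\<forall>i<N. mv N (goe_mat g) v i = ip N v (mv N (goe_mat g) v) * v i)
     \<and> t \<le> f (real N * qform N A v)})"
  have cf: "continuous_on S (\<lambda>x. f (h x))" if "continuous_on S h" for S :: "'z::topological_space set" and h
    by (rule continuous_on_compose2[OF f that]) simp
  have "closed {g. \<exists>p\<in>sphere_fn N \<times> sphere_fn N. (g, p) \<in> {(g, p). ip N (fst p) (snd p) = 0
      \<and> (\<forall>i<N. mv N (goe_mat g) (fst p) i = ip N (fst p) (mv N (goe_mat g) (fst p)) * fst p i)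
      \<and> (\<forall>i<N. mv N (goe_mat g) (snd p) i = ip N (fst p) (mv N (goe_mat g) (fst p)) * snd p i)}}"
    unfolding case_prod_beta
    by (intro closed_Collect_ex_compact compact_Times compact_sphere_fn closed_Collect_conj closed_Collect_all
        closed_Collect_imp open_Collect_const closed_Collect_eq continuous_intros)
  then have "closed Z" by (simp add: Z_def not_simple_iff)
  then have mZ: "Z \<in> sets borel" by simp
  have "closed {g. \<exists>v\<in>sphere_fn N. (g, v) \<in> C t}" for t
    unfolding C_def case_prod_beta
    by (intro closed_Collect_ex_compact compact_sphere_fn closed_Collect_conj closed_Collect_all
        closed_Collect_imp open_Collect_const closed_Collect_eq closed_Collect_le cf continuous_intros)
  then have mC: "{g. \<exists>v\<in>sphere_fn N. (g, v) \<in> C t} \<in> sets borel" for t by simp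
  have "{g. t \<le> eig_stat f N A (goe_mat g)} =
      ({g. \<exists>v\<in>sphere_fn N. (g, v) \<in> C t} - Z) \<union> (if t \<le> 0 then Z else {})" for t
  proof -
    have "t \<le> eig_stat f N A (goe_mat g) \<longleftrightarrow> (\<exists>v\<in>sphere_fn N. (g, v) \<in> C t)" if "g \<notin> Z" for g
    proof -
      let ?H = "goe_mat g"
      have card: "card (eigenvalues N ?H) = N" using that by (simp add: Z_def)
      obtain u lam where o: "orthogonal_on {..<N} u"
        and e: "\<And>b i. b < N \<Longrightarrow> i < N \<Longrightarrow> mv N ?H (u b) i = lam b * u b i"
        using spectral_decomposition[of N ?H] goe_mat_sym by metis
      let ?S = "(\<lambda>v. f (real N * qform N A v)) ` unit_eigvecs N ?H"
      have S: "?S = (\<lambda>b. f (real N * qform N A (u b))) ` {..<N}"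
        by (rule unit_eigvecs_stat_image[OF o e inj_on_eigenbasis_if_card[OF o e card]])
      have "finite ?S" "?S \<noteq> {}" unfolding S using N by (auto simp: lessThan_empty_iff)
      then have "t \<le> Max ?S \<longleftrightarrow> (\<exists>a\<in>?S. t \<le> a)" by (rule Max_ge_iff)
      moreover have "(\<exists>v\<in>sphere_fn N. (g, v) \<in> C t) \<longleftrightarrow> (\<exists>v\<in>unit_eigvecs N ?H. t \<le> f (real N * qform N A v))"
        unfolding C_def Bex_def unit_eigvecs_iff mem_Collect_eq prod.case by blast
      ultimately show ?thesis using card by (simp add: eig_stat_def)
    qed
    moreover have "t \<le> eig_stat f N A (goe_mat g) \<longleftrightarrow> t \<le> 0" if "g \<in> Z" for g
      using that by (simp add: Z_def eig_stat_def)
    ultimately show ?thesis by auto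
  qed
  then show ?thesis
    unfolding borel_measurable_iff_ge using mZ mC by auto
qed

text \<open>Passes from the Borel sets of the product topology on all index pairs to the product of
  Borel sets over the GOE index set, off which coordinates are constantly
  \<open>undefined\<close>.\<close>

lemma borel_measurable_eig_stat_PiM:
  assumes "1 \<le> N" "continuous_on UNIV f"
  shows "(\<lambda>g. eig_stat f N A (goe_mat g)) \<in> borel_measurable (PiM (goe_index N) (\<lambda>_. borel))"
proof -
  have "(\<lambda>g. g) \<in> borel_measurable (PiM (goe_index N) (\<lambda>_. borel :: real measure))"
  proof (rule measurable_coordinatewise_then_product)
    fix p
    show "(\<lambda>g. g p) \<in> borel_measurable (PiM (goe_index N) (\<lambda>_. borel :: real measure))"
    proof (cases "p \<in> goe_index N")
      case False
      then have "(\<lambda>g. g p) \<in> borel_measurable (PiM (goe_index N) (\<lambda>_. borel :: real measure))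
          \<longleftrightarrow> (\<lambda>g. undefined :: real) \<in> borel_measurable (PiM (goe_index N) (\<lambda>_. borel :: real measure))"
        by (intro measurable_cong) (cases p, auto simp: space_PiM PiE_def extensional_def)
      then show ?thesis by simp
    qed simp
  qed
  from measurable_compose[OF this borel_measurable_eig_stat[OF assms]] show ?thesis .
qed

section \<open>Gram--Schmidt orthonormalisation\<close>


text \<open>Division by zero makes the result the zero vector if row a depends on the earlier rows;
  \<open>gs_nondeg\<close> below excludes this, and holds almost surely for Gaussian rows.\<close>

function gs :: "nat \<Rightarrow> (nat \<Rightarrow> nat \<Rightarrow> real) \<Rightarrow> nat \<Rightarrow> nat \<Rightarrow> real" where
  "gs N r a = (let w = (\<lambda>i. r a i - (\<Sum>b<a. ip N (r a) (gs N r b) * gs N r b i))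
     in (\<lambda>i. w i / sqrt (ip N w w)))"
  by auto
termination by (relation "Wellfounded.measure (\<lambda>(N, r, a). a)") auto

declare gs.simps [simp del]

definition gs_res :: "nat \<Rightarrow> (nat \<Rightarrow> nat \<Rightarrow> real) \<Rightarrow> nat \<Rightarrow> nat \<Rightarrow> real" where
  "gs_res N r a i = r a i - (\<Sum>b<a. ip N (r a) (gs N r b) * gs N r b i)"

lemma gs_eq: "gs N r a i = gs_res N r a i / sqrt (ip N (gs_res N r a) (gs_res N r a))"
  unfolding gs.simps[of N r a] Let_def gs_res_def[abs_def] ..

definition gs_nondeg :: "nat \<Rightarrow> (nat \<Rightarrow> nat \<Rightarrow> real) \<Rightarrow> bool" where
  "gs_nondeg N r \<longleftrightarrow> (\<forall>a<N. ip N (gs_res N r a) (gs_res N r a) \<noteq> 0)"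

lemma ip_gs_res: "ip N (gs_res N r a) v = ip N (r a) v - (\<Sum>b<a. ip N (r a) (gs N r b) * ip N (gs N r b) v)"
proof -
  have "ip N (gs_res N r a) v = ip N (\<lambda>i. r a i - (\<Sum>b<a. ip N (r a) (gs N r b) * gs N r b i)) v"
    by (simp add: gs_res_def[abs_def])
  then show ?thesis by (simp add: ip_simps)
qed

lemma ip_gs_left: "ip N (gs N r a) v = ip N (gs_res N r a) v / sqrt (ip N (gs_res N r a) (gs_res N r a))"
  unfolding ip_def[of N "gs N r a"] gs_eq by (simp add: ip_def[of N "gs_res N r a" v] sum_divide_distrib)

lemma ip_gs_right: "ip N v (gs N r a) = ip N v (gs_res N r a) / sqrt (ip N (gs_res N r a) (gs_res N r a))"
  by (simp add: ip_commute[of N v] ip_gs_left)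

context
  fixes N r assumes nd: "gs_nondeg N r"
begin

lemma gs_norm_pos: "a < N \<Longrightarrow> 0 < sqrt (ip N (gs_res N r a) (gs_res N r a))"
  using nd ip_nonneg[of N "gs_res N r a"] by (auto simp: gs_nondeg_def order_le_neq_trans)

lemma ip_gs_self: assumes "a < N" shows "ip N (gs N r a) (gs N r a) = 1"
proof -
  have "ip N (gs N r a) (gs N r a) = ip N (gs_res N r a) (gs_res N r a) /
      (sqrt (ip N (gs_res N r a) (gs_res N r a)) * sqrt (ip N (gs_res N r a) (gs_res N r a)))"
    by (simp add: ip_gs_left ip_gs_right)
  then show ?thesis using gs_norm_pos[OF assms] by simp
qed

lemma ip_gs_less: "a < N \<Longrightarrow> b < a \<Longrightarrow> ip N (gs N r a) (gs N r b) = 0"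
proof (induction a arbitrary: b rule: less_induct)
  case (less a)
  have "(\<Sum>c<a. ip N (r a) (gs N r c) * ip N (gs N r c) (gs N r b))
      = (\<Sum>c<a. if c = b then ip N (r a) (gs N r c) else 0)"
  proof (intro sum.cong refl)
    fix c assume "c \<in> {..<a}"
    then show "ip N (r a) (gs N r c) * ip N (gs N r c) (gs N r b) = (if c = b then ip N (r a) (gs N r c) else 0)"
      using less.IH[of c b] less.IH[of b c] less.prems ip_gs_self[of b]
      by (cases c b rule: linorder_cases) (auto simp: ip_commute[of N "gs N r c" "gs N r b"])
  qed
  then have "ip N (gs_res N r a) (gs N r b) = 0"
    using less.prems by (simp add: ip_gs_res)
  then show ?case by (simp add: ip_gs_left)
qed

lemma orthogonal_gs: "orthogonal_on {..<N} (gs N r)"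
  unfolding orthogonal_on_ip
proof (intro allI impI)
  fix a b assume "a < N" "b < N"
  then show "ip N (gs N r a) (gs N r b) = of_bool (a = b)"
    using ip_gs_less[of a b] ip_gs_less[of b a] ip_gs_self[of a] ip_commute[of N "gs N r a" "gs N r b"]
    by (cases a b rule: linorder_cases) auto
qed

text \<open>Row a lies in the span of the orthonormalised vectors 0, ..., a. In matrix terms, the
  factor L in Y = L Q is lower triangular.\<close>

lemma ip_gs_upper:
  assumes "a < b" "b < N" shows "ip N (r a) (gs N r b) = 0"
proof -
  have e: "gs_res N r a i = sqrt (ip N (gs_res N r a) (gs_res N r a)) * gs N r a i" for i
    using gs_norm_pos[of a] assms by (simp add: gs_eq)
  have "r a i = sqrt (ip N (gs_res N r a) (gs_res N r a)) * gs N r a i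
      + (\<Sum>b<a. ip N (r a) (gs N r b) * gs N r b i)" for i
    using e[of i] unfolding gs_res_def[of N r a i] by linarith
  then have "ip N (r a) (gs N r b) = ip N (\<lambda>i. sqrt (ip N (gs_res N r a) (gs_res N r a)) * gs N r a i
      + (\<Sum>b<a. ip N (r a) (gs N r b) * gs N r b i)) (gs N r b)"
    by (intro ip_cong) auto
  also have "\<dots> = 0"
    unfolding ip_simps
    using orthogonal_gs assms by (simp add: orthogonal_on_ip)
  finally show ?thesis .
qed

end

text \<open>Vector a is computed from rows 0, ..., a alone; for Gaussian rows this later gives its
  independence of the rows that follow.\<close>

lemma gs_cong:
  assumes "\<And>b i. b \<le> a \<Longrightarrow> i < N \<Longrightarrow> r b i = r' b i" "i < N"
  shows "gs N r a i = gs N r' a i"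
  using assms
proof (induction a arbitrary: i rule: less_induct)
  case (less a)
  have IH: "gs N r b i = gs N r' b i" if "b < a" "i < N" for b i
    using less.prems that by (intro less.IH) auto
  have ipe: "ip N (r a) (gs N r b) = ip N (r' a) (gs N r' b)" if "b < a" for b
    by (rule ip_cong) (use less.prems IH that in auto)
  have "gs_res N r a i = gs_res N r' a i" if "i < N" for i
    unfolding gs_res_def using less.prems IH ipe that by (auto intro!: sum.cong)
  then show ?case using less.prems(2) ip_cong[of N "gs_res N r a" "gs_res N r' a" "gs_res N r a" "gs_res N r' a"]
    by (simp add: gs_eq)
qed

text \<open>Gram--Schmidt uses the rows only linearly and through inner products, and W preserves
  the latter.\<close>

lemma gs_equivariant:
  assumes W: "orthogonal_on {..<N} W"
  shows "gs N (\<lambda>a. mv N W (r a)) a i = mv N W (gs N r a) i"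
proof (induction a arbitrary: i rule: less_induct)
  case (less a)
  have IH: "gs N (\<lambda>a. mv N W (r a)) b = mv N W (gs N r b)" if "b < a" for b
    using less.IH[OF that] by (rule ext)
  have res: "gs_res N (\<lambda>a. mv N W (r a)) a i = mv N W (gs_res N r a) i" for i
  proof -
    have "mv N W (gs_res N r a) i = mv N W (r a) i - (\<Sum>j<N. \<Sum>b<a. ip N (r a) (gs N r b) * (W i j * gs N r b j))"
      unfolding mv_def gs_res_def right_diff_distrib sum_subtractf
      by (simp add: sum_distrib_left algebra_simps)
    also have "(\<Sum>j<N. \<Sum>b<a. ip N (r a) (gs N r b) * (W i j * gs N r b j))
        = (\<Sum>b<a. ip N (r a) (gs N r b) * mv N W (gs N r b) i)"
      by (subst sum.swap) (simp add: mv_def sum_distrib_left)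
    finally show ?thesis
      unfolding gs_res_def[of N "\<lambda>a. mv N W (r a)"] by (simp add: IH ip_mv_orthogonal[OF W])
  qed
  then have "gs_res N (\<lambda>a. mv N W (r a)) a = mv N W (gs_res N r a)" by (rule ext)
  then have "gs N (\<lambda>a. mv N W (r a)) a i = mv N W (gs_res N r a) i / sqrt (ip N (gs_res N r a) (gs_res N r a))"
    by (simp add: gs_eq ip_mv_orthogonal[OF W])
  also have "\<dots> = mv N W (gs N r a) i"
    unfolding mv_def gs_eq by (simp add: sum_divide_distrib)
  finally show ?case .
qed

text \<open>The coefficient 1 at row a is what makes the combination nontrivial: a vanishing
  residual would be a linear dependence between the rows.\<close>

lemma gs_res_combination:
  assumes "a < N"
  shows "\<exists>v. v a = 1 \<and> (\<forall>c>a. v c = 0) \<and> (\<forall>i. gs_res N r a i = (\<Sum>c<N. v c * r c i))"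
  using assms
proof (induction a rule: less_induct)
  case (less a)
  have "\<exists>t. (\<forall>c>b. t c = 0) \<and> (\<forall>i. gs N r b i = (\<Sum>c<N. t c * r c i))" if ba: "b < a" for b
  proof -
    obtain v where v: "\<forall>c>b. v c = 0" "\<forall>i. gs_res N r b i = (\<Sum>c<N. v c * r c i)"
      using less.IH[OF ba] ba less.prems by auto
    show ?thesis
      by (rule exI[of _ "\<lambda>c. v c / sqrt (ip N (gs_res N r b) (gs_res N r b))"])
         (use v in \<open>simp add: gs_eq[of N r b] sum_divide_distrib\<close>)
  qed
  then obtain t where t: "\<And>b c. b < a \<Longrightarrow> c > b \<Longrightarrow> t b c = 0"
    "\<And>b i. b < a \<Longrightarrow> gs N r b i = (\<Sum>c<N. t b c * r c i)" by metis
  define k where "k = (\<lambda>b. ip N (r a) (gs N r b))"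
  define v where "v = (\<lambda>c. of_bool (c = a) - (\<Sum>b<a. k b * t b c))"
  have "gs_res N r a i = (\<Sum>c<N. v c * r c i)" for i
  proof -
    have "(\<Sum>b<a. k b * gs N r b i) = (\<Sum>b<a. \<Sum>c<N. k b * t b c * r c i)"
      using t(2) by (intro sum.cong refl) (simp add: sum_distrib_left mult.assoc)
    also have "\<dots> = (\<Sum>c<N. (\<Sum>b<a. k b * t b c) * r c i)"
      by (subst sum.swap) (simp add: sum_distrib_right)
    finally have "(\<Sum>c<N. v c * r c i) = (\<Sum>c<N. of_bool (c = a) * r c i) - (\<Sum>b<a. k b * gs N r b i)"
      by (simp add: v_def left_diff_distrib sum_subtractf)
    moreover have "(\<Sum>c<N. of_bool (c = a) * r c i) = r a i"
      using less.prems by simp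
    ultimately show ?thesis by (simp add: gs_res_def k_def)
  qed
  moreover have "v a = 1" "\<forall>c>a. v c = 0" unfolding v_def using t(1) by auto
  ultimately show ?case by blast
qed

lemma gs_nondeg_if_det:
  assumes "Determinant.det (mat N N (\<lambda>(a, i). r a i)) \<noteq> 0"
  shows "gs_nondeg N r"
  unfolding gs_nondeg_def
proof (intro allI impI notI)
  fix a assume a: "a < N" and z: "ip N (gs_res N r a) (gs_res N r a) = 0"
  let ?K = "mat N N (\<lambda>(a, i). r a i)"
  obtain v where v: "v a = 1" "\<forall>i. gs_res N r a i = (\<Sum>c<N. v c * r c i)"
    using gs_res_combination[OF a] by metis
  have "transpose_mat ?K *\<^sub>v vec N v = 0\<^sub>v N"
  proof (rule eq_vecI)
    fix i assume "i < dim_vec (0\<^sub>v N :: real vec)"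
    then have "i < N" by simp
    moreover from this have "(\<Sum>c<N. v c * r c i) = 0" using z v(2) by (simp add: ip_self_eq_0_iff)
    ultimately show "(transpose_mat ?K *\<^sub>v vec N v) $ i = 0\<^sub>v N $ i"
      by (simp add: scalar_prod_def atLeast0LessThan mult.commute)
  qed simp
  moreover have "vec N v \<noteq> 0\<^sub>v N"
    using v(1) a by (metis index_vec index_zero_vec(1) zero_neq_one)
  moreover have "transpose_mat ?K \<in> carrier_mat N N" by simp
  ultimately have "Determinant.det (transpose_mat ?K) = 0"
    using det_0_iff_vec_prod_zero[of "transpose_mat ?K" N] vec_carrier[of N v] by blast
  moreover have "Determinant.det (transpose_mat ?K) = Determinant.det ?K"
    by (rule det_transpose[of _ N]) simp
  ultimately show False using assms by simp
qed

text \<open>Since y (i, a) is coordinate a of the vector y_i, row a of Y collects that coordinate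
  over all vectors, and y_i itself is column i of Y.\<close>

definition rows :: "(nat \<times> nat \<Rightarrow> real) \<Rightarrow> nat \<Rightarrow> nat \<Rightarrow> real" where
  "rows y a i = y (i, a)"

abbreviation sq_index :: "nat \<Rightarrow> (nat \<times> nat) set" where
  "sq_index N \<equiv> {..<N} \<times> {..<N}"

lemma gauss_vecs_eq: "gauss_vecs N = gauss (sq_index N)"
  by (simp add: gauss_vecs_def gauss_def)

lemma AE_gs_nondeg: "AE y in gauss_vecs N. gs_nondeg N (rows y)"
proof -
  define F where "F = (\<lambda>y. Determinant.det (mat N N (\<lambda>(a, i). rows y a i)))"
  have "F \<in> polyfun" unfolding F_def rows_def
    by (intro polyfun_det) (simp add: polyfun.coord)
  moreover define y0 where "y0 = (\<lambda>p\<in>sq_index N. if fst p = snd p then 1 else 0 :: real)"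
  moreover have "F y0 \<noteq> 0"
  proof -
    have "mat N N (\<lambda>(a, i). rows y0 a i) = 1\<^sub>m N"
      by (rule eq_matI) (auto simp: rows_def y0_def)
    then show ?thesis by (simp add: F_def)
  qed
  ultimately have "AE y in gauss (sq_index N). F y \<noteq> 0"
    by (intro polyfun_AE_nonzero[where p = y0]) (auto simp: space_gauss)
  then show ?thesis
    unfolding gauss_vecs_eq by eventually_elim (simp add: gs_nondeg_if_det F_def)
qed

text \<open>Kronecker product of two matrices acting on the array: W mixes the vectors with each
  other, V rotates the coordinates inside each of them. It is orthogonal if both factors
  are.\<close>

definition kron :: "nat \<Rightarrow> (nat \<Rightarrow> nat \<Rightarrow> real) \<Rightarrow> (nat \<Rightarrow> nat \<Rightarrow> real) \<Rightarrow> (nat \<times> nat \<Rightarrow> real) \<Rightarrow> nat \<times> nat \<Rightarrow> real" where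
  "kron N W V y = (\<lambda>p\<in>sq_index N. \<Sum>l<N. \<Sum>b<N. W (fst p) l * V (snd p) b * y (l, b))"

lemma sets_gauss_vecs [measurable_cong]: "sets (gauss_vecs N) = sets (PiM (sq_index N) (\<lambda>_. borel))"
  by (simp add: gauss_vecs_eq sets_gauss)

lemma prob_space_gauss_vecs: "prob_space (gauss_vecs N)"
  by (simp add: gauss_vecs_eq prob_space_gauss)

lemma nn_integral_kron:
  assumes W: "orthogonal_on {..<N} W" and V: "orthogonal_on {..<N} V"
    and f: "f \<in> borel_measurable (PiM (sq_index N) (\<lambda>_. borel))"
  shows "(\<integral>\<^sup>+y. f (kron N W V y) \<partial>gauss_vecs N) = (\<integral>\<^sup>+y. f y \<partial>gauss_vecs N)"
proof -
  define T where "T = (\<lambda>p q. W (fst p) (fst q) * V (snd p) (snd q))"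
  have "orthogonal_on (sq_index N) T"
    unfolding orthogonal_on_def
  proof (intro ballI)
    fix p q assume "p \<in> sq_index N" "q \<in> sq_index N"
    then have pq: "fst p < N" "snd p < N" "fst q < N" "snd q < N" by auto
    have "(\<Sum>k\<in>sq_index N. T p k * T q k)
        = (\<Sum>l<N. \<Sum>b<N. (W (fst p) l * W (fst q) l) * (V (snd p) b * V (snd q) b))"
      by (simp add: sum.cartesian_product T_def case_prod_beta mult_ac)
    also have "\<dots> = (\<Sum>l<N. W (fst p) l * W (fst q) l) * (\<Sum>b<N. V (snd p) b * V (snd q) b)"
      by (rule sum_product[symmetric])
    also have "\<dots> = of_bool (fst p = fst q) * of_bool (snd p = snd q)"
      using W V pq by (simp add: orthogonal_on_def)
    also have "\<dots> = of_bool (p = q)" by (simp add: prod_eq_iff)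
    finally show "(\<Sum>k\<in>sq_index N. T p k * T q k) = of_bool (p = q)" .
  qed
  moreover have "lin (sq_index N) T = kron N W V"
    unfolding lin_def kron_def T_def
    by (intro ext) (simp add: sum.cartesian_product case_prod_beta)
  moreover have "f \<in> borel_measurable (gauss (sq_index N))" using f by measurable
  ultimately show ?thesis
    unfolding gauss_vecs_eq using nn_integral_gauss_orthogonal[of "sq_index N" T f] by simp
qed

definition idm :: "nat \<Rightarrow> nat \<Rightarrow> real" where "idm i j = of_bool (i = j)"

lemma orthogonal_idm: "orthogonal_on {..<N} idm"
  by (auto simp: orthogonal_on_def idm_def of_bool_def if_distrib[of "(*) _"] cong: if_cong)

lemma rows_kron_left:
  assumes "a < N" "i < N"
  shows "rows (kron N W idm y) a i = mv N W (rows y a) i"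
  using assms by (simp add: rows_def kron_def mv_def idm_def of_bool_def if_distrib[of "(*) _"] if_distrib[of "\<lambda>x. x * _"] cong: if_cong)

lemma kron_right:
  assumes "i < N" "a < N"
  shows "kron N idm V y (i, a) = mv N V (\<lambda>b. y (i, b)) a"
proof -
  have "kron N idm V y (i, a) = (\<Sum>l<N. if l = i then \<Sum>b<N. V a b * y (l, b) else 0)"
  proof -
    have "(\<Sum>b<N. idm i l * V a b * y (l, b)) = (if l = i then \<Sum>b<N. V a b * y (l, b) else 0)" for l
      by (simp add: idm_def)
    then show ?thesis using assms by (simp add: kron_def)
  qed
  then show ?thesis using assms by (simp add: mv_def)
qed

lemma gs_rows_kron:
  assumes W: "orthogonal_on {..<N} W" and "a < N" "i < N"
  shows "gs N (rows (kron N W idm y)) a i = mv N W (gs N (rows y) a) i"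
proof -
  have "gs N (rows (kron N W idm y)) a i = gs N (\<lambda>a. mv N W (rows y a)) a i"
    by (rule gs_cong) (use assms rows_kron_left in auto)
  then show ?thesis by (simp add: gs_equivariant[OF W])
qed

lemma measurable_gs [measurable]:
  assumes "i < N" "a < N"
  shows "(\<lambda>y. gs N (rows y) a i) \<in> borel_measurable (PiM (sq_index N) (\<lambda>_. borel))"
  using assms
proof (induction a arbitrary: i rule: less_induct)
  case (less a)
  let ?M = "PiM (sq_index N) (\<lambda>_. borel :: real measure)"
  have c: "(\<lambda>y. rows y b i) \<in> borel_measurable ?M" if "i < N" "b < N" for i b
    unfolding rows_def using that by (intro measurable_component_singleton) auto
  have res: "(\<lambda>y. gs_res N (rows y) a i) \<in> borel_measurable ?M" if "i < N" for i
    unfolding gs_res_def ip_def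
    by (intro borel_measurable_diff borel_measurable_sum borel_measurable_times c less.IH)
       (use that less.prems in auto)
  have [measurable]: "(\<lambda>y. ip N (gs_res N (rows y) a) (gs_res N (rows y) a)) \<in> borel_measurable ?M"
    unfolding ip_def by (intro borel_measurable_sum borel_measurable_times res) auto
  note res[OF less.prems(1), measurable]
  show ?case unfolding gs_eq by measurable
qed

section \<open>Laws of the two maxima\<close>


text \<open>Column b of Q stands for the b-th eigenvector of the random matrix in coordinates with
  respect to the eigenbasis of A, and lam for the eigenvalues of A.\<close>

definition haar_stat :: "(real \<Rightarrow> real) \<Rightarrow> nat \<Rightarrow> (nat \<Rightarrow> real) \<Rightarrow> (nat \<Rightarrow> nat \<Rightarrow> real) \<Rightarrow> real" where
  "haar_stat f N lam Q = Max ((\<lambda>b. f (real N * (\<Sum>a<N. lam a * (Q a b)\<^sup>2))) ` {..<N})"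

definition diag_stat :: "(real \<Rightarrow> real) \<Rightarrow> nat \<Rightarrow> (nat \<Rightarrow> real) \<Rightarrow> (nat \<times> nat \<Rightarrow> real) \<Rightarrow> real" where
  "diag_stat f N lam y = Max ((\<lambda>i. f (\<Sum>a<N. lam a * (y (i, a))\<^sup>2)) ` {..<N})"

definition gauss_stat :: "(real \<Rightarrow> real) \<Rightarrow> nat \<Rightarrow> (nat \<Rightarrow> nat \<Rightarrow> real) \<Rightarrow> (nat \<times> nat \<Rightarrow> real) \<Rightarrow> real" where
  "gauss_stat f N A y = Max ((\<lambda>i. f (qform N A (\<lambda>j. y (i, j)))) ` {..<N})"

lemma gauss_max_eq_gauss_stat: "gauss_max N A y = gauss_stat (\<lambda>x. x) N A y"
  by (simp add: gauss_max_def gauss_stat_def)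

lemma gauss_max_abs_eq_gauss_stat: "gauss_max_abs N A y = gauss_stat abs N A y"
  by (simp add: gauss_max_abs_def gauss_stat_def)

lemma qform_eigenbasis:
  assumes sym: "\<And>i j. i < N \<Longrightarrow> j < N \<Longrightarrow> A i j = A j i"
    and o: "orthogonal_on {..<N} v"
    and e: "\<And>b i. b < N \<Longrightarrow> i < N \<Longrightarrow> mv N A (v b) i = lam b * v b i"
  shows "qform N A w = (\<Sum>a<N. lam a * (ip N (v a) w)\<^sup>2)"
proof -
  have "ip N (v a) (mv N A w) = lam a * ip N (v a) w" if a: "a < N" for a
  proof -
    have "ip N (v a) (mv N A w) = ip N (mv N A (v a)) w"
      by (rule ip_mv_sym[OF sym])
    also have "\<dots> = ip N (\<lambda>i. lam a * v a i) w" by (rule ip_cong) (use e a in auto)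
    finally show ?thesis by (simp add: ip_simps)
  qed
  then show ?thesis
    unfolding qform_ip parseval[OF o, of w "mv N A w"]
    by (intro sum.cong refl) (simp add: power2_eq_square)
qed

lemma borel_measurable_Max_stat:
  fixes f :: "real \<Rightarrow> real" and N :: nat
  assumes "continuous_on UNIV f" "\<And>i. i < N \<Longrightarrow> h i \<in> borel_measurable M"
  shows "(\<lambda>x. Max ((\<lambda>i. f (h i x)) ` {..<N})) \<in> borel_measurable M"
proof (rule borel_measurable_Max[where f = "\<lambda>i x. f (h i x)" and I = "{..<N}"])
  show "(\<lambda>x. f (h i x)) \<in> borel_measurable M" if "i \<in> {..<N}" for i
    by (rule measurable_compose[OF assms(2) borel_measurable_continuous_onI[OF assms(1)]]) (use that in auto)
qed simp

lemma measurable_haar_stat: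
  assumes "continuous_on UNIV f"
  shows "(\<lambda>y. haar_stat f N lam (gs N (rows y))) \<in> borel_measurable (PiM (sq_index N) (\<lambda>_. borel))"
  unfolding haar_stat_def
  by (rule borel_measurable_Max_stat[OF assms(1)])
     (intro borel_measurable_times borel_measurable_const borel_measurable_sum borel_measurable_power measurable_gs, auto)

lemma measurable_diag_stat:
  assumes "continuous_on UNIV f"
  shows "diag_stat f N lam \<in> borel_measurable (PiM (sq_index N) (\<lambda>_. borel))"
  unfolding diag_stat_def[abs_def]
  by (rule borel_measurable_Max_stat[OF assms(1)])
     (intro borel_measurable_times borel_measurable_const borel_measurable_sum borel_measurable_power measurable_component_singleton, auto)

lemma gauss_stat_eq_diag_stat:
  assumes sym: "\<And>i j. i < N \<Longrightarrow> j < N \<Longrightarrow> A i j = A j i"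
    and o: "orthogonal_on {..<N} v"
    and e: "\<And>b i. b < N \<Longrightarrow> i < N \<Longrightarrow> mv N A (v b) i = lam b * v b i"
  shows "gauss_stat f N A y = diag_stat f N lam (kron N idm v y)"
proof -
  have "f (qform N A (\<lambda>j. y (i, j))) = f (\<Sum>a<N. lam a * (kron N idm v y (i, a))\<^sup>2)" if "i < N" for i
    using that by (simp add: qform_eigenbasis[OF sym o e] kron_right mv_def ip_def)
  then show ?thesis
    unfolding gauss_stat_def diag_stat_def by (intro arg_cong[where f = Max] image_cong) auto
qed

text \<open>Passing to the eigenbasis of A rotates the coordinates of every y_i in the same way,
  which does not change their joint law.\<close>

lemma gauss_stat_law:
  assumes sym: "\<And>i j. i < N \<Longrightarrow> j < N \<Longrightarrow> A i j = A j i"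
    and o: "orthogonal_on {..<N} v"
    and e: "\<And>b i. b < N \<Longrightarrow> i < N \<Longrightarrow> mv N A (v b) i = lam b * v b i"
    and f: "continuous_on UNIV f" and B[measurable]: "B \<in> sets borel"
  shows "(\<integral>\<^sup>+y. indicator B (gauss_stat f N A y) \<partial>gauss_vecs N)
       = (\<integral>\<^sup>+y. indicator B (diag_stat f N lam y) \<partial>gauss_vecs N)"
proof -
  note [measurable] = measurable_diag_stat[OF f]
  have "(\<integral>\<^sup>+y. indicator B (gauss_stat f N A y) \<partial>gauss_vecs N)
      = (\<integral>\<^sup>+y. indicator B (diag_stat f N lam (kron N idm v y)) \<partial>gauss_vecs N)"
    by (simp add: gauss_stat_eq_diag_stat[OF sym o e])
  also have "\<dots> = (\<integral>\<^sup>+y. indicator B (diag_stat f N lam y) \<partial>gauss_vecs N)"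
    by (rule nn_integral_kron[OF orthogonal_idm o]) measurable
  finally show ?thesis .
qed

text \<open>A GOE matrix may be conjugated by an independent orthogonal matrix without changing its law, and
  Gram--Schmidt commutes with right multiplication by the eigenvector matrix, which can therefore be
  absorbed into the Gaussian matrix.\<close>

proposition eig_stat_law:
  assumes N: "1 \<le> N" and sym: "\<And>i j. i < N \<Longrightarrow> j < N \<Longrightarrow> A i j = A j i"
    and o: "orthogonal_on {..<N} v"
    and e: "\<And>b i. b < N \<Longrightarrow> i < N \<Longrightarrow> mv N A (v b) i = lam b * v b i"
    and f: "continuous_on UNIV f" and B[measurable]: "B \<in> sets borel"
  shows "(\<integral>\<^sup>+g. indicator B (eig_stat f N A (goe_mat g)) \<partial>goe N)
       = (\<integral>\<^sup>+y. indicator B (haar_stat f N lam (gs N (rows y))) \<partial>gauss_vecs N)" (is "?L = ?R")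
proof -
  interpret G: prob_space "goe N" by (rule prob_space_goe[OF N])
  interpret Y: prob_space "gauss_vecs N" by (rule prob_space_gauss_vecs)
  interpret pair_sigma_finite "goe N" "gauss_vecs N" ..
  \<comment> \<open>This is \<open>V^T Q\<close>, with the eigenvectors v a of A as rows of V and Q
    the Gram--Schmidt matrix of y. It is chosen so that W x has the coordinates of Q x in the
    eigenbasis of A.\<close>
  define W where "W = (\<lambda>y i k. \<Sum>a<N. v a i * gs N (rows y) a k)"
  \<comment> \<open>The event for a GOE matrix conjugated by an independent random orthogonal
    matrix. Integrating over g first gives the left side, integrating over y first gives the right
    side.\<close>
  define Ph :: "(nat \<times> nat \<Rightarrow> real) \<Rightarrow> (nat \<times> nat \<Rightarrow> real) \<Rightarrow> ennreal" where
    "Ph = (\<lambda>g y. indicator B (eig_stat f N A (goe_mat (conj_goe N (W y) g))))"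
  note [measurable] = borel_measurable_eig_stat_PiM[OF N f] measurable_haar_stat[OF f]
  have mc: "(\<lambda>(g, y). conj_goe N (W y) g) \<in> goe N \<Otimes>\<^sub>M gauss_vecs N \<rightarrow>\<^sub>M PiM (goe_index N) (\<lambda>_. borel)"
  proof -
    have q: "(\<lambda>x. gs N (rows (snd x)) a k) \<in> borel_measurable (goe N \<Otimes>\<^sub>M gauss_vecs N)" if "a < N" "k < N" for a k
    proof -
      have "(\<lambda>y. gs N (rows y) a k) \<in> borel_measurable (gauss_vecs N)"
        using measurable_gs[OF that(2,1)] by measurable
      then show ?thesis by measurable
    qed
    have g: "(\<lambda>x. goe_mat (fst x) k l) \<in> borel_measurable (goe N \<Otimes>\<^sub>M gauss_vecs N)" if "k < N" "l < N" for k l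
    proof -
      have "(\<lambda>g. g (min k l, max k l)) \<in> borel_measurable (PiM (goe_index N) (\<lambda>_. borel :: real measure))"
        by (rule measurable_component_singleton) (use that in \<open>auto simp: goe_index_def\<close>)
      then have "(\<lambda>g. goe_mat g k l) \<in> borel_measurable (goe N)" unfolding goe_mat_def by measurable
      then show ?thesis by measurable
    qed
    show ?thesis
      unfolding conj_goe_def conj_mat_def W_def case_prod_beta
      by (intro measurable_restrict borel_measurable_sum borel_measurable_times borel_measurable_const q g) auto
  qed
  have mPh: "case_prod Ph \<in> borel_measurable (goe N \<Otimes>\<^sub>M gauss_vecs N)"
  proof -
    have "(\<lambda>x. indicator B (eig_stat f N A (goe_mat x))) \<in> borel_measurable (PiM (goe_index N) (\<lambda>_. borel))"
      by measurable
    from measurable_compose[OF mc this] show ?thesis by (simp add: Ph_def case_prod_beta')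
  qed
  have W: "orthogonal_on {..<N} (W y)" and vW: "\<And>a x. a < N \<Longrightarrow> ip N (v a) (mv N (W y) x) = ip N (gs N (rows y) a) x"
    if "gs_nondeg N (rows y)" for y
  proof -
    have oq: "ip N (gs N (rows y) a) (gs N (rows y) b) = of_bool (a = b)" if "a < N" "b < N" for a b
      using orthogonal_gs[OF \<open>gs_nondeg N (rows y)\<close>] that by (simp add: orthogonal_on_ip)
    show "orthogonal_on {..<N} (W y)"
      unfolding orthogonal_on_ip
    proof (intro allI impI)
      fix i j assume ij: "i < N" "j < N"
      have "ip N (W y i) (W y j) = (\<Sum>a<N. \<Sum>b<N. if b = a then v a i * v b j else 0)"
        unfolding W_def ip_simps sum_distrib_left by (intro sum.cong refl) (auto simp: oq)
      also have "\<dots> = (\<Sum>a<N. v a i * v a j)" by simp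
      also have "\<dots> = of_bool (i = j)"
        using orthogonal_on_transpose[OF o] ij by (simp add: orthogonal_on_def)
      finally show "ip N (W y i) (W y j) = of_bool (i = j)" .
    qed
    fix a x assume a: "a < N"
    have "mv N (W y) x = (\<lambda>i. \<Sum>b<N. ip N (gs N (rows y) b) x * v b i)"
      unfolding mv_def W_def ip_def sum_distrib_right
      by (rule ext, subst sum.swap) (simp add: algebra_simps)
    then have "ip N (v a) (mv N (W y) x) = (\<Sum>b<N. if b = a then ip N (gs N (rows y) b) x else 0)"
      unfolding ip_simps using o a by (auto simp: orthogonal_on_ip ip_simps intro!: sum.cong)
    then show "ip N (v a) (mv N (W y) x) = ip N (gs N (rows y) a) x" using a by simp
  qed
  have "(\<integral>\<^sup>+y. (\<integral>\<^sup>+g. Ph g y \<partial>goe N) \<partial>gauss_vecs N) = (\<integral>\<^sup>+y. ?L \<partial>gauss_vecs N)"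
  proof (rule nn_integral_cong_AE)
    show "AE y in gauss_vecs N. (\<integral>\<^sup>+g. Ph g y \<partial>goe N) = ?L"
      using AE_gs_nondeg[of N]
    proof eventually_elim
      case (elim y)
      show ?case unfolding Ph_def
        by (rule nn_integral_goe_conj[OF N W[OF elim], of "\<lambda>g. indicator B (eig_stat f N A (goe_mat g))"]) measurable
    qed
  qed
  then have 1: "?L = (\<integral>\<^sup>+y. (\<integral>\<^sup>+g. Ph g y \<partial>goe N) \<partial>gauss_vecs N)"
    by (simp add: Y.emeasure_space_1)
  also have "\<dots> = (\<integral>\<^sup>+g. (\<integral>\<^sup>+y. Ph g y \<partial>gauss_vecs N) \<partial>goe N)"
    by (rule Fubini'[OF mPh])
  also have "\<dots> = (\<integral>\<^sup>+g. ?R \<partial>goe N)"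
  proof (rule nn_integral_cong_AE)
    show "AE g in goe N. (\<integral>\<^sup>+y. Ph g y \<partial>gauss_vecs N) = ?R"
      using AE_goe_simple_spectrum[OF N]
    proof eventually_elim
      case (elim g)
      \<comment> \<open>For fixed g the conjugated matrix has eigenvectors W (u b), whose
        coordinates in the eigenbasis of A are the inner products of q_a with u b. These are the
        entries of the Gram--Schmidt matrix of rows rotated by u, and the rotation does not affect
        the Gaussian law.\<close>
      obtain u mu where ou: "orthogonal_on {..<N} u"
        and eu: "\<And>b i. b < N \<Longrightarrow> i < N \<Longrightarrow> mv N (goe_mat g) (u b) i = mu b * u b i"
        using spectral_decomposition[of N "goe_mat g"] goe_mat_sym by metis
      have inj: "inj_on mu {..<N}" by (rule inj_on_eigenbasis_if_card[OF ou eu elim])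
      have "(\<integral>\<^sup>+y. Ph g y \<partial>gauss_vecs N)
         = (\<integral>\<^sup>+y. indicator B (haar_stat f N lam (gs N (rows (kron N u idm y)))) \<partial>gauss_vecs N)"
      proof (rule nn_integral_cong_AE)
        show "AE y in gauss_vecs N. Ph g y = indicator B (haar_stat f N lam (gs N (rows (kron N u idm y))))"
          using AE_gs_nondeg[of N]
        proof eventually_elim
          case (elim y)
          have "eig_stat f N A (goe_mat (conj_goe N (W y) g)) = eig_stat f N A (conj_mat N (W y) (goe_mat g))"
            by (rule eig_stat_cong) (rule goe_mat_conj_goe)
          also have "\<dots> = Max ((\<lambda>b. f (real N * qform N A (mv N (W y) (u b)))) ` {..<N})"
            by (rule eig_stat_conj_mat[OF ou eu inj W[OF elim]])
          also have "\<dots> = haar_stat f N lam (gs N (rows (kron N u idm y)))"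
            unfolding haar_stat_def
          proof (intro arg_cong[where f = Max] image_cong refl)
            fix b assume "b \<in> {..<N}"
            then have b: "b < N" by simp
            have "qform N A (mv N (W y) (u b)) = (\<Sum>a<N. lam a * (ip N (v a) (mv N (W y) (u b)))\<^sup>2)"
              by (rule qform_eigenbasis[OF sym o e])
            also have "\<dots> = (\<Sum>a<N. lam a * (gs N (rows (kron N u idm y)) a b)\<^sup>2)"
            proof -
              have "ip N (v a) (mv N (W y) (u b)) = gs N (rows (kron N u idm y)) a b" if "a < N" for a
                unfolding vW[OF elim that] gs_rows_kron[OF ou that b] by (simp add: mv_def ip_def mult.commute)
              then show ?thesis by simp
            qed
            finally show "f (real N * qform N A (mv N (W y) (u b)))
               = f (real N * (\<Sum>a<N. lam a * (gs N (rows (kron N u idm y)) a b)\<^sup>2))" by simp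
          qed
          finally show ?case by (simp add: Ph_def)
        qed
      qed
      also have "\<dots> = ?R" by (rule nn_integral_kron[OF ou orthogonal_idm]) measurable
      finally show ?case .
    qed
  qed
  also have "\<dots> = ?R" by (simp add: G.emeasure_space_1)
  finally show ?thesis .
qed

section \<open>Concentration of Gaussian quadratic forms\<close>


abbreviation stdN :: "real measure" where
  "stdN \<equiv> density lborel (\<lambda>x. ennreal (std_normal_density x))"

text \<open>The tilted density is, up to the factor claimed, again a normal density, of variance 1 /
  (1 - 2 s).\<close>

lemma nn_integral_exp_square:
  assumes "s < 1 / 2"
  shows "(\<integral>\<^sup>+x. exp (s * x\<^sup>2) \<partial>stdN) = 1 / sqrt (1 - 2 * s)"
proof -
  define c where "c = sqrt (1 - 2 * s)"
  have c: "c > 0" and c2: "c\<^sup>2 = 1 - 2 * s" using assms by (auto simp: c_def)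
  have e: "std_normal_density x * exp (s * x\<^sup>2) = (1 / c) * normal_density 0 (1 / c) x" for x
  proof -
    have "exp (- x\<^sup>2 / 2) * exp (s * x\<^sup>2) = exp (- x\<^sup>2 * c\<^sup>2 / 2)"
      by (simp add: exp_add[symmetric] c2 field_simps)
    then show ?thesis using c
      by (simp add: std_normal_density_def normal_density_def real_sqrt_divide real_sqrt_mult power_divide field_simps)
  qed
  have "(\<integral>\<^sup>+x. exp (s * x\<^sup>2) \<partial>stdN) = (\<integral>\<^sup>+x. std_normal_density x * exp (s * x\<^sup>2) \<partial>lborel)"
    by (subst nn_integral_density) (auto simp: ennreal_mult)
  also have "\<dots> = (\<integral>\<^sup>+x. ennreal (1 / c) * normal_density 0 (1 / c) x \<partial>lborel)"
    unfolding e using c by (intro nn_integral_cong ennreal_mult) auto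
  also have "\<dots> = ennreal (1 / c) * (\<integral>\<^sup>+x. normal_density 0 (1 / c) x \<partial>lborel)"
    by (rule nn_integral_cmult) simp
  also have "(\<integral>\<^sup>+x. normal_density 0 (1 / c) x \<partial>lborel) = 1"
    using c by (subst nn_integral_eq_integral) auto
  finally show ?thesis by (simp add: c_def)
qed

lemma nn_integral_exp_square_centered:
  assumes "\<bar>s\<bar> \<le> 1 / 4"
  shows "(\<integral>\<^sup>+x. exp (s * (x\<^sup>2 - 1)) \<partial>stdN) \<le> exp (4 * s\<^sup>2)"
proof -
  have s: "s < 1 / 2" using assms by linarith
  have "(\<integral>\<^sup>+x. exp (s * (x\<^sup>2 - 1)) \<partial>stdN) = (\<integral>\<^sup>+x. ennreal (exp (- s)) * exp (s * x\<^sup>2) \<partial>stdN)"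
    by (intro nn_integral_cong) (simp add: ennreal_mult[symmetric] exp_add[symmetric] right_diff_distrib)
  also have "\<dots> = ennreal (exp (- s)) * ennreal (1 / sqrt (1 - 2 * s))"
    by (simp add: nn_integral_cmult nn_integral_exp_square[OF s])
  also have "\<dots> = ennreal (exp (- s) / sqrt (1 - 2 * s))"
    using s by (simp add: ennreal_mult[symmetric])
  also have "\<dots> \<le> exp (4 * s\<^sup>2)"
  proof (rule ennreal_leI)
    \<comment> \<open>The hypothesis on s gives the bound 1 / 2 on its double that this logarithm
      estimate asks for. The error is at most 8 s^2; halved by the square root it becomes the
      exponent 4 s^2.\<close>
    have "\<bar>ln (1 + (- 2 * s)) - (- 2 * s)\<bar> \<le> 2 * (- 2 * s)\<^sup>2"
      by (rule abs_ln_one_plus_x_minus_x_bound) (use assms in \<open>simp add: abs_mult\<close>)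
    then have "- 2 * s - 8 * s\<^sup>2 \<le> ln (1 - 2 * s)" by (simp add: power2_eq_square abs_le_iff)
    then have l: "- s - ln (1 - 2 * s) / 2 \<le> 4 * s\<^sup>2" by simp
    have a: "ln (sqrt (1 - 2 * s)) = ln (1 - 2 * s) / 2" using s by (intro ln_sqrt) simp
    have "exp (ln (sqrt (1 - 2 * s))) = sqrt (1 - 2 * s)" using s by (intro exp_ln) simp
    then have "sqrt (1 - 2 * s) = exp (ln (1 - 2 * s) / 2)" unfolding a by (rule sym)
    then have "exp (- s) / sqrt (1 - 2 * s) = exp (- s - ln (1 - 2 * s) / 2)"
      by (simp add: exp_diff)
    then show "exp (- s) / sqrt (1 - 2 * s) \<le> exp (4 * s\<^sup>2)" using l by simp
  qed
  finally show ?thesis .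
qed

lemma nn_integral_gauss_prod:
  assumes "finite I" "\<And>i. i \<in> I \<Longrightarrow> f i \<in> borel_measurable borel"
  shows "(\<integral>\<^sup>+x. (\<Prod>i\<in>I. f i (x i)) \<partial>gauss I) = (\<Prod>i\<in>I. \<integral>\<^sup>+x. f i x \<partial>stdN)"
  unfolding gauss_def by (rule std.product_nn_integral_prod) (use assms in auto)

lemma prod_ennreal_le:
  fixes f g :: "'i \<Rightarrow> ennreal"
  shows "(\<And>i. i \<in> I \<Longrightarrow> f i \<le> g i) \<Longrightarrow> (\<Prod>i\<in>I. f i) \<le> (\<Prod>i\<in>I. g i)"
  by (induction I rule: infinite_finite_induct) (auto intro: mult_mono)

lemma nn_integral_exp_quadratic:
  assumes "finite I" "\<And>i. i \<in> I \<Longrightarrow> \<bar>s i\<bar> \<le> 1 / 4"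
  shows "(\<integral>\<^sup>+x. exp (\<Sum>i\<in>I. s i * ((x i)\<^sup>2 - 1)) \<partial>gauss I) \<le> exp (4 * (\<Sum>i\<in>I. (s i)\<^sup>2))"
proof -
  have "(\<integral>\<^sup>+x. exp (\<Sum>i\<in>I. s i * ((x i)\<^sup>2 - 1)) \<partial>gauss I)
      = (\<integral>\<^sup>+x. (\<Prod>i\<in>I. ennreal (exp (s i * ((x i)\<^sup>2 - 1)))) \<partial>gauss I)"
    using assms(1) by (simp add: exp_sum prod_ennreal)
  also have "\<dots> = (\<Prod>i\<in>I. \<integral>\<^sup>+x. exp (s i * (x\<^sup>2 - 1)) \<partial>stdN)"
    by (rule nn_integral_gauss_prod[where f = "\<lambda>i x. ennreal (exp (s i * (x\<^sup>2 - 1)))"]) (use assms in auto)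
  also have "\<dots> \<le> (\<Prod>i\<in>I. ennreal (exp (4 * (s i)\<^sup>2)))"
    by (intro prod_ennreal_le nn_integral_exp_square_centered assms)
  also have "\<dots> = exp (4 * (\<Sum>i\<in>I. (s i)\<^sup>2))"
    using assms(1) by (simp add: exp_sum prod_ennreal sum_distrib_left)
  finally show ?thesis .
qed

text \<open>Chernoff's method with parameter 1 / (4 \<eta>) for both signs of the sum. Each
  coefficient is at most \<eta> in modulus, so the scaled ones are at most 1 / 4, and the exponent 4
  (\<Sum> \<mu>^2) / (16 \<eta>^2) is at most 1 / 4.\<close>

lemma gauss_quadratic_tail:
  assumes I: "finite I" and \<eta>: "0 < \<eta>" "(\<Sum>i\<in>I. (\<mu> i)\<^sup>2) \<le> \<eta>\<^sup>2"
  shows "(\<integral>\<^sup>+x. (if t \<le> \<bar>\<Sum>i\<in>I. \<mu> i * ((x i)\<^sup>2 - 1)\<bar> then 1 else 0) \<partial>gauss I) \<le> 2 * exp (1 / 4 - t / (4 * \<eta>))"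
proof -
  have m[measurable]: "(\<lambda>x. \<Sum>i\<in>I. c i * ((x i)\<^sup>2 - 1)) \<in> borel_measurable (gauss I)" for c :: "'a \<Rightarrow> real"
  proof -
    have "(\<lambda>x. \<Sum>i\<in>I. c i * ((x i)\<^sup>2 - 1)) \<in> borel_measurable (PiM I (\<lambda>_. borel :: real measure))"
      by (intro borel_measurable_sum) measurable
    then show ?thesis by measurable
  qed
  have bd: "(\<integral>\<^sup>+x. exp (\<Sum>i\<in>I. (e / (4 * \<eta>) * \<mu> i) * ((x i)\<^sup>2 - 1)) \<partial>gauss I) \<le> exp (1 / 4)" if e: "\<bar>e\<bar> = 1" for e
  proof -
    have "\<bar>e / (4 * \<eta>) * \<mu> i\<bar> \<le> 1 / 4" if "i \<in> I" for i
    proof -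
      have "(\<mu> i)\<^sup>2 \<le> (\<Sum>i\<in>I. (\<mu> i)\<^sup>2)" by (rule member_le_sum) (use that I in auto)
      then have "(\<mu> i)\<^sup>2 \<le> \<eta>\<^sup>2" using \<eta> by simp
      then have "\<bar>\<mu> i\<bar> \<le> \<eta>" using \<eta>(1) by (simp add: abs_le_square_iff[symmetric])
      then show ?thesis using e \<eta>(1) by (simp add: abs_mult abs_divide field_simps)
    qed
    then have "(\<integral>\<^sup>+x. exp (\<Sum>i\<in>I. (e / (4 * \<eta>) * \<mu> i) * ((x i)\<^sup>2 - 1)) \<partial>gauss I)
        \<le> exp (4 * (\<Sum>i\<in>I. (e / (4 * \<eta>) * \<mu> i)\<^sup>2))"
      by (intro nn_integral_exp_quadratic[OF I])
    also have "\<dots> \<le> exp (1 / 4)"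
    proof (intro ennreal_leI)
      have "e\<^sup>2 = 1" using e by (metis abs_square_eq_1)
      then have "4 * (\<Sum>i\<in>I. (e / (4 * \<eta>) * \<mu> i)\<^sup>2) = (\<Sum>i\<in>I. (\<mu> i)\<^sup>2) / (4 * \<eta>\<^sup>2)"
        by (simp add: power_mult_distrib power_divide sum_distrib_left[symmetric] sum_divide_distrib[symmetric])
      also have "\<dots> \<le> 1 / 4" using \<eta> by (simp add: field_simps)
      finally show "exp (4 * (\<Sum>i\<in>I. (e / (4 * \<eta>) * \<mu> i)\<^sup>2)) \<le> exp (1 / 4)" by simp
    qed
    finally show ?thesis .
  qed
  let ?S = "\<lambda>x. \<Sum>i\<in>I. \<mu> i * ((x i)\<^sup>2 - 1)"
  let ?E = "\<lambda>e x. exp (\<Sum>i\<in>I. (e / (4 * \<eta>) * \<mu> i) * ((x i)\<^sup>2 - 1))"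
  have E: "?E e x = exp (e * ?S x / (4 * \<eta>))" for e x
    by (simp add: sum_distrib_left sum_divide_distrib mult_ac)
  have "(\<integral>\<^sup>+x. (if t \<le> \<bar>?S x\<bar> then 1 else 0) \<partial>gauss I)
      \<le> (\<integral>\<^sup>+x. ennreal (exp (- t / (4 * \<eta>))) * ennreal (?E 1 x) + ennreal (exp (- t / (4 * \<eta>))) * ennreal (?E (-1) x) \<partial>gauss I)"
  proof (rule nn_integral_mono)
    fix x
    show "(if t \<le> \<bar>?S x\<bar> then 1 else 0)
        \<le> ennreal (exp (- t / (4 * \<eta>))) * ennreal (?E 1 x) + ennreal (exp (- t / (4 * \<eta>))) * ennreal (?E (-1) x)"
    proof (cases "t \<le> \<bar>?S x\<bar>")
      case True
      have eq: "ennreal (exp (- t / (4 * \<eta>))) * ennreal (?E 1 x) + ennreal (exp (- t / (4 * \<eta>))) * ennreal (?E (-1) x)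
          = ennreal (exp ((?S x - t) / (4 * \<eta>)) + exp ((- ?S x - t) / (4 * \<eta>)))"
        unfolding E by (simp add: ennreal_mult[symmetric] exp_add[symmetric] ennreal_plus[symmetric] diff_divide_distrib add.commute del: ennreal_plus)
      have "1 \<le> exp ((?S x - t) / (4 * \<eta>)) + exp ((- ?S x - t) / (4 * \<eta>))"
      proof (cases "0 \<le> ?S x")
        case True
        then have "0 \<le> (?S x - t) / (4 * \<eta>)" using \<open>t \<le> \<bar>?S x\<bar>\<close> \<eta>(1) by simp
        then have "1 \<le> exp ((?S x - t) / (4 * \<eta>))" by simp
        then show ?thesis by (simp add: add_increasing2)
      next
        case False
        then have "0 \<le> (- ?S x - t) / (4 * \<eta>)" using \<open>t \<le> \<bar>?S x\<bar>\<close> \<eta>(1) by simp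
        then have "1 \<le> exp ((- ?S x - t) / (4 * \<eta>))" by simp
        then show ?thesis by (simp add: add_increasing)
      qed
      then have "ennreal 1 \<le> ennreal (exp ((?S x - t) / (4 * \<eta>)) + exp ((- ?S x - t) / (4 * \<eta>)))"
        by (rule ennreal_leI)
      then show ?thesis unfolding eq using True by (simp only: if_True ennreal_1)
    qed simp
  qed
  also have "\<dots> = ennreal (exp (- t / (4 * \<eta>))) * (\<integral>\<^sup>+x. ?E 1 x \<partial>gauss I) + ennreal (exp (- t / (4 * \<eta>))) * (\<integral>\<^sup>+x. ?E (-1) x \<partial>gauss I)"
    by (subst nn_integral_add) (auto simp: nn_integral_cmult)
  also have "\<dots> \<le> ennreal (exp (- t / (4 * \<eta>))) * exp (1 / 4) + ennreal (exp (- t / (4 * \<eta>))) * exp (1 / 4)"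
    by (intro add_mono mult_left_mono bd) auto
  also have "\<dots> = 2 * exp (1 / 4 - t / (4 * \<eta>))"
    by (simp add: ennreal_mult[symmetric] ennreal_plus[symmetric] exp_add[symmetric] del: ennreal_plus)
  finally show ?thesis .
qed

text \<open>On the event, exp (N / 2 - |x|^2) exceeds 1. Its expectation is a product of N equal
  factors, namely exp (1 / 2) times the integral of exp (- x^2), which is 1 / sqrt 3.\<close>

lemma gauss_norm_tail:
  "(\<integral>\<^sup>+x. (if ip N x x < real N / 2 then 1 else 0) \<partial>gauss {..<N}) \<le> (exp (1 / 2) / sqrt 3) ^ N"
proof -
  have "(\<integral>\<^sup>+x. (if ip N x x < real N / 2 then 1 else 0) \<partial>gauss {..<N})
     \<le> (\<integral>\<^sup>+x. (\<Prod>i<N. ennreal (exp (1 / 2) * exp ((- 1) * (x i)\<^sup>2))) \<partial>gauss {..<N})"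
  proof (rule nn_integral_mono)
    fix x :: "nat \<Rightarrow> real"
    have "(\<Prod>i<N. ennreal (exp (1 / 2) * exp ((- 1) * (x i)\<^sup>2))) = ennreal (exp (\<Sum>i<N. 1 / 2 - (x i)\<^sup>2))"
      by (simp add: prod_ennreal exp_sum exp_add[symmetric])
    also have "(\<Sum>i<N. 1 / 2 - (x i)\<^sup>2) = real N / 2 - ip N x x"
      by (simp add: sum_subtractf ip_def power2_eq_square)
    finally show "(if ip N x x < real N / 2 then 1 else 0) \<le> (\<Prod>i<N. ennreal (exp (1 / 2) * exp ((- 1) * (x i)\<^sup>2)))"
      by (simp add: ennreal_1[symmetric] del: ennreal_1)
  qed
  also have "\<dots> = (\<Prod>i<N. \<integral>\<^sup>+x. exp (1 / 2) * exp ((- 1) * x\<^sup>2) \<partial>stdN)"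
    by (rule nn_integral_gauss_prod[where f = "\<lambda>i x. ennreal (exp (1 / 2) * exp ((- 1) * x\<^sup>2))"]) auto
  also have "(\<integral>\<^sup>+x. exp (1 / 2) * exp ((- 1) * x\<^sup>2) \<partial>stdN) = ennreal (exp (1 / 2)) * (\<integral>\<^sup>+x. exp ((- 1) * x\<^sup>2) \<partial>stdN)"
    by (subst nn_integral_cmult[symmetric]) (auto simp: ennreal_mult)
  also have "\<dots> = ennreal (exp (1 / 2) / sqrt 3)"
    by (subst nn_integral_exp_square) (auto simp: ennreal_mult[symmetric])
  finally show ?thesis by (simp add: ennreal_power)
qed

definition trace :: "nat \<Rightarrow> (nat \<Rightarrow> nat \<Rightarrow> real) \<Rightarrow> real" where
  "trace N M = (\<Sum>i<N. M i i)"

text \<open>The squared Frobenius norm.\<close>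

definition frob :: "nat \<Rightarrow> (nat \<Rightarrow> nat \<Rightarrow> real) \<Rightarrow> real" where
  "frob N M = (\<Sum>i<N. \<Sum>j<N. (M i j)\<^sup>2)"

lemma
  assumes o: "orthogonal_on {..<N} v"
    and e: "\<And>b i. b < N \<Longrightarrow> i < N \<Longrightarrow> mv N M (v b) i = \<mu> b * v b i"
  shows trace_eigenbasis: "trace N M = (\<Sum>a<N. \<mu> a)"
    and frob_eigenbasis: "frob N M = (\<Sum>a<N. (\<mu> a)\<^sup>2)"
proof -
  have vv: "(\<Sum>i<N. (v a i)\<^sup>2) = 1" if "a < N" for a
    using o that by (simp add: orthogonal_on_def power2_eq_square)
  have c: "ip N (v a) (M i) = \<mu> a * v a i" if "a < N" "i < N" for a i
    using e[OF that] by (simp add: ip_def mv_def mult.commute)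
  have "trace N M = (\<Sum>i<N. \<Sum>a<N. \<mu> a * (v a i)\<^sup>2)"
    unfolding trace_def
  proof (rule sum.cong[OF refl])
    fix i assume "i \<in> {..<N}"
    then have i: "i < N" by simp
    show "M i i = (\<Sum>a<N. \<mu> a * (v a i)\<^sup>2)"
      using orthonormal_expand[OF o i, of "M i"] c[OF _ i] by (simp add: power2_eq_square mult.assoc)
  qed
  then show "trace N M = (\<Sum>a<N. \<mu> a)"
    by (subst (asm) sum.swap) (simp add: sum_distrib_left[symmetric] vv)
  have "frob N M = (\<Sum>i<N. \<Sum>a<N. (\<mu> a)\<^sup>2 * (v a i)\<^sup>2)"
    unfolding frob_def
  proof (rule sum.cong[OF refl])
    fix i assume "i \<in> {..<N}"
    then have i: "i < N" by simp
    have "(\<Sum>j<N. (M i j)\<^sup>2) = ip N (M i) (M i)" by (simp add: ip_def power2_eq_square)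
    also have "\<dots> = (\<Sum>a<N. (\<mu> a)\<^sup>2 * (v a i)\<^sup>2)"
      unfolding parseval[OF o, of "M i" "M i"] using c[OF _ i] by (simp add: power2_eq_square mult_ac)
    finally show "(\<Sum>j<N. (M i j)\<^sup>2) = (\<Sum>a<N. (\<mu> a)\<^sup>2 * (v a i)\<^sup>2)" .
  qed
  then show "frob N M = (\<Sum>a<N. (\<mu> a)\<^sup>2)"
    by (subst (asm) sum.swap) (simp add: sum_distrib_left[symmetric] vv)
qed

lemma measurable_qform_gauss [measurable]: "qform N M \<in> borel_measurable (gauss {..<N})"
proof -
  have "qform N M \<in> borel_measurable (PiM {..<N} (\<lambda>_. borel))"
    unfolding qform_def[abs_def]
    by (intro borel_measurable_sum borel_measurable_times borel_measurable_const measurable_component_singleton) auto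
  then show ?thesis by measurable
qed

lemma measurable_ip_gauss [measurable]: "(\<lambda>x. ip N x x) \<in> borel_measurable (gauss {..<N})"
proof -
  have "(\<lambda>x. ip N x x) \<in> borel_measurable (PiM {..<N} (\<lambda>_. borel))"
    unfolding ip_def
    by (intro borel_measurable_sum borel_measurable_times measurable_component_singleton) auto
  then show ?thesis by measurable
qed

lemma lin_eq_mv: "i < N \<Longrightarrow> lin {..<N} T x i = mv N T x i"
  by (simp add: lin_def mv_def)

text \<open>In an eigenbasis of M, the quadratic form minus its mean is a sum of multiples of
  centred squares, and rotation invariance allows the change of basis.\<close>

lemma gauss_qform_tail:
  assumes sym: "\<And>i j. i < N \<Longrightarrow> j < N \<Longrightarrow> M i j = M j i"
    and \<eta>: "0 < \<eta>" "frob N M \<le> \<eta>\<^sup>2"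
  shows "(\<integral>\<^sup>+x. (if t \<le> \<bar>qform N M x - trace N M\<bar> then 1 else 0) \<partial>gauss {..<N}) \<le> 2 * exp (1 / 4 - t / (4 * \<eta>))"
proof -
  obtain v \<mu> where o: "orthogonal_on {..<N} v"
    and e: "\<And>b i. b < N \<Longrightarrow> i < N \<Longrightarrow> mv N M (v b) i = \<mu> b * v b i"
    using spectral_decomposition[of N M] sym by metis
  define S where "S = (\<lambda>x. \<Sum>i<N. \<mu> i * ((x i)\<^sup>2 - 1))"
  have S: "qform N M x - trace N M = S (lin {..<N} v x)" for x
  proof -
    have "qform N M x = (\<Sum>a<N. \<mu> a * (ip N (v a) x)\<^sup>2)" by (rule qform_eigenbasis[OF sym o e])
    moreover have "trace N M = (\<Sum>a<N. \<mu> a)" by (rule trace_eigenbasis[OF o e])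
    ultimately show ?thesis
      by (simp add: S_def lin_eq_mv mv_def ip_def right_diff_distrib sum_subtractf)
  qed
  have [measurable]: "S \<in> borel_measurable (gauss {..<N})"
  proof -
    have "S \<in> borel_measurable (PiM {..<N} (\<lambda>_. borel :: real measure))"
      unfolding S_def by (intro borel_measurable_sum) measurable
    then show ?thesis by measurable
  qed
  have "(\<integral>\<^sup>+x. (if t \<le> \<bar>qform N M x - trace N M\<bar> then 1 else 0) \<partial>gauss {..<N})
      = (\<integral>\<^sup>+x. (if t \<le> \<bar>S (lin {..<N} v x)\<bar> then 1 else 0) \<partial>gauss {..<N})"
    by (simp add: S)
  also have "\<dots> = (\<integral>\<^sup>+x. (if t \<le> \<bar>S x\<bar> then 1 else 0) \<partial>gauss {..<N})"
    by (rule nn_integral_gauss_orthogonal[OF _ o, of "\<lambda>x. if t \<le> \<bar>S x\<bar> then 1 else 0"]) auto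
  also have "\<dots> \<le> 2 * exp (1 / 4 - t / (4 * \<eta>))"
    unfolding S_def by (rule gauss_quadratic_tail) (use \<eta> frob_eigenbasis[OF o e] in auto)
  finally show ?thesis .
qed

text \<open>The inequality is homogeneous in x, so it speaks about the direction of x only. Unless
  |x|^2 is below N / 2, it forces |qform| > \<epsilon> / 2; the trace takes at most \<epsilon> / 4
  of this, and the fluctuation must supply the other \<epsilon> / 4, whence the 16 in the
  exponent.\<close>

lemma gauss_qform_ratio_tail:
  assumes sym: "\<And>i j. i < N \<Longrightarrow> j < N \<Longrightarrow> M i j = M j i"
    and \<eta>: "0 < \<eta>" "frob N M \<le> \<eta>\<^sup>2" and \<epsilon>: "0 < \<epsilon>" and tr: "\<bar>trace N M\<bar> \<le> \<epsilon> / 4"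
  shows "(\<integral>\<^sup>+x. (if \<epsilon> * ip N x x < real N * \<bar>qform N M x\<bar> then 1 else 0) \<partial>gauss {..<N})
    \<le> 2 * exp (1 / 4 - \<epsilon> / (16 * \<eta>)) + (exp (1 / 2) / sqrt 3) ^ N"
proof -
  have "(\<integral>\<^sup>+x. (if \<epsilon> * ip N x x < real N * \<bar>qform N M x\<bar> then 1 else 0) \<partial>gauss {..<N})
     \<le> (\<integral>\<^sup>+x. (if \<epsilon> / 4 \<le> \<bar>qform N M x - trace N M\<bar> then 1 else 0) + (if ip N x x < real N / 2 then 1 else 0) \<partial>gauss {..<N})"
  proof (rule nn_integral_mono)
    fix x :: "nat \<Rightarrow> real"
    have "\<epsilon> / 4 \<le> \<bar>qform N M x - trace N M\<bar>"
      if "\<epsilon> * ip N x x < real N * \<bar>qform N M x\<bar>" "\<not> ip N x x < real N / 2"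
    proof -
      have N: "real N > 0" using that(1) \<epsilon> ip_nonneg[of N x] by (cases "N = 0") (auto simp: ip_def)
      have "\<epsilon> * (real N / 2) \<le> \<epsilon> * ip N x x" using that(2) \<epsilon> by (intro mult_left_mono) auto
      then have "real N * (\<epsilon> / 2) < real N * \<bar>qform N M x\<bar>" using that(1) by (simp add: mult_ac)
      then have "\<epsilon> / 2 < \<bar>qform N M x\<bar>" using N by (simp only: mult_less_cancel_left_pos)
      then show ?thesis using tr by linarith
    qed
    then show "(if \<epsilon> * ip N x x < real N * \<bar>qform N M x\<bar> then 1 else 0)
       \<le> (if \<epsilon> / 4 \<le> \<bar>qform N M x - trace N M\<bar> then 1 else 0 :: ennreal) + (if ip N x x < real N / 2 then 1 else 0)"
      by auto
  qed
  also have "\<dots> = (\<integral>\<^sup>+x. (if \<epsilon> / 4 \<le> \<bar>qform N M x - trace N M\<bar> then 1 else 0) \<partial>gauss {..<N})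
     + (\<integral>\<^sup>+x. (if ip N x x < real N / 2 then 1 else 0) \<partial>gauss {..<N})"
    by (rule nn_integral_add) auto
  also have "\<dots> \<le> ennreal (2 * exp (1 / 4 - (\<epsilon> / 4) / (4 * \<eta>))) + ennreal ((exp (1 / 2) / sqrt 3) ^ N)"
    by (intro add_mono gauss_qform_tail gauss_norm_tail sym \<eta>)
  finally show ?thesis by (simp add: ennreal_plus[symmetric] del: ennreal_plus)
qed

section \<open>The coupling error at a fixed index\<close>


definition Lmat :: "nat \<Rightarrow> (nat \<times> nat \<Rightarrow> real) \<Rightarrow> nat \<Rightarrow> nat \<Rightarrow> real" where
  "Lmat N y a b = ip N (rows y a) (gs N (rows y) b)"

definition Mmat :: "nat \<Rightarrow> (nat \<Rightarrow> real) \<Rightarrow> (nat \<times> nat \<Rightarrow> real) \<Rightarrow> nat \<Rightarrow> nat \<Rightarrow> real" where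
  "Mmat N lam y b c = lam b * of_bool (b = c) - (\<Sum>a<N. lam a * Lmat N y a b * Lmat N y a c) / real N"

text \<open>Completes a unit vector to an orthogonal matrix with that vector as row i, by the
  reflection that exchanges it with the i-th standard basis vector.\<close>

lemma householder:
  assumes h: "ip N h h = 1" and i: "i < N"
  shows "\<exists>W. orthogonal_on {..<N} W \<and> (\<forall>k<N. W i k = h k)"
proof -
  define e :: "nat \<Rightarrow> real" where "e = (\<lambda>k. of_bool (k = i))"
  define z where "z = (\<lambda>k. e k - h k)"
  have ee: "ip N e x = x i" for x
    using i by (simp add: ip_def e_def of_bool_def if_distrib[of "\<lambda>t. t * _"] cong: if_cong)
  have zz: "ip N z z = 2 * z i"
    unfolding z_def ip_simps by (simp add: ee ip_commute[of N h e] h) (simp add: e_def)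
  show ?thesis
  proof (cases "z i = 0")
    case True
    then have "\<forall>k<N. z k = 0" using zz by (simp add: ip_self_eq_0_iff)
    then have "\<forall>k<N. idm i k = h k" by (auto simp: z_def e_def idm_def)
    then show ?thesis using orthogonal_idm by blast
  next
    case False
    \<comment> \<open>The usual 1 - 2 z z^T / |z|^2, since \<open>zz\<close> says |z|^2 = 2 z i. If
      z i = 0, the two vectors coincide and the identity serves.\<close>
    define W where "W = (\<lambda>j k. idm j k - z j * z k / z i)"
    have "ip N (W j) (W l) = of_bool (j = l)" if "j < N" "l < N" for j l
    proof -
      have id: "ip N (idm m) x = x m" if "m < N" for m x
        using that by (simp add: ip_def idm_def of_bool_def if_distrib[of "\<lambda>t. t * _"] cong: if_cong)
      have W': "W j = (\<lambda>k. idm j k - (z j / z i) * z k)" for j by (simp add: W_def)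
      have "ip N (W j) (W l) = idm l j - (z l / z i) * z j - (z j / z i) * (z l - (z l / z i) * (2 * z i))"
        unfolding W' ip_simps using that zz by (simp add: id ip_commute[of N z "idm _"])
      also have "\<dots> = idm l j" using False by (simp add: algebra_simps)
      finally show ?thesis by (simp add: idm_def eq_commute)
    qed
    then have "orthogonal_on {..<N} W" by (simp add: orthogonal_on_ip)
    moreover have "\<forall>k<N. W i k = h k"
      using False by (auto simp: W_def z_def e_def idm_def)
    ultimately show ?thesis by blast
  qed
qed

lemma Lmat_kron:
  assumes "orthogonal_on {..<N} W" "a < N" "b < N"
  shows "Lmat N (kron N W idm y) a b = Lmat N y a b"
proof -
  have "Lmat N (kron N W idm y) a b = ip N (mv N W (rows y a)) (mv N W (gs N (rows y) b))"
    unfolding Lmat_def by (rule ip_cong) (use assms in \<open>auto simp: rows_kron_left gs_rows_kron\<close>)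
  then show ?thesis by (simp add: ip_mv_orthogonal[OF assms(1)] Lmat_def)
qed

lemma Mmat_kron:
  assumes "orthogonal_on {..<N} W" "b < N" "c < N"
  shows "Mmat N lam (kron N W idm y) b c = Mmat N lam y b c"
  using assms by (simp add: Mmat_def Lmat_kron)

lemma Mmat_sym: "Mmat N lam y b c = Mmat N lam y c b"
  by (auto simp: Mmat_def mult_ac)

lemma rows_expand:
  assumes "gs_nondeg N (rows y)" "i < N"
  shows "rows y a i = (\<Sum>b<N. Lmat N y a b * gs N (rows y) b i)"
  using orthonormal_expand[OF orthogonal_gs[OF assms(1)] assms(2), of "rows y a"]
  by (simp add: Lmat_def ip_commute)

lemma quadratic_difference:
  assumes nd: "gs_nondeg N (rows y)" and i: "i < N"
  shows "real N * (\<Sum>a<N. lam a * (gs N (rows y) a i)\<^sup>2) - (\<Sum>a<N. lam a * (y (i, a))\<^sup>2)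
    = real N * qform N (Mmat N lam y) (\<lambda>b. gs N (rows y) b i)"
proof -
  let ?g = "\<lambda>b. gs N (rows y) b i"
  have N: "real N \<noteq> 0" using i by simp
  have "(\<Sum>a<N. lam a * (y (i, a))\<^sup>2) = (\<Sum>a<N. \<Sum>b<N. \<Sum>c<N. ?g b * (lam a * Lmat N y a b * Lmat N y a c) * ?g c)"
  proof (rule sum.cong[OF refl])
    fix a
    \<comment> \<open>Column i of the factorisation Y = L Q.\<close>
    have "y (i, a) = (\<Sum>b<N. Lmat N y a b * ?g b)"
      using rows_expand[OF nd i, of a] by (simp add: rows_def)
    then show "lam a * (y (i, a))\<^sup>2 = (\<Sum>b<N. \<Sum>c<N. ?g b * (lam a * Lmat N y a b * Lmat N y a c) * ?g c)"
      by (simp add: power2_eq_square sum_product sum_distrib_left mult_ac)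
  qed
  also have "\<dots> = (\<Sum>b<N. \<Sum>c<N. \<Sum>a<N. ?g b * (lam a * Lmat N y a b * Lmat N y a c) * ?g c)"
    by (subst sum.swap, rule sum.cong[OF refl], rule sum.swap)
  also have "\<dots> = (\<Sum>b<N. \<Sum>c<N. ?g b * (\<Sum>a<N. lam a * Lmat N y a b * Lmat N y a c) * ?g c)"
    by (simp add: sum_distrib_left sum_distrib_right)
  finally have s: "(\<Sum>a<N. lam a * (y (i, a))\<^sup>2) = \<dots>" .
  have d: "(\<Sum>a<N. lam a * (?g a)\<^sup>2) = (\<Sum>b<N. \<Sum>c<N. ?g b * (lam b * of_bool (b = c)) * ?g c)"
  proof (rule sum.cong[OF refl])
    fix b assume b: "b \<in> {..<N}"
    have "(\<Sum>c<N. ?g b * (lam b * of_bool (b = c)) * ?g c) = (\<Sum>c<N. if c = b then ?g b * lam b * ?g b else 0)"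
      by (intro sum.cong) auto
    then show "lam b * (?g b)\<^sup>2 = (\<Sum>c<N. ?g b * (lam b * of_bool (b = c)) * ?g c)"
      using b by (simp add: power2_eq_square)
  qed
  have "real N * qform N (Mmat N lam y) ?g = (\<Sum>b<N. \<Sum>c<N. real N * (?g b * (lam b * of_bool (b = c)) * ?g c)
      - ?g b * (\<Sum>a<N. lam a * Lmat N y a b * Lmat N y a c) * ?g c)"
    unfolding qform_def sum_distrib_left[of "real N"]
  proof (intro sum.cong refl)
    fix b c
    show "real N * (?g b * Mmat N lam y b c * ?g c) = real N * (?g b * (lam b * of_bool (b = c)) * ?g c)
      - ?g b * (\<Sum>a<N. lam a * Lmat N y a b * Lmat N y a c) * ?g c"
      using N by (simp add: Mmat_def field_simps)
  qed
  also have "\<dots> = real N * (\<Sum>a<N. lam a * (?g a)\<^sup>2) - (\<Sum>a<N. lam a * (y (i, a))\<^sup>2)"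
    unfolding s d by (simp add: sum_subtractf sum_distrib_left)
  finally show ?thesis by simp
qed

text \<open>The bounds on M are part of the event, so that their failure is paid for once and not
  for every index in the union bound. The last condition is homogeneous in w, so it can be tested on
  a Gaussian vector instead of a unit vector.\<close>

definition bad_event :: "nat \<Rightarrow> (nat \<Rightarrow> nat \<Rightarrow> real) \<Rightarrow> real \<Rightarrow> real \<Rightarrow> (nat \<Rightarrow> real) \<Rightarrow> bool" where
  "bad_event N M \<eta> \<epsilon> w \<longleftrightarrow> frob N M \<le> \<eta>\<^sup>2 \<and> \<bar>trace N M\<bar> \<le> \<epsilon> / 4 \<and> \<epsilon> * ip N w w < real N * \<bar>qform N M w\<bar>"

lemma bad_event_cong:
  assumes "\<And>i j. i < N \<Longrightarrow> j < N \<Longrightarrow> M i j = M' i j" "\<And>i. i < N \<Longrightarrow> w i = w' i"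
  shows "bad_event N M \<eta> \<epsilon> w = bad_event N M' \<eta> \<epsilon> w'"
proof -
  have "frob N M = frob N M'" unfolding frob_def by (intro sum.cong refl) (use assms in auto)
  moreover have "trace N M = trace N M'" unfolding trace_def by (intro sum.cong refl) (use assms in auto)
  moreover have "qform N M w = qform N M' w'" unfolding qform_def by (intro sum.cong refl) (use assms in auto)
  moreover have "ip N w w = ip N w' w'" by (rule ip_cong) (use assms in auto)
  ultimately show ?thesis by (simp add: bad_event_def)
qed

lemma bad_event_scale:
  assumes "c \<noteq> 0"
  shows "bad_event N M \<eta> \<epsilon> (\<lambda>i. c * w i) = bad_event N M \<eta> \<epsilon> w"
proof -
  have q: "qform N M (\<lambda>i. c * w i) = c\<^sup>2 * qform N M w"
    unfolding qform_def sum_distrib_left by (intro sum.cong refl) (simp add: power2_eq_square mult_ac)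
  have "\<epsilon> * ip N (\<lambda>i. c * w i) (\<lambda>i. c * w i) < real N * \<bar>qform N M (\<lambda>i. c * w i)\<bar>
      \<longleftrightarrow> c\<^sup>2 * (\<epsilon> * ip N w w) < c\<^sup>2 * (real N * \<bar>qform N M w\<bar>)"
  proof -
    have "\<bar>c\<^sup>2 * qform N M w\<bar> = c\<^sup>2 * \<bar>qform N M w\<bar>" by (simp add: abs_mult)
    then show ?thesis unfolding q by (simp only:) (simp add: ip_simps power2_eq_square mult_ac)
  qed
  also have "\<dots> \<longleftrightarrow> \<epsilon> * ip N w w < real N * \<bar>qform N M w\<bar>" using assms by simp
  finally show ?thesis by (simp add: bad_event_def)
qed

lemma measurable_Lmat:
  assumes "a < N" "b < N"
  shows "(\<lambda>y. Lmat N y a b) \<in> borel_measurable (gauss_vecs N)"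
proof -
  have "(\<lambda>y. Lmat N y a b) \<in> borel_measurable (PiM (sq_index N) (\<lambda>_. borel))"
    unfolding Lmat_def ip_def rows_def[of _ a]
    by (intro borel_measurable_sum borel_measurable_times measurable_component_singleton measurable_gs) (use assms in auto)
  then show ?thesis by measurable
qed

lemma measurable_Mmat:
  assumes "b < N" "c < N"
  shows "(\<lambda>y. Mmat N lam y b c) \<in> borel_measurable (gauss_vecs N)"
  unfolding Mmat_def
  by (intro borel_measurable_diff borel_measurable_divide borel_measurable_const borel_measurable_sum borel_measurable_times measurable_Lmat)
     (use assms in auto)

lemma measurable_frob_Mmat [measurable]: "(\<lambda>y. frob N (Mmat N lam y)) \<in> borel_measurable (gauss_vecs N)"
  unfolding frob_def by (intro borel_measurable_sum borel_measurable_power measurable_Mmat) auto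

lemma measurable_trace_Mmat [measurable]: "(\<lambda>y. trace N (Mmat N lam y)) \<in> borel_measurable (gauss_vecs N)"
  unfolding trace_def by (intro borel_measurable_sum measurable_Mmat) auto

lemma measurable_bad_event:
  assumes G[measurable]: "G \<in> M \<rightarrow>\<^sub>M gauss_vecs N"
    and w: "\<And>i. i < N \<Longrightarrow> (\<lambda>y. w y i) \<in> borel_measurable M"
  shows "(\<lambda>y. if bad_event N (Mmat N lam (G y)) \<eta> \<epsilon> (w y) then 1 else 0 :: ennreal) \<in> borel_measurable M"
proof -
  have [measurable]: "(\<lambda>y. ip N (w y) (w y)) \<in> borel_measurable M"
    unfolding ip_def by (intro borel_measurable_sum borel_measurable_times w) auto
  have [measurable]: "(\<lambda>y. qform N (Mmat N lam (G y)) (w y)) \<in> borel_measurable M"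
    unfolding qform_def
    by (intro borel_measurable_sum borel_measurable_times w measurable_compose[OF G measurable_Mmat]) auto
  show ?thesis unfolding bad_event_def by measurable
qed

text \<open>A fixed column of the Gram--Schmidt matrix is a uniformly distributed unit vector independent of
  \<^term>\<open>Mmat N lam\<close>; it is realised below as a normalised independent Gaussian vector.\<close>

proposition column_tail:
  assumes i: "i < N" and \<eta>: "0 < \<eta>" and \<epsilon>: "0 < \<epsilon>"
  shows "(\<integral>\<^sup>+y. (if bad_event N (Mmat N lam y) \<eta> \<epsilon> (\<lambda>b. gs N (rows y) b i) then 1 else 0) \<partial>gauss_vecs N)
    \<le> 2 * exp (1 / 4 - \<epsilon> / (16 * \<eta>)) + (exp (1 / 2) / sqrt 3) ^ N" (is "?L \<le> ?R")
proof -
  interpret G: prob_space "gauss {..<N}" by (rule prob_space_gauss)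
  interpret Y: prob_space "gauss_vecs N" by (rule prob_space_gauss_vecs)
  interpret pair_sigma_finite "gauss {..<N}" "gauss_vecs N" ..
  define Q where "Q = (\<lambda>y. gs N (rows y))"
  define K :: "(nat \<times> nat \<Rightarrow> real) \<Rightarrow> (nat \<Rightarrow> real) \<Rightarrow> ennreal" where
    "K = (\<lambda>y w. if bad_event N (Mmat N lam y) \<eta> \<epsilon> w then 1 else 0)"
  have mQ: "(\<lambda>y. Q y a k) \<in> borel_measurable (gauss_vecs N)" if "a < N" "k < N" for a k
    using measurable_gs[OF that(2,1)] unfolding Q_def by measurable
  have mL: "(\<lambda>y. K y (\<lambda>b. Q y b i)) \<in> borel_measurable (PiM (sq_index N) (\<lambda>_. borel))"
  proof -
    have "(\<lambda>y. K y (\<lambda>b. Q y b i)) \<in> borel_measurable (gauss_vecs N)"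
      unfolding K_def by (rule measurable_bad_event[where G = "\<lambda>y. y"]) (use mQ i in auto)
    then show ?thesis by measurable
  qed
  \<comment> \<open>Choose W with row i equal to h. Rotating the rows by W leaves M unchanged and
    turns column i of the Gram--Schmidt matrix into Q h, so the probability is the same for every
    unit vector h.\<close>
  have unit: "(\<integral>\<^sup>+y. K y (mv N (Q y) h) \<partial>gauss_vecs N) = ?L" if h: "ip N h h = 1" for h
  proof -
    obtain W where W: "orthogonal_on {..<N} W" "\<forall>k<N. W i k = h k" using householder[OF h i] by auto
    have "K (kron N W idm y) (\<lambda>b. Q (kron N W idm y) b i) = K y (mv N (Q y) h)" for y
    proof -
      have "Q (kron N W idm y) b i = mv N (Q y) h b" if "b < N" for b
        unfolding Q_def gs_rows_kron[OF W(1) that i] using W(2) by (simp add: mv_def mult.commute)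
      then show ?thesis
        unfolding K_def using bad_event_cong[of N "Mmat N lam (kron N W idm y)" "Mmat N lam y"
          "\<lambda>b. Q (kron N W idm y) b i" "mv N (Q y) h" \<eta> \<epsilon>] Mmat_kron[OF W(1)] by simp
    qed
    then have "(\<integral>\<^sup>+y. K y (mv N (Q y) h) \<partial>gauss_vecs N)
        = (\<integral>\<^sup>+y. (\<lambda>y. K y (\<lambda>b. Q y b i)) (kron N W idm y) \<partial>gauss_vecs N)" by simp
    also have "\<dots> = (\<integral>\<^sup>+y. K y (\<lambda>b. Q y b i) \<partial>gauss_vecs N)"
      by (rule nn_integral_kron[OF W(1) orthogonal_idm mL])
    finally show ?thesis by (simp add: K_def Q_def)
  qed
  have nz: "(\<integral>\<^sup>+y. K y (mv N (Q y) g) \<partial>gauss_vecs N) = ?L" if g: "ip N g g \<noteq> 0" for g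
  proof -
    define c where "c = sqrt (ip N g g)"
    have c: "c > 0" "ip N g g = c * c" using g ip_nonneg[of N g] by (auto simp: c_def)
    define h where "h = (\<lambda>i. inverse c * g i)"
    have "ip N h h = 1" unfolding h_def ip_simps c(2) using c(1) by (simp add: field_simps)
    moreover have "K y (mv N (Q y) h) = K y (mv N (Q y) g)" for y
    proof -
      have "mv N (Q y) h = (\<lambda>i. inverse c * mv N (Q y) g i)"
        by (rule ext, rule mv_scale) (simp add: h_def)
      then show ?thesis using c(1) by (simp add: K_def bad_event_scale)
    qed
    ultimately show ?thesis using unit[of h] by simp
  qed
  have AEnz: "AE g in gauss {..<N}. ip N g g \<noteq> 0"
  proof (rule polyfun_AE_nonzero)
    show "(\<lambda>g. ip N g g) \<in> polyfun"
      unfolding ip_def by (intro polyfun_sum polyfun.intros)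
    show "(\<lambda>i\<in>{..<N}. 1) \<in> space (gauss {..<N})" by (simp add: space_gauss)
    show "ip N (\<lambda>i\<in>{..<N}. 1) (\<lambda>i\<in>{..<N}. 1) \<noteq> 0" using i by (simp add: ip_def)
  qed simp
  have mj: "(\<lambda>(g, y). K y (mv N (Q y) g)) \<in> borel_measurable (gauss {..<N} \<Otimes>\<^sub>M gauss_vecs N)"
    unfolding K_def case_prod_beta'
  proof (rule measurable_bad_event)
    fix b assume b: "b < N"
    have 1: "(\<lambda>x. Q (snd x) b k) \<in> borel_measurable (gauss {..<N} \<Otimes>\<^sub>M gauss_vecs N)" if "k < N" for k
      using mQ[OF b that] by measurable
    have 2: "(\<lambda>x. fst x k) \<in> borel_measurable (gauss {..<N} \<Otimes>\<^sub>M gauss_vecs N)" if "k < N" for k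
    proof -
      have "(\<lambda>g. g k) \<in> borel_measurable (PiM {..<N} (\<lambda>_. borel :: real measure))" using that by simp
      then have "(\<lambda>g. g k) \<in> borel_measurable (gauss {..<N})" by measurable
      then show ?thesis by measurable
    qed
    show "(\<lambda>x. mv N (Q (snd x)) (fst x) b) \<in> borel_measurable (gauss {..<N} \<Otimes>\<^sub>M gauss_vecs N)"
      unfolding mv_def by (intro borel_measurable_sum borel_measurable_times 1 2) auto
  qed auto
  \<comment> \<open>The constant is averaged over an auxiliary Gaussian vector g. After exchanging
    the integrals y is fixed, M is a fixed matrix, and Q g is again standard Gaussian because Q is
    orthogonal, so the tail of a quadratic form applies.\<close>
  have "?L = (\<integral>\<^sup>+g. ?L \<partial>gauss {..<N})" by (simp add: G.emeasure_space_1)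
  also have "\<dots> = (\<integral>\<^sup>+g. (\<integral>\<^sup>+y. K y (mv N (Q y) g) \<partial>gauss_vecs N) \<partial>gauss {..<N})"
    by (rule nn_integral_cong_AE) (use AEnz in eventually_elim, simp add: nz)
  also have "\<dots> = (\<integral>\<^sup>+y. (\<integral>\<^sup>+g. K y (mv N (Q y) g) \<partial>gauss {..<N}) \<partial>gauss_vecs N)"
    by (rule Fubini'[OF mj, symmetric])
  also have "\<dots> \<le> (\<integral>\<^sup>+y. ?R \<partial>gauss_vecs N)"
  proof (rule nn_integral_mono_AE)
    show "AE y in gauss_vecs N. (\<integral>\<^sup>+g. K y (mv N (Q y) g) \<partial>gauss {..<N}) \<le> ?R"
      using AE_gs_nondeg[of N]
    proof eventually_elim
      case (elim y)
      let ?M = "Mmat N lam y"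
      show ?case
      proof (cases "frob N ?M \<le> \<eta>\<^sup>2 \<and> \<bar>trace N ?M\<bar> \<le> \<epsilon> / 4")
        case True
        define F :: "(nat \<Rightarrow> real) \<Rightarrow> ennreal" where
          "F = (\<lambda>x. if \<epsilon> * ip N x x < real N * \<bar>qform N ?M x\<bar> then 1 else 0)"
        have [measurable]: "F \<in> borel_measurable (gauss {..<N})" unfolding F_def by measurable
        have "K y (mv N (Q y) g) = F (lin {..<N} (Q y) g)" for g
        proof -
          have "K y (mv N (Q y) g) = K y (lin {..<N} (Q y) g)"
            unfolding K_def using bad_event_cong[of N ?M ?M "mv N (Q y) g" "lin {..<N} (Q y) g" \<eta> \<epsilon>]
            by (simp add: lin_eq_mv)
          then show ?thesis using True by (simp add: K_def F_def bad_event_def)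
        qed
        then have "(\<integral>\<^sup>+g. K y (mv N (Q y) g) \<partial>gauss {..<N}) = (\<integral>\<^sup>+g. F (lin {..<N} (Q y) g) \<partial>gauss {..<N})"
          by simp
        also have "\<dots> = (\<integral>\<^sup>+g. F g \<partial>gauss {..<N})"
          by (rule nn_integral_gauss_orthogonal) (use orthogonal_gs[OF elim] in \<open>auto simp: Q_def\<close>)
        also have "\<dots> \<le> ?R"
          unfolding F_def by (rule gauss_qform_ratio_tail[OF Mmat_sym \<eta> _ \<epsilon>]) (use True in auto)
        finally show ?thesis .
      next
        case False
        then have "K y w = 0" for w by (auto simp: K_def bad_event_def)
        then show ?thesis by simp
      qed
    qed
  qed
  also have "\<dots> = ?R" by (simp add: Y.emeasure_space_1)
  finally show ?thesis .
qed

section \<open>Second moments of Gaussian rows\<close>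


lemma has_bochner_integral_stdN:
  assumes "has_bochner_integral lborel (\<lambda>x. std_normal_density x * g x) v" "g \<in> borel_measurable borel"
  shows "has_bochner_integral stdN g v"
  using assms by (simp add: has_bochner_integral_density)

lemma stdN_const: "has_bochner_integral stdN (\<lambda>x. c) (c :: real)"
  using prob_space.prob_space[OF prob_space_normal_density[of 1 0]] by (simp add: has_bochner_integral_iff)

lemma stdN_moments:
  shows stdN_moment_1: "has_bochner_integral stdN (\<lambda>x. x) 0"
    and stdN_moment_2: "has_bochner_integral stdN (\<lambda>x. x\<^sup>2) 1"
    and stdN_moment_4: "has_bochner_integral stdN (\<lambda>x. x ^ 4) 3"
proof -
  show "has_bochner_integral stdN (\<lambda>x. x) 0"
    using std_normal_moment_odd[of 0] by (intro has_bochner_integral_stdN) auto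
  show "has_bochner_integral stdN (\<lambda>x. x\<^sup>2) 1"
    using std_normal_moment_even[of 1] by (intro has_bochner_integral_stdN) auto
  show "has_bochner_integral stdN (\<lambda>x. x ^ 4) 3"
    using std_normal_moment_even[of 2] by (intro has_bochner_integral_stdN) (auto simp: fact_numeral)
qed

text \<open>The shift s absorbs the coordinates held fixed while one more independent coordinate is
  integrated out.\<close>

lemma nn_integral_shifted_square:
  assumes f: "has_bochner_integral stdN f 0" and f2: "has_bochner_integral stdN (\<lambda>x. (f x)\<^sup>2) v"
  shows "(\<integral>\<^sup>+x. ennreal ((s + f x)\<^sup>2) \<partial>stdN) = ennreal (s\<^sup>2 + v)"
proof -
  have "has_bochner_integral stdN (\<lambda>x. s\<^sup>2 + 2 * s * f x + (f x)\<^sup>2) (s\<^sup>2 + 2 * s * 0 + v)"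
    by (intro has_bochner_integral_add has_bochner_integral_mult_right stdN_const f f2)
  then have "has_bochner_integral stdN (\<lambda>x. (s + f x)\<^sup>2) (s\<^sup>2 + v)"
    by (simp add: power2_sum add_ac)
  then show ?thesis
    by (subst nn_integral_eq_integral) (auto simp: has_bochner_integral_iff)
qed

lemma has_bochner_integral_square_nonneg:
  "has_bochner_integral M (\<lambda>x. (f x)\<^sup>2) (v::real) \<Longrightarrow> 0 \<le> v"
  by (auto simp: has_bochner_integral_iff intro!: Bochner_Integration.integral_nonneg)

lemma nn_integral_gauss_sum_square:
  assumes "finite I" "\<And>i. i \<in> I \<Longrightarrow> has_bochner_integral stdN (f i) 0"
    and "\<And>i. i \<in> I \<Longrightarrow> has_bochner_integral stdN (\<lambda>x. (f i x)\<^sup>2) (v i)"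
  shows "(\<integral>\<^sup>+x. ennreal ((s + (\<Sum>i\<in>I. f i (x i)))\<^sup>2) \<partial>gauss I) = ennreal (s\<^sup>2 + (\<Sum>i\<in>I. v i))"
  using assms
proof (induction I rule: finite_induct)
  case empty
  interpret prob_space "gauss ({} :: 'a set)" by (rule prob_space_gauss)
  show ?case by (simp add: emeasure_space_1)
next
  case (insert i J)
  have fm: "f j \<in> borel_measurable borel" if "j \<in> insert i J" for j
    using insert.prems(1)[OF that] by (auto simp: has_bochner_integral_iff dest: borel_measurable_integrable)
  have m: "(\<lambda>x. ennreal ((s + (\<Sum>j\<in>insert i J. f j (x j)))\<^sup>2)) \<in> borel_measurable (gauss (insert i J))"
  proof -
    have "(\<lambda>x. f j (x j)) \<in> borel_measurable (PiM (insert i J) (\<lambda>_. borel :: real measure))" if "j \<in> insert i J" for j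
      by (rule measurable_compose[where f = "\<lambda>x. x j" and N = borel, OF _ fm]) (use that in auto)
    then have "(\<lambda>x. \<Sum>j\<in>insert i J. f j (x j)) \<in> borel_measurable (PiM (insert i J) (\<lambda>_. borel :: real measure))"
      by (rule borel_measurable_sum)
    then show ?thesis by measurable
  qed
  have v: "0 \<le> v j" if "j \<in> insert i J" for j
    using has_bochner_integral_square_nonneg[OF insert.prems(2)[OF that]] .
  interpret J: prob_space "gauss J" by (rule prob_space_gauss)
  have mJ: "(\<lambda>x. \<Sum>j\<in>J. f j (x j)) \<in> borel_measurable (gauss J)"
  proof -
    have "(\<lambda>x. f j (x j)) \<in> borel_measurable (PiM J (\<lambda>_. borel :: real measure))" if "j \<in> J" for j
      by (rule measurable_compose[where f = "\<lambda>x. x j" and N = borel, OF _ fm]) (use that in auto)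
    then have "(\<lambda>x. \<Sum>j\<in>J. f j (x j)) \<in> borel_measurable (PiM J (\<lambda>_. borel :: real measure))"
      by (rule borel_measurable_sum)
    then show ?thesis by measurable
  qed
  have "(\<integral>\<^sup>+x. ennreal ((s + (\<Sum>j\<in>insert i J. f j (x j)))\<^sup>2) \<partial>gauss (insert i J))
     = (\<integral>\<^sup>+x. (\<integral>\<^sup>+t. ennreal ((s + (\<Sum>j\<in>insert i J. f j ((x(i := t)) j)))\<^sup>2) \<partial>stdN) \<partial>gauss J)"
    by (rule nn_integral_gauss_insert[OF insert.hyps m])
  also have "\<dots> = (\<integral>\<^sup>+x. ennreal ((s + (\<Sum>j\<in>J. f j (x j)))\<^sup>2 + v i) \<partial>gauss J)"
  proof (rule nn_integral_cong)
    fix x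
    have "s + (\<Sum>j\<in>insert i J. f j ((x(i := t)) j)) = (s + (\<Sum>j\<in>J. f j (x j))) + f i t" for t
    proof -
      have "(\<Sum>j\<in>J. f j ((x(i := t)) j)) = (\<Sum>j\<in>J. f j (x j))"
        using insert.hyps by (intro sum.cong) auto
      then show ?thesis using insert.hyps by simp
    qed
    note eq = this
    show "(\<integral>\<^sup>+t. ennreal ((s + (\<Sum>j\<in>insert i J. f j ((x(i := t)) j)))\<^sup>2) \<partial>stdN)
        = ennreal ((s + (\<Sum>j\<in>J. f j (x j)))\<^sup>2 + v i)"
      unfolding eq by (rule nn_integral_shifted_square) (use insert.prems in auto)
  qed
  also have "\<dots> = (\<integral>\<^sup>+x. ennreal ((s + (\<Sum>j\<in>J. f j (x j)))\<^sup>2) + ennreal (v i) \<partial>gauss J)"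
    using v by (simp add: ennreal_plus)
  also have "\<dots> = (\<integral>\<^sup>+x. ennreal ((s + (\<Sum>j\<in>J. f j (x j)))\<^sup>2) \<partial>gauss J) + ennreal (v i)"
    by (subst nn_integral_add) (use mJ in \<open>auto simp: J.emeasure_space_1\<close>)
  also have "\<dots> = ennreal (s\<^sup>2 + (\<Sum>j\<in>J. v j)) + ennreal (v i)"
    by (subst insert.IH) (use insert.prems in auto)
  also have "\<dots> = ennreal (s\<^sup>2 + (\<Sum>j\<in>insert i J. v j))"
    using v insert.hyps by (simp add: ennreal_plus[symmetric] sum_nonneg add_ac del: ennreal_plus)
  finally show ?case .
qed

text \<open>A row norm is a sum of N independent squares, and one square has variance 3 - 2 + 1 = 2.
  Terms outside row a are set to 0 so that the general sum over the whole array applies.\<close>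

lemma row_norm_variance:
  assumes a: "a < N"
  shows "(\<integral>\<^sup>+y. ennreal ((ip N (rows y a) (rows y a) - real N)\<^sup>2) \<partial>gauss_vecs N) = ennreal (2 * real N)"
proof -
  define f :: "nat \<times> nat \<Rightarrow> real \<Rightarrow> real" where "f = (\<lambda>p x. if snd p = a then x\<^sup>2 - 1 else 0)"
  define v :: "nat \<times> nat \<Rightarrow> real" where "v = (\<lambda>p. if snd p = a then 2 else 0)"
  have "has_bochner_integral stdN (\<lambda>x. x\<^sup>2 - 1) (1 - 1 :: real)"
    by (intro has_bochner_integral_diff stdN_moments stdN_const)
  then have f1: "has_bochner_integral stdN (f p) 0" for p
    by (cases "snd p = a") (auto simp: f_def intro: has_bochner_integral_zero)
  have "has_bochner_integral stdN (\<lambda>x. x ^ 4 - 2 * x\<^sup>2 + 1) (3 - 2 * 1 + 1 :: real)"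
    by (intro has_bochner_integral_add has_bochner_integral_diff has_bochner_integral_mult_right stdN_moments stdN_const)
  then have "has_bochner_integral stdN (\<lambda>x. (x\<^sup>2 - 1)\<^sup>2) (2 :: real)"
    by (simp add: power2_diff power_mult[symmetric] diff_add_eq)
  then have f2: "has_bochner_integral stdN (\<lambda>x. (f p x)\<^sup>2) (v p)" for p
    by (cases "snd p = a") (auto simp: f_def v_def intro: has_bochner_integral_zero)
  have s: "(\<Sum>p\<in>sq_index N. g p * (if snd p = a then 1 else 0)) = (\<Sum>i<N. g (i, a))" for g :: "nat \<times> nat \<Rightarrow> real"
  proof -
    have "(\<Sum>p\<in>sq_index N. g p * (if snd p = a then 1 else 0)) = (\<Sum>i<N. \<Sum>b<N. if b = a then g (i, b) else 0)"
      unfolding sum.cartesian_product by (rule sum.cong) auto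
    then show ?thesis using a by simp
  qed
  have "(\<Sum>p\<in>sq_index N. f p (y p)) = (\<Sum>i<N. (y (i, a))\<^sup>2 - 1)" for y
    using s[of "\<lambda>p. (y p)\<^sup>2 - 1"] by (simp add: f_def if_distrib cong: if_cong)
  then have e: "(\<Sum>p\<in>sq_index N. f p (y p)) = ip N (rows y a) (rows y a) - real N" for y
    by (simp add: ip_def rows_def power2_eq_square sum_subtractf)
  have "(\<Sum>p\<in>sq_index N. v p) = 2 * real N"
    using s[of "\<lambda>p. 2"] by (simp add: v_def if_distrib cong: if_cong)
  then show ?thesis
    using nn_integral_gauss_sum_square[of "sq_index N" f v 0] f1 f2 by (simp add: e gauss_vecs_eq)
qed

text \<open>Condition on all rows except a: the coefficients become constants, while row a remains
  standard Gaussian. The assumption \<open>indep\<close> expresses that the coefficients do not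
  depend on row a.\<close>

lemma row_linear_second_moment:
  assumes a: "a < N"
    and m: "\<And>i. i < N \<Longrightarrow> c i \<in> borel_measurable (PiM (sq_index N) (\<lambda>_. borel))"
    and indep: "\<And>i y y'. i < N \<Longrightarrow> (\<And>j b. j < N \<Longrightarrow> b < N \<Longrightarrow> b \<noteq> a \<Longrightarrow> y (j, b) = y' (j, b)) \<Longrightarrow> c i y = c i y'"
  shows "(\<integral>\<^sup>+y. ennreal ((\<Sum>i<N. c i y * y (i, a))\<^sup>2) \<partial>gauss_vecs N)
    = (\<integral>\<^sup>+y. ennreal (\<Sum>i<N. (c i y)\<^sup>2) \<partial>gauss_vecs N)"
proof -
  define R where "R = {..<N} \<times> {a}"
  define J where "J = sq_index N - R"
  have JR: "J \<inter> R = {}" "finite J" "finite R" and S: "sq_index N = J \<union> R"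
    using a by (auto simp: J_def R_def)
  have fold: "(\<integral>\<^sup>+y. F y \<partial>gauss_vecs N) = (\<integral>\<^sup>+x. (\<integral>\<^sup>+z. F (merge J R (x, z)) \<partial>gauss R) \<partial>gauss J)"
    if "F \<in> borel_measurable (PiM (sq_index N) (\<lambda>_. borel))" for F :: "(nat \<times> nat \<Rightarrow> real) \<Rightarrow> ennreal"
  proof -
    have "F \<in> borel_measurable (gauss (J \<union> R))" using that unfolding S by measurable
    then show ?thesis unfolding gauss_vecs_eq S unfolding gauss_def
      by (intro std.product_nn_integral_fold[OF JR])
  qed
  have mcomp: "(\<lambda>y. y (i, a)) \<in> borel_measurable (PiM (sq_index N) (\<lambda>_. borel :: real measure))" if "i < N" for i
    by (rule measurable_component_singleton) (use that a in auto)
  have m1: "(\<lambda>y. ennreal ((\<Sum>i<N. c i y * y (i, a))\<^sup>2)) \<in> borel_measurable (PiM (sq_index N) (\<lambda>_. borel))"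
  proof -
    have "(\<lambda>y. \<Sum>i<N. c i y * y (i, a)) \<in> borel_measurable (PiM (sq_index N) (\<lambda>_. borel))"
      by (intro borel_measurable_sum borel_measurable_times m mcomp) auto
    then show ?thesis by measurable
  qed
  have m2: "(\<lambda>y. ennreal (\<Sum>i<N. (c i y)\<^sup>2)) \<in> borel_measurable (PiM (sq_index N) (\<lambda>_. borel))"
  proof -
    have "(\<lambda>y. \<Sum>i<N. (c i y)\<^sup>2) \<in> borel_measurable (PiM (sq_index N) (\<lambda>_. borel))"
      by (intro borel_measurable_sum borel_measurable_power m) auto
    then show ?thesis by measurable
  qed
  show ?thesis unfolding fold[OF m1] fold[OF m2]
  proof (rule nn_integral_cong)
    fix x assume "x \<in> space (gauss J)"
    \<comment> \<open>The coefficients with the entries of row a filled in by 0; by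
      \<open>indep\<close> any other filling gives the same values.\<close>
    define d where "d = (\<lambda>i. c i (merge J R (x, \<lambda>_. 0)))"
    have cd: "c i (merge J R (x, z)) = d i" if "i < N" for i z
      unfolding d_def by (rule indep[OF that]) (auto simp: merge_def J_def R_def)
    define f where "f = (\<lambda>(p :: nat \<times> nat) t. d (fst p) * t)"
    have "has_bochner_integral stdN (\<lambda>x. d (fst p) * x) (d (fst p) * 0)" for p :: "nat \<times> nat"
      by (intro has_bochner_integral_mult_right stdN_moments)
    then have f1: "has_bochner_integral stdN (f p) 0" for p by (simp add: f_def)
    have "has_bochner_integral stdN (\<lambda>x. (d (fst p))\<^sup>2 * x\<^sup>2) ((d (fst p))\<^sup>2 * 1)" for p :: "nat \<times> nat"
      by (intro has_bochner_integral_mult_right stdN_moments)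
    then have f2: "has_bochner_integral stdN (\<lambda>x. (f p x)\<^sup>2) ((d (fst p))\<^sup>2)" for p
      by (simp add: f_def power_mult_distrib)
    have sR: "(\<Sum>p\<in>R. h p) = (\<Sum>i<N. h (i, a))" for h :: "nat \<times> nat \<Rightarrow> real"
      unfolding R_def by (rule sum.reindex_bij_witness[of _ "\<lambda>i. (i, a)" fst]) auto
    interpret PR: prob_space "gauss R" by (rule prob_space_gauss)
    have "(\<integral>\<^sup>+z. ennreal ((\<Sum>i<N. c i (merge J R (x, z)) * merge J R (x, z) (i, a))\<^sup>2) \<partial>gauss R)
        = (\<integral>\<^sup>+z. ennreal ((0 + (\<Sum>p\<in>R. f p (z p)))\<^sup>2) \<partial>gauss R)"
    proof (rule nn_integral_cong)
      fix z
      have "(\<Sum>i<N. c i (merge J R (x, z)) * merge J R (x, z) (i, a)) = (\<Sum>i<N. d i * z (i, a))"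
      proof (rule sum.cong[OF refl])
        fix i assume "i \<in> {..<N}"
        then have "merge J R (x, z) (i, a) = z (i, a)" by (simp add: merge_def J_def R_def)
        then show "c i (merge J R (x, z)) * merge J R (x, z) (i, a) = d i * z (i, a)"
          using \<open>i \<in> {..<N}\<close> by (simp add: cd)
      qed
      then show "ennreal ((\<Sum>i<N. c i (merge J R (x, z)) * merge J R (x, z) (i, a))\<^sup>2)
          = ennreal ((0 + (\<Sum>p\<in>R. f p (z p)))\<^sup>2)" by (simp add: sR f_def)
    qed
    also have "\<dots> = ennreal (0\<^sup>2 + (\<Sum>p\<in>R. (d (fst p))\<^sup>2))"
      by (rule nn_integral_gauss_sum_square[OF JR(3) f1 f2])
    also have "\<dots> = (\<integral>\<^sup>+z. ennreal (\<Sum>i<N. (c i (merge J R (x, z)))\<^sup>2) \<partial>gauss R)"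
      by (simp add: sR cd PR.emeasure_space_1)
    finally show "(\<integral>\<^sup>+z. ennreal ((\<Sum>i<N. c i (merge J R (x, z)) * merge J R (x, z) (i, a))\<^sup>2) \<partial>gauss R)
        = (\<integral>\<^sup>+z. ennreal (\<Sum>i<N. (c i (merge J R (x, z)))\<^sup>2) \<partial>gauss R)" .
  qed
qed

lemma row_norm_mean:
  assumes "a < N"
  shows "(\<integral>\<^sup>+y. ennreal (ip N (rows y a) (rows y a)) \<partial>gauss_vecs N) \<le> ennreal (real N)"
proof -
  have "(\<integral>\<^sup>+y. ennreal (\<Sum>i<N. (y (i, a))\<^sup>2) \<partial>gauss_vecs N) = (\<Sum>i<N. \<integral>\<^sup>+y. ennreal ((y (i, a))\<^sup>2) \<partial>gauss_vecs N)"
  proof -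
    have m: "(\<lambda>y. ennreal ((y (i, a))\<^sup>2)) \<in> borel_measurable (gauss_vecs N)" if "i < N" for i
    proof -
      have "(\<lambda>y. y (i, a)) \<in> borel_measurable (PiM (sq_index N) (\<lambda>_. borel :: real measure))"
        by (rule measurable_component_singleton) (use that assms in auto)
      then show ?thesis by measurable
    qed
    show ?thesis
      by (subst nn_integral_sum[symmetric]) (use m in \<open>auto simp: sum_ennreal\<close>)
  qed
  also have "\<dots> = (\<Sum>i<N. 1)"
  proof (rule sum.cong[OF refl])
    fix i assume i: "i \<in> {..<N}"
    define f :: "nat \<times> nat \<Rightarrow> real \<Rightarrow> real" where "f = (\<lambda>p x. if p = (i, a) then x else 0)"
    define v :: "nat \<times> nat \<Rightarrow> real" where "v = (\<lambda>p. if p = (i, a) then 1 else 0)"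
    have f1: "has_bochner_integral stdN (f p) 0" for p
      using stdN_moment_1 by (cases "p = (i, a)") (auto simp: f_def intro: has_bochner_integral_zero)
    have f2: "has_bochner_integral stdN (\<lambda>x. (f p x)\<^sup>2) (v p)" for p
      using stdN_moment_2 by (cases "p = (i, a)") (auto simp: f_def v_def intro: has_bochner_integral_zero)
    have "(\<Sum>p\<in>sq_index N. f p (y p)) = y (i, a)" for y
    proof -
      have "(\<Sum>p\<in>sq_index N. f p (y p)) = (\<Sum>p\<in>sq_index N. if p = (i, a) then y p else 0)"
        unfolding f_def by (rule sum.cong) auto
      then show ?thesis using i assms by simp
    qed
    moreover have "(\<Sum>p\<in>sq_index N. v p) = 1" using i assms by (simp add: v_def)
    ultimately show "(\<integral>\<^sup>+y. ennreal ((y (i, a))\<^sup>2) \<partial>gauss_vecs N) = 1"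
      using nn_integral_gauss_sum_square[of "sq_index N" f v 0] f1 f2 by (simp add: gauss_vecs_eq)
  qed
  also have "\<dots> = ennreal (real N)" by (simp add: ennreal_of_nat_eq_real_of_nat)
  finally show ?thesis by (simp add: ip_def rows_def power2_eq_square)
qed

lemma measurable_rows: "a < N \<Longrightarrow> i < N \<Longrightarrow> (\<lambda>y. rows y a i) \<in> borel_measurable (PiM (sq_index N) (\<lambda>_. borel))"
  unfolding rows_def by (rule measurable_component_singleton) auto

lemma row_inner_second_moment:
  assumes "a < N" "b < N" "a \<noteq> b"
  shows "(\<integral>\<^sup>+y. ennreal ((ip N (rows y a) (rows y b))\<^sup>2) \<partial>gauss_vecs N) \<le> ennreal (real N)"
proof -
  have "(\<integral>\<^sup>+y. ennreal ((\<Sum>i<N. rows y b i * y (i, a))\<^sup>2) \<partial>gauss_vecs N)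
      = (\<integral>\<^sup>+y. ennreal (\<Sum>i<N. (rows y b i)\<^sup>2) \<partial>gauss_vecs N)"
    by (rule row_linear_second_moment[OF assms(1)]) (use assms in \<open>auto simp: measurable_rows, auto simp: rows_def\<close>)
  also have "\<dots> \<le> ennreal (real N)"
    using row_norm_mean[OF assms(2)] by (simp add: ip_def power2_eq_square)
  finally show ?thesis by (simp add: ip_def rows_def mult.commute)
qed

text \<open>For b < a the unit vector b is a function of rows 0, ..., b, so it is independent of row
  a, and its squared entries add up to 1.\<close>

lemma Lmat_second_moment:
  assumes "b < a" "a < N"
  shows "(\<integral>\<^sup>+y. ennreal ((Lmat N y a b)\<^sup>2) \<partial>gauss_vecs N) \<le> 1"
proof -
  interpret prob_space "gauss_vecs N" by (rule prob_space_gauss_vecs)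
  have "(\<integral>\<^sup>+y. ennreal ((\<Sum>i<N. gs N (rows y) b i * y (i, a))\<^sup>2) \<partial>gauss_vecs N)
      = (\<integral>\<^sup>+y. ennreal (\<Sum>i<N. (gs N (rows y) b i)\<^sup>2) \<partial>gauss_vecs N)"
  proof (rule row_linear_second_moment[OF assms(2)])
    fix i assume "i < N"
    then show "(\<lambda>y. gs N (rows y) b i) \<in> borel_measurable (PiM (sq_index N) (\<lambda>_. borel))"
      using assms by (intro measurable_gs) auto
    fix y y' :: "nat \<times> nat \<Rightarrow> real"
    assume "\<And>j c. j < N \<Longrightarrow> c < N \<Longrightarrow> c \<noteq> a \<Longrightarrow> y (j, c) = y' (j, c)"
    then show "gs N (rows y) b i = gs N (rows y') b i"
      using assms \<open>i < N\<close> by (intro gs_cong) (auto simp: rows_def)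
  qed
  also have "\<dots> = (\<integral>\<^sup>+y. 1 \<partial>gauss_vecs N)"
    by (rule nn_integral_cong_AE)
       (use AE_gs_nondeg[of N] in eventually_elim, use assms ip_gs_self in \<open>simp add: ip_def power2_eq_square\<close>)
  also have "\<dots> = 1" by (simp add: emeasure_space_1)
  finally show ?thesis by (simp add: Lmat_def ip_def rows_def mult.commute)
qed

section \<open>Trace and Frobenius norm of the error matrix\<close>


lemma sum_rotate3:
  fixes F :: "nat \<Rightarrow> nat \<Rightarrow> nat \<Rightarrow> real"
  shows "(\<Sum>b<n. \<Sum>c<m. \<Sum>a<l. F a b c) = (\<Sum>a<l. \<Sum>b<n. \<Sum>c<m. F a b c)"
proof -
  have "(\<Sum>b<n. \<Sum>c<m. \<Sum>a<l. F a b c) = (\<Sum>b<n. \<Sum>a<l. \<Sum>c<m. F a b c)"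
    by (rule sum.cong[OF refl], rule sum.swap)
  also have "\<dots> = (\<Sum>a<l. \<Sum>b<n. \<Sum>c<m. F a b c)" by (rule sum.swap)
  finally show ?thesis .
qed

text \<open>The Gram matrix identity \<open>Y Y^T = L L^T\<close>.\<close>

lemma ip_rows_Lmat:
  assumes "gs_nondeg N (rows y)"
  shows "ip N (rows y a) (rows y a') = (\<Sum>b<N. Lmat N y a b * Lmat N y a' b)"
  using parseval[OF orthogonal_gs[OF assms], of "rows y a" "rows y a'"]
  by (simp add: Lmat_def ip_commute)

lemma trace_Mmat:
  assumes nd: "gs_nondeg N (rows y)"
  shows "trace N (Mmat N lam y) = (\<Sum>a<N. lam a * (1 - ip N (rows y a) (rows y a) / real N))"
proof -
  have "trace N (Mmat N lam y) = (\<Sum>b<N. lam b) - (\<Sum>b<N. \<Sum>a<N. lam a * (Lmat N y a b * Lmat N y a b)) / real N"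
    by (simp add: trace_def Mmat_def sum_subtractf sum_divide_distrib mult.assoc)
  also have "(\<Sum>b<N. \<Sum>a<N. lam a * (Lmat N y a b * Lmat N y a b)) = (\<Sum>a<N. lam a * ip N (rows y a) (rows y a))"
    by (subst sum.swap) (simp add: ip_rows_Lmat[OF nd] sum_distrib_left)
  finally show ?thesis
    by (simp add: right_diff_distrib sum_subtractf sum_divide_distrib)
qed

text \<open>Expansion of the square of Lam - S / N with S = L^T Lam L. The cross term involves only
  the diagonal of S. The last term is the trace of (Lam G)^2 for the Gram matrix G = L L^T, which
  turns entries of L into inner products of rows.\<close>

lemma frob_Mmat:
  assumes nd: "gs_nondeg N (rows y)"
  shows "frob N (Mmat N lam y) = (\<Sum>a<N. (lam a)\<^sup>2)
    - 2 / real N * (\<Sum>a<N. lam a * (\<Sum>b<N. lam b * (Lmat N y a b)\<^sup>2))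
    + 1 / (real N)\<^sup>2 * (\<Sum>a<N. \<Sum>a'<N. lam a * lam a' * (ip N (rows y a) (rows y a'))\<^sup>2)"
proof -
  let ?L = "Lmat N y"
  define S where "S = (\<lambda>b c. \<Sum>a<N. lam a * ?L a b * ?L a c)"
  have M: "Mmat N lam y b c = lam b * of_bool (b = c) - S b c / real N" for b c
    by (simp add: Mmat_def S_def)
  have "frob N (Mmat N lam y) = (\<Sum>b<N. \<Sum>c<N. (if c = b then (lam b)\<^sup>2 else 0)
      - 2 / real N * (if c = b then lam b * S b b else 0) + 1 / (real N)\<^sup>2 * (S b c)\<^sup>2)"
    unfolding frob_def M
    by (intro sum.cong refl) (auto simp: power2_diff power_divide of_bool_def)
  also have "\<dots> = (\<Sum>b<N. (lam b)\<^sup>2) - 2 / real N * (\<Sum>b<N. lam b * S b b)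
      + 1 / (real N)\<^sup>2 * (\<Sum>b<N. \<Sum>c<N. (S b c)\<^sup>2)"
    unfolding sum.distrib sum_subtractf sum_distrib_left[symmetric] by simp
  also have "(\<Sum>b<N. lam b * S b b) = (\<Sum>a<N. lam a * (\<Sum>b<N. lam b * (?L a b)\<^sup>2))"
    unfolding S_def sum_distrib_left by (subst sum.swap) (simp add: power2_eq_square mult_ac)
  also have "(\<Sum>b<N. \<Sum>c<N. (S b c)\<^sup>2) = (\<Sum>b<N. \<Sum>c<N. \<Sum>a<N. lam a * (?L a b * S b c * ?L a c))"
  proof (intro sum.cong refl)
    fix b c
    have "(S b c)\<^sup>2 = S b c * (\<Sum>a<N. lam a * ?L a b * ?L a c)" by (simp add: power2_eq_square S_def)
    then show "(S b c)\<^sup>2 = (\<Sum>a<N. lam a * (?L a b * S b c * ?L a c))"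
      by (simp add: sum_distrib_left mult_ac)
  qed
  also have "\<dots> = (\<Sum>a<N. lam a * (\<Sum>b<N. \<Sum>c<N. ?L a b * S b c * ?L a c))"
    unfolding sum_distrib_left by (rule sum_rotate3)
  also have "\<dots> = (\<Sum>a<N. lam a * (\<Sum>a'<N. lam a' * (ip N (rows y a) (rows y a'))\<^sup>2))"
  proof (rule sum.cong[OF refl])
    fix a
    have "(\<Sum>b<N. \<Sum>c<N. ?L a b * S b c * ?L a c)
        = (\<Sum>b<N. \<Sum>c<N. \<Sum>a'<N. lam a' * ((?L a b * ?L a' b) * (?L a c * ?L a' c)))"
      unfolding S_def sum_distrib_left sum_distrib_right by (intro sum.cong refl) (simp add: mult_ac)
    also have "\<dots> = (\<Sum>a'<N. \<Sum>b<N. \<Sum>c<N. lam a' * ((?L a b * ?L a' b) * (?L a c * ?L a' c)))"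
      by (rule sum_rotate3)
    also have "\<dots> = (\<Sum>a'<N. lam a' * (ip N (rows y a) (rows y a'))\<^sup>2)"
      by (simp only: ip_rows_Lmat[OF nd] power2_eq_square sum_product) (simp only: sum_distrib_left)
    finally show "lam a * (\<Sum>b<N. \<Sum>c<N. ?L a b * S b c * ?L a c)
        = lam a * (\<Sum>a'<N. lam a' * (ip N (rows y a) (rows y a'))\<^sup>2)" by simp
  qed
  also have "\<dots> = (\<Sum>a<N. \<Sum>a'<N. lam a * lam a' * (ip N (rows y a) (rows y a'))\<^sup>2)"
    by (simp add: sum_distrib_left mult.assoc)
  finally show ?thesis .
qed

lemma sum_restrict_support:
  fixes g :: "nat \<Rightarrow> real"
  assumes "k \<le> N" "\<And>a. k \<le> a \<Longrightarrow> a < N \<Longrightarrow> g a = 0"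
  shows "(\<Sum>a<N. g a) = (\<Sum>a<k. g a)"
  by (rule sum.mono_neutral_right) (use assms in auto)

text \<open>The three terms of \<open>frob_Mmat\<close> are large and cancel. To expose this, the
  squared diagonal entry of L is traded for G a a minus the squares to its left. The terms in G a a
  then complete to a square of G a a - N, and what remains are entries of L below the diagonal and
  off-diagonal entries of G, with small second moments.\<close>

lemma frob_Mmat_le:
  assumes nd: "gs_nondeg N (rows y)" and k: "k \<le> N" and N: "1 \<le> N"
    and C: "\<And>a. a < N \<Longrightarrow> \<bar>lam a\<bar> \<le> C" and supp: "\<And>a. k \<le> a \<Longrightarrow> a < N \<Longrightarrow> lam a = 0"
  shows "frob N (Mmat N lam y) \<le> (\<Sum>a<k. C\<^sup>2 / (real N)\<^sup>2 * (ip N (rows y a) (rows y a) - real N)\<^sup>2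
      + 4 * C\<^sup>2 / real N * (\<Sum>b<a. (Lmat N y a b)\<^sup>2)
      + C\<^sup>2 / (real N)\<^sup>2 * (\<Sum>b\<in>{..<k} - {a}. (ip N (rows y a) (rows y b))\<^sup>2))"
proof -
  let ?L = "Lmat N y"
  let ?G = "\<lambda>a b. ip N (rows y a) (rows y b)"
  define R where "R = (\<lambda>a. \<Sum>b<a. (?L a b)\<^sup>2)"
  have CC: "\<bar>lam a * lam b\<bar> \<le> C\<^sup>2" if "a < N" "b < N" for a b
    using mult_mono[OF C[OF that(1)] C[OF that(2)]] C[OF that(1)] by (simp add: abs_mult power2_eq_square)
  have R0: "0 \<le> R a" for a by (simp add: R_def sum_nonneg)
  have split: "(\<Sum>b<N. g b * (?L a b)\<^sup>2) = g a * (?L a a)\<^sup>2 + (\<Sum>b<a. g b * (?L a b)\<^sup>2)" if a: "a < N" for a and g :: "nat \<Rightarrow> real"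
  proof -
    have "(\<Sum>b<N. g b * (?L a b)\<^sup>2) = (\<Sum>b<Suc a. g b * (?L a b)\<^sup>2)"
      by (rule sum_restrict_support) (use a ip_gs_upper[OF nd] in \<open>auto simp: Lmat_def\<close>)
    then show ?thesis by simp
  qed
  have G: "?G a a = (?L a a)\<^sup>2 + R a" if "a < N" for a
    using split[OF that, of "\<lambda>_. 1"] by (simp add: ip_rows_Lmat[OF nd] R_def power2_eq_square)
  \<comment> \<open>One C^2 R a comes from replacing the squared diagonal entry by G a a - R a, the
    other from the terms b < a. The later factor 2 / N turns this 2 into the 4 of the
    statement.\<close>
  have low: "(lam a)\<^sup>2 * ?G a a - 2 * C\<^sup>2 * R a \<le> lam a * (\<Sum>b<N. lam b * (?L a b)\<^sup>2)" if a: "a < N" for a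
  proof -
    have "- (C\<^sup>2 * R a) \<le> (\<Sum>b<a. lam a * lam b * (?L a b)\<^sup>2)"
    proof -
      have "(\<Sum>b<a. - C\<^sup>2 * (?L a b)\<^sup>2) \<le> (\<Sum>b<a. lam a * lam b * (?L a b)\<^sup>2)"
      proof (intro sum_mono mult_right_mono)
        fix b assume "b \<in> {..<a}"
        then show "- C\<^sup>2 \<le> lam a * lam b" using CC[of a b] a by (simp add: abs_le_iff)
      qed simp
      then show ?thesis by (simp add: R_def sum_distrib_left sum_negf)
    qed
    moreover have "(lam a)\<^sup>2 * R a \<le> C\<^sup>2 * R a"
      using CC[OF a a] R0 by (intro mult_right_mono) (auto simp: power2_eq_square)
    moreover have "lam a * (\<Sum>b<N. lam b * (?L a b)\<^sup>2)
        = (lam a)\<^sup>2 * (?G a a - R a) + (\<Sum>b<a. lam a * lam b * (?L a b)\<^sup>2)"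
      unfolding split[OF a] G[OF a] by (simp add: distrib_left sum_distrib_left power2_eq_square mult_ac)
    ultimately show ?thesis by (simp add: right_diff_distrib)
  qed
  have t1: "(\<Sum>a<N. (lam a)\<^sup>2) = (\<Sum>a<k. (lam a)\<^sup>2)"
    by (rule sum_restrict_support) (use k supp in auto)
  have t2: "(\<Sum>a<k. (lam a)\<^sup>2 * ?G a a - 2 * C\<^sup>2 * R a) \<le> (\<Sum>a<N. lam a * (\<Sum>b<N. lam b * (?L a b)\<^sup>2))"
    unfolding sum_restrict_support[of k N "\<lambda>a. lam a * (\<Sum>b<N. lam b * (?L a b)\<^sup>2)", OF k, simplified supp, simplified]
    by (intro sum_mono low) (use k in auto)
  have t3: "(\<Sum>a<N. \<Sum>a'<N. lam a * lam a' * (?G a a')\<^sup>2)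
      \<le> (\<Sum>a<k. (lam a)\<^sup>2 * (?G a a)\<^sup>2 + C\<^sup>2 * (\<Sum>b\<in>{..<k} - {a}. (?G a b)\<^sup>2))"
  proof -
    have "(\<Sum>a<N. \<Sum>a'<N. lam a * lam a' * (?G a a')\<^sup>2) = (\<Sum>a<k. \<Sum>a'<N. lam a * lam a' * (?G a a')\<^sup>2)"
      by (rule sum_restrict_support) (use k supp in auto)
    also have "\<dots> = (\<Sum>a<k. \<Sum>a'<k. lam a * lam a' * (?G a a')\<^sup>2)"
      by (rule sum.cong[OF refl], rule sum_restrict_support) (use k supp in auto)
    also have "\<dots> \<le> (\<Sum>a<k. (lam a)\<^sup>2 * (?G a a)\<^sup>2 + C\<^sup>2 * (\<Sum>b\<in>{..<k} - {a}. (?G a b)\<^sup>2))"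
    proof (rule sum_mono)
      fix a assume a: "a \<in> {..<k}"
      have "(\<Sum>a'<k. lam a * lam a' * (?G a a')\<^sup>2)
          = lam a * lam a * (?G a a)\<^sup>2 + (\<Sum>a'\<in>{..<k} - {a}. lam a * lam a' * (?G a a')\<^sup>2)"
        by (rule sum.remove) (use a in auto)
      also have "(\<Sum>a'\<in>{..<k} - {a}. lam a * lam a' * (?G a a')\<^sup>2) \<le> (\<Sum>a'\<in>{..<k} - {a}. C\<^sup>2 * (?G a a')\<^sup>2)"
      proof (intro sum_mono mult_right_mono)
        fix b assume "b \<in> {..<k} - {a}"
        then show "lam a * lam b \<le> C\<^sup>2" using CC[of a b] a k by (simp add: abs_le_iff)
      qed simp
      finally show "(\<Sum>a'<k. lam a * lam a' * (?G a a')\<^sup>2)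
          \<le> (lam a)\<^sup>2 * (?G a a)\<^sup>2 + C\<^sup>2 * (\<Sum>b\<in>{..<k} - {a}. (?G a b)\<^sup>2)"
        by (simp add: power2_eq_square sum_distrib_left)
    qed
    finally show ?thesis .
  qed
  have "frob N (Mmat N lam y) \<le> (\<Sum>a<k. (lam a)\<^sup>2) - 2 / real N * (\<Sum>a<k. (lam a)\<^sup>2 * ?G a a - 2 * C\<^sup>2 * R a)
      + 1 / (real N)\<^sup>2 * (\<Sum>a<k. (lam a)\<^sup>2 * (?G a a)\<^sup>2 + C\<^sup>2 * (\<Sum>b\<in>{..<k} - {a}. (?G a b)\<^sup>2))"
    unfolding frob_Mmat[OF nd] t1
    by (intro add_mono diff_mono mult_left_mono t2 t3) auto
  also have "\<dots> = (\<Sum>a<k. (lam a)\<^sup>2 - 2 / real N * ((lam a)\<^sup>2 * ?G a a - 2 * C\<^sup>2 * R a)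
      + 1 / (real N)\<^sup>2 * ((lam a)\<^sup>2 * (?G a a)\<^sup>2 + C\<^sup>2 * (\<Sum>b\<in>{..<k} - {a}. (?G a b)\<^sup>2)))"
    by (simp only: sum.distrib sum_subtractf sum_distrib_left[symmetric])
  also have "\<dots> \<le> (\<Sum>a<k. C\<^sup>2 / (real N)\<^sup>2 * (?G a a - real N)\<^sup>2 + 4 * C\<^sup>2 / real N * R a
      + C\<^sup>2 / (real N)\<^sup>2 * (\<Sum>b\<in>{..<k} - {a}. (?G a b)\<^sup>2))"
  proof (rule sum_mono)
    fix a assume a: "a \<in> {..<k}"
    \<comment> \<open>Completes the square: 1 - 2 g / N + g^2 / N^2 = (g - N)^2 / N^2 for g = G a
      a.\<close>
    have "(lam a)\<^sup>2 - 2 / real N * ((lam a)\<^sup>2 * ?G a a - 2 * C\<^sup>2 * R a)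
      + 1 / (real N)\<^sup>2 * ((lam a)\<^sup>2 * (?G a a)\<^sup>2 + C\<^sup>2 * (\<Sum>b\<in>{..<k} - {a}. (?G a b)\<^sup>2))
      = (lam a)\<^sup>2 / (real N)\<^sup>2 * (?G a a - real N)\<^sup>2 + 4 * C\<^sup>2 / real N * R a
      + C\<^sup>2 / (real N)\<^sup>2 * (\<Sum>b\<in>{..<k} - {a}. (?G a b)\<^sup>2)"
      using N by (simp add: power2_diff field_simps power2_eq_square)
    also have "(lam a)\<^sup>2 / (real N)\<^sup>2 * (?G a a - real N)\<^sup>2 \<le> C\<^sup>2 / (real N)\<^sup>2 * (?G a a - real N)\<^sup>2"
      using CC[of a a] a k by (intro mult_right_mono divide_right_mono) (auto simp: power2_eq_square)
    finally show "(lam a)\<^sup>2 - 2 / real N * ((lam a)\<^sup>2 * ?G a a - 2 * C\<^sup>2 * R a)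
      + 1 / (real N)\<^sup>2 * ((lam a)\<^sup>2 * (?G a a)\<^sup>2 + C\<^sup>2 * (\<Sum>b\<in>{..<k} - {a}. (?G a b)\<^sup>2))
      \<le> C\<^sup>2 / (real N)\<^sup>2 * (?G a a - real N)\<^sup>2 + 4 * C\<^sup>2 / real N * R a
      + C\<^sup>2 / (real N)\<^sup>2 * (\<Sum>b\<in>{..<k} - {a}. (?G a b)\<^sup>2)" by simp
  qed
  finally show ?thesis by (simp add: R_def)
qed

text \<open>Cauchy--Schwarz over the k nonzero eigenvalues. The factor k it costs is affordable: the
  expectation is of order k^2 / N, as for the Frobenius norm.\<close>

lemma trace_Mmat_sq_le:
  assumes nd: "gs_nondeg N (rows y)" and k: "k \<le> N" and N: "1 \<le> N"
    and C: "\<And>a. a < N \<Longrightarrow> \<bar>lam a\<bar> \<le> C" and supp: "\<And>a. k \<le> a \<Longrightarrow> a < N \<Longrightarrow> lam a = 0"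
  shows "(trace N (Mmat N lam y))\<^sup>2 \<le> (\<Sum>a<k. real k * C\<^sup>2 / (real N)\<^sup>2 * (ip N (rows y a) (rows y a) - real N)\<^sup>2)"
proof -
  let ?d = "\<lambda>a. 1 - ip N (rows y a) (rows y a) / real N"
  have "trace N (Mmat N lam y) = (\<Sum>a<k. lam a * ?d a)"
    unfolding trace_Mmat[OF nd] by (rule sum_restrict_support) (use k supp in auto)
  then have "(trace N (Mmat N lam y))\<^sup>2 \<le> (\<Sum>a<k. (lam a)\<^sup>2) * (\<Sum>a<k. (?d a)\<^sup>2)"
    using Cauchy_Schwarz_ineq_sum[of lam ?d "{..<k}"] by simp
  also have "\<dots> \<le> (real k * C\<^sup>2) * (\<Sum>a<k. (?d a)\<^sup>2)"
  proof (rule mult_right_mono)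
    have "(\<Sum>a<k. (lam a)\<^sup>2) \<le> (\<Sum>a<k. C\<^sup>2)"
      using C k by (intro sum_mono) (auto simp: abs_le_square_iff[symmetric] intro: order_trans[OF _ abs_ge_self])
    then show "(\<Sum>a<k. (lam a)\<^sup>2) \<le> real k * C\<^sup>2" by simp
  qed (simp add: sum_nonneg)
  also have "\<dots> = (\<Sum>a<k. real k * C\<^sup>2 / (real N)\<^sup>2 * (ip N (rows y a) (rows y a) - real N)\<^sup>2)"
    unfolding sum_distrib_left
  proof (rule sum.cong[OF refl])
    fix a
    have "?d a = (real N - ip N (rows y a) (rows y a)) / real N" using N by (simp add: diff_divide_distrib)
    then show "real k * C\<^sup>2 * (?d a)\<^sup>2 = real k * C\<^sup>2 / (real N)\<^sup>2 * (ip N (rows y a) (rows y a) - real N)\<^sup>2"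
      by (simp add: power_divide power2_commute)
  qed
  finally show ?thesis .
qed

section \<open>Markov's inequality and the resulting tails of trace and Frobenius norm\<close>

lemma nn_integral_markov:
  assumes [measurable]: "X \<in> borel_measurable M" and t: "0 < t"
    and E: "(\<integral>\<^sup>+y. ennreal (X y) \<partial>M) \<le> ennreal B" and B: "0 \<le> B"
  shows "(\<integral>\<^sup>+y. (if t < X y then 1 else 0) \<partial>M) \<le> ennreal (B / t)"
proof -
  have "(\<integral>\<^sup>+y. (if t < X y then 1 else 0) \<partial>M) \<le> (\<integral>\<^sup>+y. ennreal (1 / t) * ennreal (X y) \<partial>M)"
  proof (rule nn_integral_mono)
    fix y
    show "(if t < X y then 1 else 0) \<le> ennreal (1 / t) * ennreal (X y)"
    proof (cases "t < X y")
      case True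
      then have "1 \<le> 1 / t * X y" using t by simp
      then have "ennreal 1 \<le> ennreal (1 / t * X y)" by (rule ennreal_leI)
      then show ?thesis using True t by (simp add: ennreal_mult[symmetric])
    qed simp
  qed
  also have "\<dots> = ennreal (1 / t) * (\<integral>\<^sup>+y. ennreal (X y) \<partial>M)" by (rule nn_integral_cmult) simp
  also have "\<dots> \<le> ennreal (1 / t) * ennreal B" by (intro mult_left_mono E) simp
  also have "\<dots> = ennreal (B / t)" using t B by (simp add: ennreal_mult[symmetric])
  finally show ?thesis .
qed

lemma nn_integral_cmult_real:
  assumes "X \<in> borel_measurable M" "0 \<le> c" "(\<integral>\<^sup>+y. ennreal (X y) \<partial>M) \<le> ennreal B" "\<And>y. 0 \<le> X y" "0 \<le> B"
  shows "(\<integral>\<^sup>+y. ennreal (c * X y) \<partial>M) \<le> ennreal (c * B)"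
proof -
  have "(\<integral>\<^sup>+y. ennreal (c * X y) \<partial>M) = (\<integral>\<^sup>+y. ennreal c * ennreal (X y) \<partial>M)"
    using assms by (simp add: ennreal_mult)
  also have "\<dots> = ennreal c * (\<integral>\<^sup>+y. ennreal (X y) \<partial>M)" by (rule nn_integral_cmult) (use assms in simp)
  also have "\<dots> \<le> ennreal c * ennreal B" by (intro mult_left_mono assms) simp
  finally show ?thesis using assms by (simp add: ennreal_mult)
qed

lemma nn_integral_sum_real:
  assumes "\<And>i. i \<in> I \<Longrightarrow> X i \<in> borel_measurable M" "\<And>i y. i \<in> I \<Longrightarrow> 0 \<le> X i y"
    and "\<And>i. i \<in> I \<Longrightarrow> (\<integral>\<^sup>+y. ennreal (X i y) \<partial>M) \<le> ennreal (B i)" "\<And>i. i \<in> I \<Longrightarrow> 0 \<le> B i"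
  shows "(\<integral>\<^sup>+y. ennreal (\<Sum>i\<in>I. X i y) \<partial>M) \<le> ennreal (\<Sum>i\<in>I. B i)"
proof -
  have "(\<integral>\<^sup>+y. ennreal (\<Sum>i\<in>I. X i y) \<partial>M) = (\<integral>\<^sup>+y. (\<Sum>i\<in>I. ennreal (X i y)) \<partial>M)"
    using assms(2) by (simp add: sum_ennreal)
  also have "\<dots> = (\<Sum>i\<in>I. \<integral>\<^sup>+y. ennreal (X i y) \<partial>M)" by (rule nn_integral_sum) (use assms in simp)
  also have "\<dots> \<le> (\<Sum>i\<in>I. ennreal (B i))" by (rule sum_mono) (use assms in simp)
  also have "\<dots> = ennreal (\<Sum>i\<in>I. B i)" using assms(4) by (simp add: sum_ennreal)
  finally show ?thesis .
qed

lemma nn_integral_add_real: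
  assumes "X \<in> borel_measurable M" "Y \<in> borel_measurable M" "\<And>y. 0 \<le> X y" "\<And>y. 0 \<le> Y y"
    and "(\<integral>\<^sup>+y. ennreal (X y) \<partial>M) \<le> ennreal A" "(\<integral>\<^sup>+y. ennreal (Y y) \<partial>M) \<le> ennreal B" "0 \<le> A" "0 \<le> B"
  shows "(\<integral>\<^sup>+y. ennreal (X y + Y y) \<partial>M) \<le> ennreal (A + B)"
proof -
  have "(\<integral>\<^sup>+y. ennreal (X y + Y y) \<partial>M) = (\<integral>\<^sup>+y. ennreal (X y) + ennreal (Y y) \<partial>M)"
    using assms by (simp add: ennreal_plus)
  also have "\<dots> = (\<integral>\<^sup>+y. ennreal (X y) \<partial>M) + (\<integral>\<^sup>+y. ennreal (Y y) \<partial>M)"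
    by (rule nn_integral_add) (use assms in auto)
  also have "\<dots> \<le> ennreal A + ennreal B" by (intro add_mono assms)
  finally show ?thesis using assms by (simp add: ennreal_plus)
qed

lemma measurable_ip_rows [measurable]:
  assumes "a < N" "b < N"
  shows "(\<lambda>y. ip N (rows y a) (rows y b)) \<in> borel_measurable (gauss_vecs N)"
proof -
  have "(\<lambda>y. ip N (rows y a) (rows y b)) \<in> borel_measurable (PiM (sq_index N) (\<lambda>_. borel))"
    unfolding ip_def by (intro borel_measurable_sum borel_measurable_times measurable_rows) (use assms in auto)
  then show ?thesis by measurable
qed

lemma frob_tail:
  assumes k: "k \<le> N" and N: "1 \<le> N" and t: "0 < t"
    and C: "\<And>a. a < N \<Longrightarrow> \<bar>lam a\<bar> \<le> C" and supp: "\<And>a. k \<le> a \<Longrightarrow> a < N \<Longrightarrow> lam a = 0"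
  shows "(\<integral>\<^sup>+y. (if t < frob N (Mmat N lam y) then 1 else 0) \<partial>gauss_vecs N)
    \<le> ennreal (7 * C\<^sup>2 * (real k)\<^sup>2 / real N / t)"
proof (rule nn_integral_markov)
  let ?G = "\<lambda>y a b. ip N (rows y a) (rows y b)"
  let ?X = "\<lambda>a y. C\<^sup>2 / (real N)\<^sup>2 * (?G y a a - real N)\<^sup>2
      + 4 * C\<^sup>2 / real N * (\<Sum>b<a. (Lmat N y a b)\<^sup>2)
      + C\<^sup>2 / (real N)\<^sup>2 * (\<Sum>b\<in>{..<k} - {a}. (?G y a b)\<^sup>2)"
  have "(\<integral>\<^sup>+y. ennreal (frob N (Mmat N lam y)) \<partial>gauss_vecs N) \<le> (\<integral>\<^sup>+y. ennreal (\<Sum>a<k. ?X a y) \<partial>gauss_vecs N)"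
    by (rule nn_integral_mono_AE)
       (use AE_gs_nondeg[of N] in eventually_elim, rule ennreal_leI, rule frob_Mmat_le[OF _ k N C supp], assumption)
  also have "\<dots> \<le> ennreal (\<Sum>a<k. C\<^sup>2 / (real N)\<^sup>2 * (2 * real N) + 4 * C\<^sup>2 / real N * (\<Sum>b<a. 1)
      + C\<^sup>2 / (real N)\<^sup>2 * (\<Sum>b\<in>{..<k} - {a}. real N))"
  proof (rule nn_integral_sum_real)
    fix a assume "a \<in> {..<k}"
    then have a: "a < k" "a < N" using k by auto
    have m1: "(\<lambda>y. (?G y a a - real N)\<^sup>2) \<in> borel_measurable (gauss_vecs N)"
      using measurable_ip_rows[OF a(2) a(2)] by measurable
    have m2: "(\<lambda>y. (Lmat N y a b)\<^sup>2) \<in> borel_measurable (gauss_vecs N)" if "b \<in> {..<a}" for b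
      by (intro borel_measurable_power measurable_Lmat) (use a that in auto)
    have m3: "(\<lambda>y. (?G y a b)\<^sup>2) \<in> borel_measurable (gauss_vecs N)" if "b \<in> {..<k} - {a}" for b
      by (intro borel_measurable_power measurable_ip_rows) (use a k that in auto)
    have m2': "(\<lambda>y. \<Sum>b<a. (Lmat N y a b)\<^sup>2) \<in> borel_measurable (gauss_vecs N)"
      by (rule borel_measurable_sum[OF m2])
    have m3': "(\<lambda>y. \<Sum>b\<in>{..<k} - {a}. (?G y a b)\<^sup>2) \<in> borel_measurable (gauss_vecs N)"
      by (rule borel_measurable_sum[OF m3])
    show "?X a \<in> borel_measurable (gauss_vecs N)"
      by (intro borel_measurable_add borel_measurable_times borel_measurable_const m1 m2' m3')
    show "0 \<le> ?X a y" for y by (intro add_nonneg_nonneg mult_nonneg_nonneg sum_nonneg) auto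
    show "(\<integral>\<^sup>+y. ennreal (?X a y) \<partial>gauss_vecs N) \<le> ennreal (C\<^sup>2 / (real N)\<^sup>2 * (2 * real N)
        + 4 * C\<^sup>2 / real N * (\<Sum>b<a. 1) + C\<^sup>2 / (real N)\<^sup>2 * (\<Sum>b\<in>{..<k} - {a}. real N))"
    proof (intro nn_integral_add_real nn_integral_cmult_real nn_integral_sum_real
        borel_measurable_add borel_measurable_times borel_measurable_const m1 m2' m3' m2 m3)
      show "(\<integral>\<^sup>+y. ennreal ((?G y a a - real N)\<^sup>2) \<partial>gauss_vecs N) \<le> ennreal (2 * real N)"
        using row_norm_variance[OF a(2)] by simp
      show "(\<integral>\<^sup>+y. ennreal ((Lmat N y a b)\<^sup>2) \<partial>gauss_vecs N) \<le> ennreal 1" if "b \<in> {..<a}" for b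
        using Lmat_second_moment[of b a N] a that by simp
      show "(\<integral>\<^sup>+y. ennreal ((?G y a b)\<^sup>2) \<partial>gauss_vecs N) \<le> ennreal (real N)" if "b \<in> {..<k} - {a}" for b
        by (rule row_inner_second_moment) (use a k that in auto)
    qed (auto intro!: sum_nonneg mult_nonneg_nonneg add_nonneg_nonneg divide_nonneg_nonneg)
    show "0 \<le> C\<^sup>2 / (real N)\<^sup>2 * (2 * real N) + 4 * C\<^sup>2 / real N * (\<Sum>b<a. 1)
      + C\<^sup>2 / (real N)\<^sup>2 * (\<Sum>b\<in>{..<k} - {a}. real N)" by simp
  qed
  also have "\<dots> \<le> ennreal (7 * C\<^sup>2 * (real k)\<^sup>2 / real N)"
  proof (rule ennreal_leI)
    have "(\<Sum>a<k. C\<^sup>2 / (real N)\<^sup>2 * (2 * real N) + 4 * C\<^sup>2 / real N * (\<Sum>b<a. 1)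
      + C\<^sup>2 / (real N)\<^sup>2 * (\<Sum>b\<in>{..<k} - {a}. real N)) \<le> (\<Sum>a<k. 7 * C\<^sup>2 * real k / real N)"
    proof (rule sum_mono)
      fix a assume "a \<in> {..<k}"
      then have a: "a < k" by simp
      \<comment> \<open>Per row: 2 from the variance of the norm, 4 a from the entries of L below
        the diagonal, k - 1 from the other rows. As a < k, the total is at most 7 k.\<close>
      have "C\<^sup>2 / (real N)\<^sup>2 * (2 * real N) + 4 * C\<^sup>2 / real N * (\<Sum>b<a. 1)
        + C\<^sup>2 / (real N)\<^sup>2 * (\<Sum>b\<in>{..<k} - {a}. real N) = C\<^sup>2 / real N * (2 + 4 * real a + (real k - 1))"
        using N a by (simp add: power2_eq_square field_simps of_nat_diff)
      also have "\<dots> \<le> C\<^sup>2 / real N * (7 * real k)"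
        using a by (intro mult_left_mono) auto
      finally show "C\<^sup>2 / (real N)\<^sup>2 * (2 * real N) + 4 * C\<^sup>2 / real N * (\<Sum>b<a. 1)
        + C\<^sup>2 / (real N)\<^sup>2 * (\<Sum>b\<in>{..<k} - {a}. real N) \<le> 7 * C\<^sup>2 * real k / real N" by (simp add: mult_ac)
    qed
    then show "(\<Sum>a<k. C\<^sup>2 / (real N)\<^sup>2 * (2 * real N) + 4 * C\<^sup>2 / real N * (\<Sum>b<a. 1)
      + C\<^sup>2 / (real N)\<^sup>2 * (\<Sum>b\<in>{..<k} - {a}. real N)) \<le> 7 * C\<^sup>2 * (real k)\<^sup>2 / real N"
      by (simp add: power2_eq_square mult_ac)
  qed
  finally show "(\<integral>\<^sup>+y. ennreal (frob N (Mmat N lam y)) \<partial>gauss_vecs N) \<le> ennreal (7 * C\<^sup>2 * (real k)\<^sup>2 / real N)" .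
qed (use t in auto)

lemma trace_tail:
  assumes k: "k \<le> N" and N: "1 \<le> N" and t: "0 < t"
    and C: "\<And>a. a < N \<Longrightarrow> \<bar>lam a\<bar> \<le> C" and supp: "\<And>a. k \<le> a \<Longrightarrow> a < N \<Longrightarrow> lam a = 0"
  shows "(\<integral>\<^sup>+y. (if t < (trace N (Mmat N lam y))\<^sup>2 then 1 else 0) \<partial>gauss_vecs N)
    \<le> ennreal (2 * C\<^sup>2 * (real k)\<^sup>2 / real N / t)"
proof (rule nn_integral_markov)
  let ?G = "\<lambda>y a b. ip N (rows y a) (rows y b)"
  have "(\<integral>\<^sup>+y. ennreal ((trace N (Mmat N lam y))\<^sup>2) \<partial>gauss_vecs N)
      \<le> (\<integral>\<^sup>+y. ennreal (\<Sum>a<k. real k * C\<^sup>2 / (real N)\<^sup>2 * (?G y a a - real N)\<^sup>2) \<partial>gauss_vecs N)"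
    by (rule nn_integral_mono_AE)
       (use AE_gs_nondeg[of N] in eventually_elim, rule ennreal_leI, rule trace_Mmat_sq_le[OF _ k N C supp], assumption)
  also have "\<dots> \<le> ennreal (\<Sum>a<k. real k * C\<^sup>2 / (real N)\<^sup>2 * (2 * real N))"
  proof (rule nn_integral_sum_real)
    fix a assume "a \<in> {..<k}"
    then have a: "a < N" using k by auto
    have m1: "(\<lambda>y. (?G y a a - real N)\<^sup>2) \<in> borel_measurable (gauss_vecs N)"
      using measurable_ip_rows[OF a a] by measurable
    then show "(\<lambda>y. real k * C\<^sup>2 / (real N)\<^sup>2 * (?G y a a - real N)\<^sup>2) \<in> borel_measurable (gauss_vecs N)"
      by measurable
    show "(\<integral>\<^sup>+y. ennreal (real k * C\<^sup>2 / (real N)\<^sup>2 * (?G y a a - real N)\<^sup>2) \<partial>gauss_vecs N)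
        \<le> ennreal (real k * C\<^sup>2 / (real N)\<^sup>2 * (2 * real N))"
      by (rule nn_integral_cmult_real[OF m1]) (use row_norm_variance[OF a] in auto)
  qed auto
  also have "\<dots> = ennreal (2 * C\<^sup>2 * (real k)\<^sup>2 / real N)"
    using N by (simp add: power2_eq_square field_simps)
  finally show "(\<integral>\<^sup>+y. ennreal ((trace N (Mmat N lam y))\<^sup>2) \<partial>gauss_vecs N) \<le> ennreal (2 * C\<^sup>2 * (real k)\<^sup>2 / real N)" .
qed (use t in auto)

section \<open>The coupling for matrices of bounded norm and low rank\<close>


lemma rank_sum_rank_one:
  assumes "finite S"
  shows "vec_space.rank N (mat N N (\<lambda>(i, j). \<Sum>a\<in>S. v a i * v a j) :: real mat) \<le> card S"
  using assms
proof (induction S rule: finite_induct)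
  case empty
  have "mat N N (\<lambda>(i, j). \<Sum>a\<in>{}. v a i * v a j) = (0\<^sub>m N N :: real mat)"
    by (rule eq_matI) auto
  then show ?case by (simp only: vec_space.rank_0I card.empty)
next
  case (insert x S)
  let ?A = "mat N N (\<lambda>(i, j). v x i * v x j) :: real mat"
  let ?B = "mat N N (\<lambda>(i, j). \<Sum>a\<in>S. v a i * v a j) :: real mat"
  have "mat N N (\<lambda>(i, j). \<Sum>a\<in>insert x S. v a i * v a j) = ?A + ?B"
    by (rule eq_matI) (use insert.hyps in auto)
  moreover have "vec_space.rank N (?A + ?B) \<le> vec_space.rank N ?A + vec_space.rank N ?B"
    by (rule vec_space.rank_subadditive) auto
  moreover have "vec_space.rank N ?A \<le> 1"
    by (rule vec_space.rank_le_1_product_entries[of _ N N "v x" "v x"]) auto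
  ultimately show ?case using insert by simp
qed

text \<open>Adding the projection onto the kernel makes a symmetric matrix invertible.\<close>

lemma card_nonzero_eigenvalues_le_mrank:
  assumes o: "orthogonal_on {..<N} v"
    and e: "\<And>b i. b < N \<Longrightarrow> i < N \<Longrightarrow> mv N A (v b) i = lam b * v b i"
    and sym: "\<And>i j. i < N \<Longrightarrow> j < N \<Longrightarrow> A i j = A j i"
  shows "card {a. a < N \<and> lam a \<noteq> 0} \<le> mrank N A"
proof -
  define Z where "Z = {a. a < N \<and> lam a = 0}"
  have fin: "finite Z" by (simp add: Z_def)
  let ?B = "mat N N (\<lambda>(i, j). \<Sum>a\<in>Z. v a i * v a j) :: real mat"
  let ?S = "to_mat N A + ?B"
  have ou: "ip N (v a) (v b) = of_bool (a = b)" if "a < N" "b < N" for a b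
    using o that by (simp add: orthogonal_on_ip)
  have S: "?S \<in> carrier_mat N N" by (simp add: to_mat_def)
  have "Determinant.det ?S \<noteq> 0"
  proof
    assume "Determinant.det ?S = 0"
    then obtain w where w: "w \<in> carrier_vec N" "w \<noteq> 0\<^sub>v N" "?S *\<^sub>v w = 0\<^sub>v N"
      using det_0_iff_vec_prod_zero[OF S] by blast
    define x where "x = (\<lambda>i. w $ i)"
    define y where "y = (\<lambda>i. mv N A x i + (\<Sum>a\<in>Z. ip N (v a) x * v a i))"
    have "y i = 0" if "i < N" for i
    proof -
      have "(?S *\<^sub>v w) $ i = (\<Sum>j<N. (A i j + (\<Sum>a\<in>Z. v a i * v a j)) * x j)"
        using that w(1) by (simp add: scalar_prod_def x_def to_mat_def atLeast0LessThan)
      also have "\<dots> = y i"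
        unfolding y_def mv_def ip_def distrib_right sum.distrib sum_distrib_right
        by (subst (2) sum.swap) (simp add: mult_ac)
      finally show ?thesis using w(3) that by simp
    qed
    then have y0: "ip N u y = 0" for u unfolding ip_def by simp
    \<comment> \<open>The sum multiplies v b by lam b if that is nonzero and by 1 otherwise, so no
      component of a kernel vector survives.\<close>
    have "ip N (v b) x = 0" if b: "b < N" for b
    proof -
      have "ip N (v b) (mv N A x) = ip N (mv N A (v b)) x" by (rule ip_mv_sym[OF sym])
      also have "\<dots> = ip N (\<lambda>i. lam b * v b i) x" by (rule ip_cong) (use e b in auto)
      finally have 1: "ip N (v b) (mv N A x) = lam b * ip N (v b) x" by (simp add: ip_simps)
      have "(\<Sum>a\<in>Z. ip N (v a) x * ip N (v b) (v a)) = (\<Sum>a\<in>Z. if a = b then ip N (v a) x else 0)"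
        by (intro sum.cong refl) (use ou b in \<open>auto simp: Z_def\<close>)
      then have "0 = lam b * ip N (v b) x + (if b \<in> Z then ip N (v b) x else 0)"
        using y0[of "v b"] fin unfolding y_def ip_simps by (simp add: 1)
      then show ?thesis using b by (auto simp: Z_def split: if_splits)
    qed
    then have "x i = 0" if "i < N" for i using orthonormal_expand[OF o that, of x] by simp
    then have "w = 0\<^sub>v N" using w(1) by (intro eq_vecI) (auto simp: x_def)
    then show False using w(2) by simp
  qed
  then have "vec_space.rank N ?S = N" using vec_space.det_rank_iff[OF S] by simp
  moreover have "vec_space.rank N ?S \<le> vec_space.rank N (to_mat N A) + vec_space.rank N ?B"
    by (rule vec_space.rank_subadditive) (auto simp: to_mat_def)
  moreover have "vec_space.rank N ?B \<le> card Z" by (rule rank_sum_rank_one[OF fin])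
  ultimately have "N \<le> mrank N A + card Z" by (simp add: mrank_def)
  moreover have "card {a. a < N \<and> lam a \<noteq> 0} + card Z = N"
  proof -
    have "card ({a. a < N \<and> lam a \<noteq> 0} \<union> Z) = card {a. a < N \<and> lam a \<noteq> 0} + card Z"
      by (rule card_Un_disjoint) (auto simp: Z_def)
    moreover have "{a. a < N \<and> lam a \<noteq> 0} \<union> Z = {..<N}" by (auto simp: Z_def)
    ultimately show ?thesis by simp
  qed
  ultimately show ?thesis by simp
qed

lemma abs_eigenvalue_le_op_norm:
  assumes o: "orthogonal_on {..<N} v"
    and e: "\<And>b i. b < N \<Longrightarrow> i < N \<Longrightarrow> mv N A (v b) i = lam b * v b i"
    and sym: "\<And>i j. i < N \<Longrightarrow> j < N \<Longrightarrow> A i j = A j i" and a: "a < N"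
  shows "\<bar>lam a\<bar> \<le> op_norm N A"
proof -
  let ?S = "{sqrt (\<Sum>i<N. (\<Sum>j<N. A i j * x j)\<^sup>2) | x. (\<Sum>j<N. (x j)\<^sup>2) = 1}"
  have sq: "(\<Sum>i<N. (\<Sum>j<N. A i j * x j)\<^sup>2) = (\<Sum>b<N. (lam b * ip N (v b) x)\<^sup>2)" for x
  proof -
    have "ip N (v b) (mv N A x) = lam b * ip N (v b) x" if b: "b < N" for b
    proof -
      have "ip N (v b) (mv N A x) = ip N (mv N A (v b)) x" by (rule ip_mv_sym[OF sym])
      also have "\<dots> = ip N (\<lambda>i. lam b * v b i) x" by (rule ip_cong) (use e b in auto)
      finally show ?thesis by (simp add: ip_simps)
    qed
    moreover have "(\<Sum>i<N. (\<Sum>j<N. A i j * x j)\<^sup>2) = ip N (mv N A x) (mv N A x)"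
      by (simp add: ip_def mv_def power2_eq_square)
    ultimately show ?thesis
      unfolding parseval[OF o, of "mv N A x"] by (simp add: power2_eq_square)
  qed
  \<comment> \<open>The supremum in \<open>op_norm\<close> bounds its members only if the set is
    bounded; the Frobenius norm serves as a bound.\<close>
  have "bdd_above ?S"
  proof (rule bdd_aboveI)
    fix s assume "s \<in> ?S"
    then obtain x where x: "s = sqrt (\<Sum>i<N. (\<Sum>j<N. A i j * x j)\<^sup>2)" "(\<Sum>j<N. (x j)\<^sup>2) = 1" by auto
    have "ip N x x = 1" using x(2) by (simp add: ip_def power2_eq_square)
    then have p: "(\<Sum>b<N. (ip N (v b) x)\<^sup>2) = 1" unfolding parseval[OF o, of x] by (simp add: power2_eq_square)
    have "(\<Sum>b<N. (lam b * ip N (v b) x)\<^sup>2) \<le> (\<Sum>b<N. (lam b)\<^sup>2)"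
    proof (rule sum_mono)
      fix b assume "b \<in> {..<N}"
      then have "(ip N (v b) x)\<^sup>2 \<le> (\<Sum>b<N. (ip N (v b) x)\<^sup>2)" by (intro member_le_sum) auto
      then have "(lam b)\<^sup>2 * (ip N (v b) x)\<^sup>2 \<le> (lam b)\<^sup>2 * 1" unfolding p by (intro mult_left_mono) auto
      then show "(lam b * ip N (v b) x)\<^sup>2 \<le> (lam b)\<^sup>2" by (simp add: power_mult_distrib)
    qed
    then show "s \<le> sqrt (\<Sum>b<N. (lam b)\<^sup>2)" unfolding x(1) sq by simp
  qed
  moreover have "\<bar>lam a\<bar> \<in> ?S"
  proof -
    have va: "ip N (v b) (v a) = of_bool (b = a)" if "b < N" for b using o a that by (simp add: orthogonal_on_ip)
    have "(\<Sum>b<N. (lam b * ip N (v b) (v a))\<^sup>2) = (\<Sum>b<N. if b = a then (lam a)\<^sup>2 else 0)"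
      by (intro sum.cong refl) (auto simp: va)
    then have "sqrt (\<Sum>i<N. (\<Sum>j<N. A i j * v a j)\<^sup>2) = \<bar>lam a\<bar>" using a by (simp add: sq)
    moreover have "(\<Sum>j<N. (v a j)\<^sup>2) = 1" using va[OF a] by (simp add: ip_def power2_eq_square)
    ultimately have "\<exists>x. \<bar>lam a\<bar> = sqrt (\<Sum>i<N. (\<Sum>j<N. A i j * x j)\<^sup>2) \<and> (\<Sum>j<N. (x j)\<^sup>2) = 1"
      by (intro exI[of _ "v a"] conjI) simp_all
    then show ?thesis by (rule CollectI)
  qed
  ultimately show ?thesis unfolding op_norm_def by (rule cSup_upper[rotated])
qed

text \<open>The order matters because Gram--Schmidt is triangular: with the nonzero eigenvalues
  first, only rows a < k of L enter, and M vanishes outside its leading k x k block.\<close>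

lemma ordered_spectral_decomposition:
  assumes sym: "\<And>i j. i < N \<Longrightarrow> j < N \<Longrightarrow> A i j = A j i"
  obtains v lam k where "orthogonal_on {..<N} v"
    "\<And>b i. b < N \<Longrightarrow> i < N \<Longrightarrow> mv N A (v b) i = lam b * v b i"
    "k \<le> N" "k \<le> mrank N A" "\<And>a. k \<le> a \<Longrightarrow> a < N \<Longrightarrow> lam a = 0" "\<And>a. a < N \<Longrightarrow> \<bar>lam a\<bar> \<le> op_norm N A"
proof -
  obtain v lam where o: "orthogonal_on {..<N} v"
    and e: "\<And>b i. b < N \<Longrightarrow> i < N \<Longrightarrow> mv N A (v b) i = lam b * v b i"
    using spectral_decomposition[of N A] sym by metis
  define K where "K = {a. a < N \<and> lam a \<noteq> 0}"
  have K: "finite K" "K \<subseteq> {..<N}" by (auto simp: K_def)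
  have kN: "card K \<le> N" using card_mono[OF _ K(2)] by simp
  obtain f where f: "bij_betw f {..<card K} K"
    using ex_bij_betw_nat_finite[OF K(1)] by (auto simp: atLeast0LessThan)
  have "card {card K..<N} = card ({..<N} - K)" using K by (simp add: card_Diff_subset)
  then obtain g where g: "bij_betw g {card K..<N} ({..<N} - K)"
    using finite_same_card_bij[of "{card K..<N}" "{..<N} - K"] by auto
  \<comment> \<open>A permutation of the indices that sends the first card K of them to the nonzero
    eigenvalues.\<close>
  define p where "p = (\<lambda>a. if a < card K then f a else g a)"
  have pf: "bij_betw p {..<card K} K" using f by (subst bij_betw_cong[of _ p f]) (auto simp: p_def)
  have pg: "bij_betw p {card K..<N} ({..<N} - K)" using g by (subst bij_betw_cong[of _ p g]) (auto simp: p_def)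
  have "bij_betw p ({..<card K} \<union> {card K..<N}) (K \<union> ({..<N} - K))"
    by (rule bij_betw_combine[OF pf pg]) auto
  moreover have "{..<card K} \<union> {card K..<N} = {..<N}" "K \<union> ({..<N} - K) = {..<N}" using kN K by auto
  ultimately have p: "bij_betw p {..<N} {..<N}" by simp
  have pN: "p a < N" if "a < N" for a using bij_betwE[OF p] that by auto
  have inj: "p a = p b \<longleftrightarrow> a = b" if "a < N" "b < N" for a b
    using p that by (auto simp: bij_betw_def inj_on_def)
  show ?thesis
  proof (rule that[of "\<lambda>a. v (p a)" "\<lambda>a. lam (p a)" "card K"])
    show "orthogonal_on {..<N} (\<lambda>a. v (p a))"
      using o by (auto simp: orthogonal_on_ip pN inj)
    show "mv N A (v (p b)) i = lam (p b) * v (p b) i" if "b < N" "i < N" for b i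
      using e[OF pN[OF that(1)] that(2)] .
    show "card K \<le> mrank N A" unfolding K_def by (rule card_nonzero_eigenvalues_le_mrank[OF o e sym])
    show "lam (p a) = 0" if "card K \<le> a" "a < N" for a
      using bij_betwE[OF pg] that by (auto simp: K_def)
    show "\<bar>lam (p a)\<bar> \<le> op_norm N A" if "a < N" for a
      by (rule abs_eigenvalue_le_op_norm[OF o e sym pN[OF that]])
  qed (rule kN)
qed

lemma Max_image_diff_le:
  fixes g h :: "nat \<Rightarrow> real"
  assumes N: "1 \<le> N" and d: "\<And>i. i < N \<Longrightarrow> \<bar>g i - h i\<bar> \<le> \<epsilon>"
  shows "\<bar>Max (g ` {..<N}) - Max (h ` {..<N})\<bar> \<le> \<epsilon>"
proof -
  have ne: "{..<N} \<noteq> {}" using N by (auto simp: lessThan_empty_iff)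
  have "Max (g ` {..<N}) \<le> Max (h ` {..<N}) + \<epsilon>" if "\<And>i. i < N \<Longrightarrow> \<bar>g i - h i\<bar> \<le> \<epsilon>" for g h :: "nat \<Rightarrow> real"
  proof (rule Max.boundedI)
    fix x assume "x \<in> g ` {..<N}"
    then obtain i where i: "i < N" "x = g i" by auto
    have "h i \<le> Max (h ` {..<N})" using i by (intro Max_ge) auto
    then show "x \<le> Max (h ` {..<N}) + \<epsilon>" using that[OF i(1)] i(2) by linarith
  qed (use ne in auto)
  from this[of g h] this[of h g] show ?thesis using d by (simp add: abs_le_iff abs_minus_commute)
qed

text \<open>In order: the chance that the squared Frobenius norm exceeds \<eta>^2, the chance that
  the trace exceeds \<epsilon> / 4, and the union bound over N columns.\<close>

definition coupling_bound :: "real \<Rightarrow> nat \<Rightarrow> nat \<Rightarrow> real \<Rightarrow> real \<Rightarrow> real" where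
  "coupling_bound C N k \<eta> \<epsilon> = 7 * C\<^sup>2 * (real k)\<^sup>2 / real N / \<eta>\<^sup>2 + 2 * C\<^sup>2 * (real k)\<^sup>2 / real N / (\<epsilon> / 4)\<^sup>2
     + real N * (2 * exp (1 / 4 - \<epsilon> / (16 * \<eta>)) + (exp (1 / 2) / sqrt 3) ^ N)"

proposition coupling:
  assumes k: "k \<le> N" and N: "1 \<le> N" and \<eta>: "0 < \<eta>" and \<epsilon>: "0 < \<epsilon>"
    and C: "\<And>a. a < N \<Longrightarrow> \<bar>lam a\<bar> \<le> C" and supp: "\<And>a. k \<le> a \<Longrightarrow> a < N \<Longrightarrow> lam a = 0"
    and f: "\<And>x y. \<bar>f x - f y\<bar> \<le> \<bar>x - y\<bar>"
  shows "(\<integral>\<^sup>+y. (if \<epsilon> < \<bar>haar_stat f N lam (gs N (rows y)) - diag_stat f N lam y\<bar> then 1 else 0) \<partial>gauss_vecs N)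
    \<le> ennreal (coupling_bound C N k \<eta> \<epsilon>)"
proof -
  let ?M = "Mmat N lam"
  let ?col = "\<lambda>y i b. gs N (rows y) b i"
  let ?R = "2 * exp (1 / 4 - \<epsilon> / (16 * \<eta>)) + (exp (1 / 2) / sqrt 3) ^ N"
  \<comment> \<open>?F counts the failures of the two bounds on M, ?B the bad columns; their sum is
    at least 1 whenever the two statistics differ by more than \<epsilon>.\<close>
  let ?F = "\<lambda>y. (if \<eta>\<^sup>2 < frob N (?M y) then 1 else 0) + (if (\<epsilon> / 4)\<^sup>2 < (trace N (?M y))\<^sup>2 then 1 else 0) :: ennreal"
  let ?B = "\<lambda>y. \<Sum>i<N. if bad_event N (?M y) \<eta> \<epsilon> (?col y i) then 1 else 0 :: ennreal"
  have mb: "(\<lambda>y. if bad_event N (?M y) \<eta> \<epsilon> (?col y i) then 1 else 0 :: ennreal) \<in> borel_measurable (gauss_vecs N)" if "i < N" for i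
  proof (rule measurable_bad_event[where G = "\<lambda>y. y"])
    fix b assume "b < N"
    from measurable_gs[OF that this] show "(\<lambda>y. gs N (rows y) b i) \<in> borel_measurable (gauss_vecs N)" by measurable
  qed auto
  have "(\<integral>\<^sup>+y. (if \<epsilon> < \<bar>haar_stat f N lam (gs N (rows y)) - diag_stat f N lam y\<bar> then 1 else 0) \<partial>gauss_vecs N)
     \<le> (\<integral>\<^sup>+y. ?F y + ?B y \<partial>gauss_vecs N)"
  proof (rule nn_integral_mono_AE)
    show "AE y in gauss_vecs N. (if \<epsilon> < \<bar>haar_stat f N lam (gs N (rows y)) - diag_stat f N lam y\<bar> then 1 else 0) \<le> ?F y + ?B y"
      using AE_gs_nondeg[of N]
    proof eventually_elim
      case (elim y)
      have le1: "(if \<epsilon> < \<bar>haar_stat f N lam (gs N (rows y)) - diag_stat f N lam y\<bar> then 1 else 0) \<le> (1 :: ennreal)"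
        by simp
      show ?case
      proof (cases "\<eta>\<^sup>2 < frob N (?M y) \<or> (\<epsilon> / 4)\<^sup>2 < (trace N (?M y))\<^sup>2 \<or> (\<exists>i<N. bad_event N (?M y) \<eta> \<epsilon> (?col y i))")
        case True
        then have "1 \<le> ?F y + ?B y"
        proof (elim disjE exE conjE)
          assume "\<eta>\<^sup>2 < frob N (?M y)"
          then have "1 \<le> ?F y" by simp
          then show ?thesis by (rule add_increasing2[rotated]) simp
        next
          assume "(\<epsilon> / 4)\<^sup>2 < (trace N (?M y))\<^sup>2"
          then have "1 \<le> ?F y" by simp
          then show ?thesis by (rule add_increasing2[rotated]) simp
        next
          fix i assume i: "i < N" "bad_event N (?M y) \<eta> \<epsilon> (?col y i)"
          have "(if bad_event N (?M y) \<eta> \<epsilon> (?col y i) then 1 else 0 :: ennreal) \<le> ?B y"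
            by (rule member_le_sum) (use i in auto)
          then have "1 \<le> ?B y" using i by simp
          then show ?thesis by (rule add_increasing[rotated]) simp
        qed
        then show ?thesis by (rule order_trans[OF le1])
      next
        case False
        have good: "frob N (?M y) \<le> \<eta>\<^sup>2" "(trace N (?M y))\<^sup>2 \<le> (\<epsilon> / 4)\<^sup>2"
          using False by (simp_all only: de_Morgan_disj not_less)
        have good3: "\<not> bad_event N (?M y) \<eta> \<epsilon> (?col y i)" if "i < N" for i
          using False that by blast
        have tr: "\<bar>trace N (?M y)\<bar> \<le> \<epsilon> / 4" using good(2) \<epsilon> by (simp add: abs_le_square_iff[symmetric])
        have "\<bar>haar_stat f N lam (gs N (rows y)) - diag_stat f N lam y\<bar> \<le> \<epsilon>"
          unfolding haar_stat_def diag_stat_def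
        proof (rule Max_image_diff_le[OF N])
          fix i assume i: "i < N"
          \<comment> \<open>Columns of an orthogonal matrix are unit vectors, so the homogeneous
            condition in \<open>bad_event\<close> becomes a bound on the coupling error at index
            i.\<close>
          have "ip N (?col y i) (?col y i) = 1"
            using orthogonal_on_transpose[OF orthogonal_gs[OF elim]] i by (simp add: orthogonal_on_ip)
          then have "real N * \<bar>qform N (?M y) (?col y i)\<bar> \<le> \<epsilon>"
            using good3[OF i] good(1) tr by (simp add: bad_event_def)
          then have "\<bar>real N * qform N (?M y) (?col y i)\<bar> \<le> \<epsilon>" by (simp add: abs_mult)
          then show "\<bar>f (real N * (\<Sum>a<N. lam a * (gs N (rows y) a i)\<^sup>2)) - f (\<Sum>a<N. lam a * (y (i, a))\<^sup>2)\<bar> \<le> \<epsilon>"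
            unfolding quadratic_difference[OF elim i, symmetric] by (rule order_trans[OF f])
        qed
        then show ?thesis by simp
      qed
    qed
  qed
  also have "\<dots> = (\<integral>\<^sup>+y. ?F y \<partial>gauss_vecs N) + (\<integral>\<^sup>+y. ?B y \<partial>gauss_vecs N)"
  proof (rule nn_integral_add)
    show "?F \<in> borel_measurable (gauss_vecs N)" by measurable
    show "?B \<in> borel_measurable (gauss_vecs N)" by (intro borel_measurable_sum mb) simp
  qed
  also have "(\<integral>\<^sup>+y. ?F y \<partial>gauss_vecs N) = (\<integral>\<^sup>+y. (if \<eta>\<^sup>2 < frob N (?M y) then 1 else 0) \<partial>gauss_vecs N)
      + (\<integral>\<^sup>+y. (if (\<epsilon> / 4)\<^sup>2 < (trace N (?M y))\<^sup>2 then 1 else 0) \<partial>gauss_vecs N)"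
    by (rule nn_integral_add) auto
  also have "(\<integral>\<^sup>+y. ?B y \<partial>gauss_vecs N) = (\<Sum>i<N. \<integral>\<^sup>+y. (if bad_event N (?M y) \<eta> \<epsilon> (?col y i) then 1 else 0) \<partial>gauss_vecs N)"
    by (rule nn_integral_sum) (use mb in auto)
  also have "(\<integral>\<^sup>+y. (if \<eta>\<^sup>2 < frob N (?M y) then 1 else 0) \<partial>gauss_vecs N)
      + (\<integral>\<^sup>+y. (if (\<epsilon> / 4)\<^sup>2 < (trace N (?M y))\<^sup>2 then 1 else 0) \<partial>gauss_vecs N)
      + (\<Sum>i<N. \<integral>\<^sup>+y. (if bad_event N (?M y) \<eta> \<epsilon> (?col y i) then 1 else 0) \<partial>gauss_vecs N)
    \<le> ennreal (7 * C\<^sup>2 * (real k)\<^sup>2 / real N / \<eta>\<^sup>2) + ennreal (2 * C\<^sup>2 * (real k)\<^sup>2 / real N / (\<epsilon> / 4)\<^sup>2) + (\<Sum>i<N. ennreal ?R)"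
    by (intro add_mono sum_mono frob_tail[OF k N _ C supp] trace_tail[OF k N _ C supp] column_tail \<eta> \<epsilon>)
       (use \<eta> \<epsilon> in auto)
  also have "(\<Sum>i<N. ennreal ?R) = ennreal (real N * ?R)"
  proof -
    have "0 \<le> ?R" by simp
    then show ?thesis by (subst sum_ennreal) simp_all
  qed
  finally show ?thesis
    unfolding coupling_bound_def by (simp add: ennreal_plus[symmetric] del: ennreal_plus)
qed

section \<open>Passage to the limit\<close>


lemma cmod_iexp_diff_le: "cmod (iexp a - iexp b) \<le> \<bar>a - b\<bar>"
proof -
  have "iexp a - iexp b = iexp b * (iexp (a - b) - 1)"
    by (simp add: right_diff_distrib exp_add[symmetric] algebra_simps)
  then have "cmod (iexp a - iexp b) = cmod (iexp (a - b) - 1)" by (simp add: norm_mult)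
  also have "\<dots> \<le> \<bar>a - b\<bar>" using iexp_approx1[of "a - b" 0] by simp
  finally show ?thesis .
qed

lemma cmod_iexp_diff_le_2: "cmod (iexp a - iexp b) \<le> 2"
  using norm_triangle_ineq4[of "iexp a" "iexp b"] by simp

text \<open>The characteristic functions at t differ by at most |t| \<epsilon> + 2 P(|X - Y| >
  \<epsilon>), and Levy's continuity theorem converts this into weak convergence. The probability
  space may change with n, as it does here.\<close>

lemma slutsky:
  fixes X Y :: "nat \<Rightarrow> 'a \<Rightarrow> real"
  assumes P: "\<And>n. prob_space (P n)" and X[measurable]: "\<And>n. X n \<in> borel_measurable (P n)"
    and Y[measurable]: "\<And>n. Y n \<in> borel_measurable (P n)"
    and \<mu>: "real_distribution \<mu>" and conv: "weak_conv_m (\<lambda>n. distr (P n) borel (X n)) \<mu>"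
    and lim: "\<And>\<epsilon>. 0 < \<epsilon> \<Longrightarrow> (\<lambda>n. \<integral>\<^sup>+\<omega>. (if \<epsilon> < \<bar>X n \<omega> - Y n \<omega>\<bar> then 1 else 0) \<partial>P n) \<longlonglongrightarrow> 0"
  shows "weak_conv_m (\<lambda>n. distr (P n) borel (Y n)) \<mu>"
proof (rule levy_continuity)
  have rd: "real_distribution (distr (P n) borel Z)" if "Z \<in> borel_measurable (P n)" for n and Z :: "'a \<Rightarrow> real"
    by (rule prob_space.real_distribution_distr[OF P that])
  show "real_distribution (distr (P n) borel (Y n))" for n by (rule rd[OF Y])
  fix t :: real
  have cX: "(\<lambda>n. char (distr (P n) borel (X n)) t) \<longlonglongrightarrow> char \<mu> t"
    by (rule levy_continuity1[OF rd[OF X] \<mu> conv])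
  have "(\<lambda>n. char (distr (P n) borel (Y n)) t - char (distr (P n) borel (X n)) t) \<longlonglongrightarrow> 0"
  proof (rule LIMSEQ_I)
    fix r :: real assume r: "0 < r"
    \<comment> \<open>The added 1 keeps the division below valid at t = 0.\<close>
    define u where "u = \<bar>t\<bar> + 1"
    have u: "0 < u" "\<bar>t\<bar> \<le> u" by (auto simp: u_def)
    \<comment> \<open>Makes |t| \<epsilon> at most r / 4; with probability below r / 4 for the
      exceptional event, the total stays below r.\<close>
    define \<epsilon> where "\<epsilon> = r / (4 * u)"
    have \<epsilon>: "0 < \<epsilon>" using r u by (simp add: \<epsilon>_def)
    have t\<epsilon>: "\<bar>t\<bar> * \<epsilon> < r / 2"
    proof -
      have "\<bar>t\<bar> * \<epsilon> \<le> u * \<epsilon>" using \<epsilon> u by (intro mult_right_mono) auto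
      also have "\<dots> = r / 4" using u by (simp add: \<epsilon>_def)
      finally show ?thesis using r by linarith
    qed
    let ?p = "\<lambda>n. \<integral>\<^sup>+\<omega>. (if \<epsilon> < \<bar>X n \<omega> - Y n \<omega>\<bar> then 1 else 0) \<partial>P n"
    have "\<forall>\<^sub>F n in sequentially. ?p n < ennreal (r / 4)"
      using order_tendstoD(2)[OF lim[OF \<epsilon>]] r by simp
    then obtain n0 where n0: "\<And>n. n \<ge> n0 \<Longrightarrow> ?p n < ennreal (r / 4)"
      by (auto simp: eventually_sequentially)
    show "\<exists>no. \<forall>n\<ge>no. norm (char (distr (P n) borel (Y n)) t - char (distr (P n) borel (X n)) t - 0) < r"
    proof (intro exI allI impI)
      fix n assume n: "n0 \<le> n"
      interpret prob_space "P n" by (rule P)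
      have int: "integrable (P n) (\<lambda>\<omega>. iexp (t * Z \<omega>))" if [measurable]: "Z \<in> borel_measurable (P n)" for Z
        by (rule integrable_const_bound[where B = 1]) auto
      have ch: "char (distr (P n) borel Z) t = (\<integral>\<omega>. iexp (t * Z \<omega>) \<partial>P n)" if [measurable]: "Z \<in> borel_measurable (P n)" for Z
        unfolding char_def by (rule integral_distr) auto
      have "char (distr (P n) borel (Y n)) t - char (distr (P n) borel (X n)) t
          = (\<integral>\<omega>. iexp (t * Y n \<omega>) - iexp (t * X n \<omega>) \<partial>P n)"
        unfolding ch[OF X] ch[OF Y] by (rule Bochner_Integration.integral_diff[symmetric]) (intro int X Y)+
      then have "ennreal (norm (char (distr (P n) borel (Y n)) t - char (distr (P n) borel (X n)) t))
          \<le> (\<integral>\<^sup>+\<omega>. norm (iexp (t * Y n \<omega>) - iexp (t * X n \<omega>)) \<partial>P n)"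
        using integral_norm_bound_ennreal[of "P n" "\<lambda>\<omega>. iexp (t * Y n \<omega>) - iexp (t * X n \<omega>)"] int[OF X] int[OF Y] by simp
      also have "\<dots> \<le> (\<integral>\<^sup>+\<omega>. ennreal (\<bar>t\<bar> * \<epsilon>) + 2 * (if \<epsilon> < \<bar>X n \<omega> - Y n \<omega>\<bar> then 1 else 0) \<partial>P n)"
      proof (rule nn_integral_mono)
        fix \<omega>
        show "ennreal (norm (iexp (t * Y n \<omega>) - iexp (t * X n \<omega>))) \<le> ennreal (\<bar>t\<bar> * \<epsilon>) + 2 * (if \<epsilon> < \<bar>X n \<omega> - Y n \<omega>\<bar> then 1 else 0)"
        proof (cases "\<epsilon> < \<bar>X n \<omega> - Y n \<omega>\<bar>")
          case True
          have "ennreal (norm (iexp (t * Y n \<omega>) - iexp (t * X n \<omega>))) \<le> ennreal 2"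
            by (intro ennreal_leI cmod_iexp_diff_le_2)
          then have "ennreal (norm (iexp (t * Y n \<omega>) - iexp (t * X n \<omega>))) \<le> 2" by simp
          then show ?thesis using True by (simp add: add_increasing)
        next
          case False
          have "norm (iexp (t * Y n \<omega>) - iexp (t * X n \<omega>)) \<le> \<bar>t * Y n \<omega> - t * X n \<omega>\<bar>"
            by (rule cmod_iexp_diff_le)
          also have "\<dots> = \<bar>t\<bar> * \<bar>X n \<omega> - Y n \<omega>\<bar>"
            by (simp add: right_diff_distrib[symmetric] abs_mult abs_minus_commute)
          also have "\<dots> \<le> \<bar>t\<bar> * \<epsilon>" using False by (intro mult_left_mono) auto
          finally show ?thesis using False by (simp add: ennreal_leI)
        qed
      qed
      also have "\<dots> = ennreal (\<bar>t\<bar> * \<epsilon>) + 2 * ?p n"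
        by (subst nn_integral_add) (auto simp: nn_integral_cmult emeasure_space_1)
      also have "\<dots> \<le> ennreal (\<bar>t\<bar> * \<epsilon>) + 2 * ennreal (r / 4)"
        using n0[OF n] by (intro add_mono mult_left_mono) auto
      also have "\<dots> = ennreal (\<bar>t\<bar> * \<epsilon> + r / 2)"
      proof -
        have "2 * ennreal (r / 4) = ennreal (r / 2)"
          using r ennreal_mult[of 2 "r / 4"] by simp
        then show ?thesis using r \<epsilon> by (simp add: ennreal_plus)
      qed
      finally have "norm (char (distr (P n) borel (Y n)) t - char (distr (P n) borel (X n)) t) \<le> \<bar>t\<bar> * \<epsilon> + r / 2"
        using r \<epsilon> by (subst (asm) ennreal_le_iff) auto
      then show "norm (char (distr (P n) borel (Y n)) t - char (distr (P n) borel (X n)) t - 0) < r"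
        using t\<epsilon> by simp
    qed
  qed
  from tendsto_add[OF this cX] show "(\<lambda>n. char (distr (P n) borel (Y n)) t) \<longlonglongrightarrow> char \<mu> t" by simp
qed (rule \<mu>)

text \<open>The facts about the GOE need 1 \<le> N; a shift of the index removes N = 0, where the
  maxima range over an empty set.\<close>

lemma weak_conv_m_Suc_iff: "weak_conv_m (\<lambda>n. M (Suc n)) \<mu> \<longleftrightarrow> weak_conv_m M \<mu>"
proof -
  have "(\<lambda>n. cdf (M (Suc n)) x) \<longlonglongrightarrow> l \<longleftrightarrow> (\<lambda>n. cdf (M n) x) \<longlonglongrightarrow> l" for x l
    by (rule filterlim_sequentially_Suc)
  then show ?thesis by (simp add: weak_conv_m_def weak_conv_def)
qed

lemma distr_affine_eqI:
  assumes X[measurable]: "X \<in> borel_measurable M" and Y[measurable]: "Y \<in> borel_measurable M'"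
    and eq: "\<And>B. B \<in> sets (borel :: real measure) \<Longrightarrow> (\<integral>\<^sup>+x. indicator B (X x) \<partial>M) = (\<integral>\<^sup>+x. indicator B (Y x) \<partial>M')"
  shows "distr M borel (\<lambda>x. c * X x + d) = distr M' borel (\<lambda>x. c * Y x + d)"
proof (rule measure_eqI)
  fix B assume "B \<in> sets (distr M borel (\<lambda>x. c * X x + d))"
  then have B[measurable]: "B \<in> sets borel" by simp
  define B' where "B' = (\<lambda>x. c * x + d) -` B"
  have "B' \<in> sets borel" unfolding B'_def using measurable_sets[of "\<lambda>x. c * x + d" borel borel B] B by simp
  note eq' = eq[OF this]
  have em: "emeasure (distr N borel (\<lambda>x. c * Z x + d)) B = (\<integral>\<^sup>+x. indicator B' (Z x) \<partial>N)"
    if [measurable]: "Z \<in> borel_measurable N" for N :: "'z measure" and Z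
  proof -
    have "emeasure (distr N borel (\<lambda>x. c * Z x + d)) B = (\<integral>\<^sup>+z. indicator B z \<partial>distr N borel (\<lambda>x. c * Z x + d))"
      using B by simp
    also have "\<dots> = (\<integral>\<^sup>+x. indicator B (c * Z x + d) \<partial>N)" by (rule nn_integral_distr) auto
    finally show ?thesis by (simp add: B'_def indicator_def)
  qed
  show "emeasure (distr M borel (\<lambda>x. c * X x + d)) B = emeasure (distr M' borel (\<lambda>x. c * Y x + d)) B"
    unfolding em[OF X] em[OF Y] by (rule eq')
qed simp

text \<open>With \<eta> = N^(-\<delta>/2), the Frobenius term is of order N^(-2 \<delta>) /
  N^(-\<delta>) = N^(-\<delta>), and the trace term of order N^(-2 \<delta>). The exponent
  \<epsilon> / (16 \<eta>) grows like a power of N and so beats the factor N of the union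
  bound.\<close>

lemma coupling_bound_tendsto_0:
  assumes \<delta>: "0 < \<delta>" and \<epsilon>: "0 < \<epsilon>"
    and k: "\<forall>\<^sub>F N in sequentially. real (k N) \<le> K * real N powr (1 / 2 - \<delta>)"
  shows "(\<lambda>N. coupling_bound C N (k N) (real N powr (- \<delta> / 2)) \<epsilon>) \<longlonglongrightarrow> 0"
proof (rule tendsto_sandwich[of "\<lambda>_. 0"])
  define q where "q = exp (1 / 2) / sqrt (3 :: real)"
  have q: "0 \<le> q" "q < 1"
  proof -
    \<comment> \<open>The base of the norm tail is below 1 because e < 3.\<close>
    have "(exp (1 / 2 :: real))\<^sup>2 = exp 1" by (simp add: power2_eq_square exp_add[symmetric])
    also have "\<dots> < (sqrt 3)\<^sup>2" using e_less_272 by simp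
    finally have "exp (1 / 2) < sqrt (3 :: real)" by (rule power_less_imp_less_base) simp
    then show "0 \<le> q" "q < 1" by (simp_all add: q_def)
  qed
  define D where "D = 7 * C\<^sup>2 * K\<^sup>2"
  define E where "E = 2 * C\<^sup>2 * K\<^sup>2 / (\<epsilon> / 4)\<^sup>2"
  let ?U = "\<lambda>N. D * real N powr (- \<delta>) + E * real N powr (- 2 * \<delta>)
      + real N * (2 * exp (1 / 4 - \<epsilon> / (16 * real N powr (- \<delta> / 2)))) + real N * q ^ N"
  have 1: "(\<lambda>N. D * real N powr (- \<delta>)) \<longlonglongrightarrow> 0" using \<delta> by real_asymp
  have 2: "(\<lambda>N. E * real N powr (- 2 * \<delta>)) \<longlonglongrightarrow> 0" using \<delta> by real_asymp
  have 3: "(\<lambda>N. real N * (2 * exp (1 / 4 - \<epsilon> / (16 * real N powr (- \<delta> / 2))))) \<longlonglongrightarrow> 0" using \<delta> \<epsilon> by real_asymp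
  have 4: "(\<lambda>N. real N * q ^ N) \<longlonglongrightarrow> 0" using powser_times_n_limit_0[of q] q by simp
  show "?U \<longlonglongrightarrow> 0" using tendsto_add[OF tendsto_add[OF tendsto_add[OF 1 2] 3] 4] by simp
  show "\<forall>\<^sub>F N in sequentially. coupling_bound C N (k N) (real N powr (- \<delta> / 2)) \<epsilon> \<le> ?U N"
    using k eventually_gt_at_top[of 0]
  proof eventually_elim
    case (elim N)
    let ?n = "real N"
    have n: "0 < ?n" using elim by simp
    have "(real (k N))\<^sup>2 \<le> (K * ?n powr (1 / 2 - \<delta>))\<^sup>2" using elim(1) by (intro power_mono) auto
    also have "\<dots> = K\<^sup>2 * (?n * ?n powr (- 2 * \<delta>))"
    proof -
      have "(?n powr (1 / 2 - \<delta>))\<^sup>2 = ?n powr (1 + - 2 * \<delta>)"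
        by (simp add: power2_eq_square powr_add[symmetric] algebra_simps)
      also have "\<dots> = ?n * ?n powr (- 2 * \<delta>)" using n by (simp only: powr_add powr_one)
      finally show ?thesis by (simp add: power_mult_distrib)
    qed
    finally have kk: "(real (k N))\<^sup>2 / ?n \<le> K\<^sup>2 * ?n powr (- 2 * \<delta>)" using n by (simp add: field_simps)
    have \<eta>: "(?n powr (- \<delta> / 2))\<^sup>2 = ?n powr (- \<delta>)" by (simp add: power2_eq_square powr_add[symmetric])
    have "7 * C\<^sup>2 * (real (k N))\<^sup>2 / ?n / (?n powr (- \<delta> / 2))\<^sup>2 = 7 * C\<^sup>2 * ((real (k N))\<^sup>2 / ?n) / ?n powr (- \<delta>)"
      unfolding \<eta> by simp
    also have "\<dots> \<le> 7 * C\<^sup>2 * (K\<^sup>2 * ?n powr (- 2 * \<delta>)) / ?n powr (- \<delta>)"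
      by (intro divide_right_mono mult_left_mono kk) auto
    also have "\<dots> = D * (?n powr (- 2 * \<delta>) / ?n powr (- \<delta>))" by (simp add: D_def)
    also have "?n powr (- 2 * \<delta>) / ?n powr (- \<delta>) = ?n powr (- \<delta>)" by (simp add: powr_diff[symmetric])
    finally have a: "7 * C\<^sup>2 * (real (k N))\<^sup>2 / ?n / (?n powr (- \<delta> / 2))\<^sup>2 \<le> D * ?n powr (- \<delta>)" .
    have "2 * C\<^sup>2 * (real (k N))\<^sup>2 / ?n / (\<epsilon> / 4)\<^sup>2 = 2 * C\<^sup>2 / (\<epsilon> / 4)\<^sup>2 * ((real (k N))\<^sup>2 / ?n)" by simp
    also have "\<dots> \<le> 2 * C\<^sup>2 / (\<epsilon> / 4)\<^sup>2 * (K\<^sup>2 * ?n powr (- 2 * \<delta>))"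
      by (intro mult_left_mono kk) auto
    also have "\<dots> = E * ?n powr (- 2 * \<delta>)" by (simp add: E_def)
    finally have b: "2 * C\<^sup>2 * (real (k N))\<^sup>2 / ?n / (\<epsilon> / 4)\<^sup>2 \<le> E * ?n powr (- 2 * \<delta>)" .
    show ?case
      using a b unfolding coupling_bound_def q_def[symmetric] by (simp add: distrib_left)
  qed
  show "\<forall>\<^sub>F N in sequentially. 0 \<le> coupling_bound C N (k N) (real N powr (- \<delta> / 2)) \<epsilon>"
    by (rule always_eventually) (auto simp: coupling_bound_def intro!: add_nonneg_nonneg)
qed simp

lemma measurable_gauss_stat:
  assumes "continuous_on UNIV f"
  shows "gauss_stat f N A \<in> borel_measurable (gauss_vecs N)"
proof -
  have "gauss_stat f N A \<in> borel_measurable (PiM (sq_index N) (\<lambda>_. borel))"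
    unfolding gauss_stat_def[abs_def] qform_def
    by (rule borel_measurable_Max_stat[OF assms])
       (intro borel_measurable_times borel_measurable_const borel_measurable_sum measurable_component_singleton, auto)
  then show ?thesis by measurable
qed

text \<open>Gathers the spectral data and both identities of laws for a single N, so that
  eigenvalues and k can then be chosen as sequences in N.\<close>

lemma spectral_laws:
  assumes N: "1 \<le> N" and sym: "\<And>i j. i < N \<Longrightarrow> j < N \<Longrightarrow> A i j = A j i"
    and f: "continuous_on UNIV f"
  shows "\<exists>lam k. k \<le> N \<and> k \<le> mrank N A \<and> (\<forall>a. k \<le> a \<longrightarrow> a < N \<longrightarrow> lam a = 0) \<and> (\<forall>a<N. \<bar>lam a\<bar> \<le> op_norm N A)
    \<and> (\<forall>c d. distr (gauss_vecs N) borel (\<lambda>y. c * gauss_stat f N A y + d)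
         = distr (gauss_vecs N) borel (\<lambda>y. c * diag_stat f N lam y + d))
    \<and> (\<forall>c d. distr (goe N) borel (\<lambda>g. c * eig_stat f N A (goe_mat g) + d)
         = distr (gauss_vecs N) borel (\<lambda>y. c * haar_stat f N lam (gs N (rows y)) + d))"
proof -
  obtain v lam k where o: "orthogonal_on {..<N} v"
    and e: "\<And>b i. b < N \<Longrightarrow> i < N \<Longrightarrow> mv N A (v b) i = lam b * v b i"
    and r: "k \<le> N" "k \<le> mrank N A" "\<And>a. k \<le> a \<Longrightarrow> a < N \<Longrightarrow> lam a = 0" "\<And>a. a < N \<Longrightarrow> \<bar>lam a\<bar> \<le> op_norm N A"
    using ordered_spectral_decomposition[of N A] sym by metis
  have m1: "diag_stat f N lam \<in> borel_measurable (gauss_vecs N)"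
    using measurable_diag_stat[OF f] by measurable
  have m2: "(\<lambda>y. haar_stat f N lam (gs N (rows y))) \<in> borel_measurable (gauss_vecs N)"
    using measurable_haar_stat[OF f] by measurable
  have m3: "(\<lambda>g. eig_stat f N A (goe_mat g)) \<in> borel_measurable (goe N)"
    using borel_measurable_eig_stat_PiM[OF N f] by measurable
  have "distr (gauss_vecs N) borel (\<lambda>y. c * gauss_stat f N A y + d)
         = distr (gauss_vecs N) borel (\<lambda>y. c * diag_stat f N lam y + d)" for c d
    by (rule distr_affine_eqI[OF measurable_gauss_stat[OF f] m1 gauss_stat_law[OF sym o e f]])
  moreover have "distr (goe N) borel (\<lambda>g. c * eig_stat f N A (goe_mat g) + d)
         = distr (gauss_vecs N) borel (\<lambda>y. c * haar_stat f N lam (gs N (rows y)) + d)" for c d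
    by (rule distr_affine_eqI[OF m3 m2 eig_stat_law[OF N sym o e f]])
  ultimately show ?thesis using r by blast
qed

proposition stat_convergence:
  fixes A :: "nat \<Rightarrow> nat \<Rightarrow> nat \<Rightarrow> real"
  assumes sym: "\<And>N i j. 1 \<le> N \<Longrightarrow> i < N \<Longrightarrow> j < N \<Longrightarrow> A N i j = A N j i"
    and rank: "\<exists>\<delta>>0. (\<lambda>N. real (mrank N (A N))) \<in> O(\<lambda>N. real N powr (1/2 - \<delta>))"
    and bdd: "\<exists>C. \<forall>N\<ge>1. op_norm N (A N) \<le> C"
    and f: "\<And>x y. \<bar>f x - f y\<bar> \<le> \<bar>x - y :: real\<bar>"
    and c: "\<And>N. \<bar>c N\<bar> \<le> B" and \<mu>: "real_distribution \<mu>"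
    and conv: "weak_conv_m (\<lambda>N. distr (gauss_vecs N) borel (\<lambda>y. c N * gauss_stat f N (A N) y + d N)) \<mu>"
  shows "weak_conv_m (\<lambda>N. distr (goe N) borel (\<lambda>g. c N * eig_stat f N (A N) (goe_mat g) + d N)) \<mu>"
proof -
  have cf: "continuous_on UNIV f"
    unfolding continuous_on_iff dist_real_def
  proof (intro ballI allI impI)
    fix x e :: real assume "0 < e"
    then show "\<exists>d>0. \<forall>x'\<in>UNIV. \<bar>x' - x\<bar> < d \<longrightarrow> \<bar>f x' - f x\<bar> < e"
      by (intro exI[of _ e] conjI ballI impI le_less_trans[OF f])
  qed
  obtain C where C: "\<And>N. 1 \<le> N \<Longrightarrow> op_norm N (A N) \<le> C" using bdd by auto
  obtain \<delta> where \<delta>: "0 < \<delta>" and O: "(\<lambda>N. real (mrank N (A N))) \<in> O(\<lambda>N. real N powr (1/2 - \<delta>))" using rank by auto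
  obtain K where K: "\<forall>\<^sub>F N in sequentially. norm (real (mrank N (A N))) \<le> K * norm (real N powr (1/2 - \<delta>))"
    using O by (auto elim: landau_o.bigE)
  define good where "good = (\<lambda>N lam k. k \<le> N \<and> k \<le> mrank N (A N)
      \<and> (\<forall>a. k \<le> a \<longrightarrow> a < N \<longrightarrow> lam a = 0) \<and> (\<forall>a<N. \<bar>lam a\<bar> \<le> op_norm N (A N))
    \<and> (\<forall>c d. distr (gauss_vecs N) borel (\<lambda>y. c * gauss_stat f N (A N) y + d)
         = distr (gauss_vecs N) borel (\<lambda>y. c * diag_stat f N lam y + d))
    \<and> (\<forall>c d. distr (goe N) borel (\<lambda>g. c * eig_stat f N (A N) (goe_mat g) + d)
         = distr (gauss_vecs N) borel (\<lambda>y. c * haar_stat f N lam (gs N (rows y)) + d)))"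
  have "\<exists>lam k. good N lam k" if "1 \<le> N" for N
    unfolding good_def by (rule spectral_laws[OF that sym[OF that] cf])
  then obtain lam k where "\<And>N. 1 \<le> N \<Longrightarrow> good N (lam N) (k N)" by metis
  note lk = this[unfolded good_def]
  have kK: "\<forall>\<^sub>F N in sequentially. real (k N) \<le> K * real N powr (1/2 - \<delta>)"
    using K eventually_ge_at_top[of 1]
  proof eventually_elim
    case (elim N)
    then have "real (k N) \<le> real (mrank N (A N))" using lk by simp
    then show ?case using elim by simp
  qed
  let ?X = "\<lambda>N y. c N * diag_stat f N (lam N) y + d N"
  let ?Y = "\<lambda>N y. c N * haar_stat f N (lam N) (gs N (rows y)) + d N"
  have mD: "diag_stat f N l \<in> borel_measurable (gauss_vecs N)" for N l
    using measurable_diag_stat[OF cf] by measurable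
  have mH: "(\<lambda>y. haar_stat f N l (gs N (rows y))) \<in> borel_measurable (gauss_vecs N)" for N l
    using measurable_haar_stat[OF cf] by measurable
  have B: "0 \<le> B" using c[of 0] by linarith
  have "weak_conv_m (\<lambda>n. distr (gauss_vecs (Suc n)) borel (?Y (Suc n))) \<mu>"
  proof (rule slutsky[OF prob_space_gauss_vecs _ _ \<mu>])
    show "?X (Suc n) \<in> borel_measurable (gauss_vecs (Suc n))" for n using mD by measurable
    show "?Y (Suc n) \<in> borel_measurable (gauss_vecs (Suc n))" for n using mH by measurable
    have "weak_conv_m (\<lambda>n. distr (gauss_vecs (Suc n)) borel (\<lambda>y. c (Suc n) * gauss_stat f (Suc n) (A (Suc n)) y + d (Suc n))) \<mu>"
      using conv weak_conv_m_Suc_iff[of "\<lambda>N. distr (gauss_vecs N) borel (\<lambda>y. c N * gauss_stat f N (A N) y + d N)"] by simp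
    then show "weak_conv_m (\<lambda>n. distr (gauss_vecs (Suc n)) borel (?X (Suc n))) \<mu>"
      using lk by simp
    fix \<epsilon> :: real assume \<epsilon>: "0 < \<epsilon>"
    \<comment> \<open>The affine map multiplies the coupling error by at most B; this is where
      boundedness of c enters. The added 1 covers B = 0.\<close>
    define e where "e = \<epsilon> / (B + 1)"
    have e: "0 < e" using \<epsilon> B by (simp add: e_def)
    let ?p = "\<lambda>N. \<integral>\<^sup>+y. (if \<epsilon> < \<bar>?X N y - ?Y N y\<bar> then 1 else 0) \<partial>gauss_vecs N"
    have pb: "?p N \<le> ennreal (coupling_bound C N (k N) (real N powr (- \<delta> / 2)) e)" if N: "1 \<le> N" for N
    proof -
      have "?p N \<le> (\<integral>\<^sup>+y. (if e < \<bar>haar_stat f N (lam N) (gs N (rows y)) - diag_stat f N (lam N) y\<bar> then 1 else 0) \<partial>gauss_vecs N)"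
      proof (rule nn_integral_mono)
        fix y
        let ?D = "\<bar>haar_stat f N (lam N) (gs N (rows y)) - diag_stat f N (lam N) y\<bar>"
        have "e < ?D" if "\<epsilon> < \<bar>?X N y - ?Y N y\<bar>"
        proof -
          have "\<bar>?X N y - ?Y N y\<bar> = \<bar>c N\<bar> * ?D"
            by (simp add: right_diff_distrib[symmetric] abs_mult abs_minus_commute)
          also have "\<dots> \<le> (B + 1) * ?D" using c[of N] by (intro mult_right_mono) auto
          finally have "\<epsilon> < (B + 1) * ?D" using that by simp
          then show ?thesis using B by (simp add: e_def divide_less_eq mult.commute)
        qed
        then show "(if \<epsilon> < \<bar>?X N y - ?Y N y\<bar> then 1 else 0) \<le> (if e < ?D then 1 else 0 :: ennreal)" by simp
      qed
      also have "\<dots> \<le> ennreal (coupling_bound C N (k N) (real N powr (- \<delta> / 2)) e)"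
      proof (rule coupling[OF _ N _ e])
        show "\<bar>lam N a\<bar> \<le> C" if "a < N" for a using lk[OF N] C[OF N] that by force
      qed (use lk[OF N] f N in auto)
      finally show ?thesis .
    qed
    have b0: "(\<lambda>n. ennreal (coupling_bound C (Suc n) (k (Suc n)) (real (Suc n) powr (- \<delta> / 2)) e)) \<longlonglongrightarrow> ennreal 0"
      using LIMSEQ_Suc[OF coupling_bound_tendsto_0[OF \<delta> e kK]] by (rule tendsto_ennrealI)
    show "(\<lambda>n. ?p (Suc n)) \<longlonglongrightarrow> 0"
    proof (rule tendsto_sandwich[of "\<lambda>_. 0"])
      show "\<forall>\<^sub>F n in sequentially. ?p (Suc n) \<le> ennreal (coupling_bound C (Suc n) (k (Suc n)) (real (Suc n) powr (- \<delta> / 2)) e)"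
        by (rule always_eventually) (intro allI pb, simp)
      show "(\<lambda>n. ennreal (coupling_bound C (Suc n) (k (Suc n)) (real (Suc n) powr (- \<delta> / 2)) e)) \<longlonglongrightarrow> 0"
        using b0 by simp
    qed auto
  qed
  then have "weak_conv_m (\<lambda>n. distr (goe (Suc n)) borel (\<lambda>g. c (Suc n) * eig_stat f (Suc n) (A (Suc n)) (goe_mat g) + d (Suc n))) \<mu>"
    using lk by simp
  then show ?thesis
    using weak_conv_m_Suc_iff[of "\<lambda>N. distr (goe N) borel (\<lambda>g. c N * eig_stat f N (A N) (goe_mat g) + d N)"] by simp
qed

theorem theorem2p1:
  fixes A :: "nat \<Rightarrow> nat \<Rightarrow> nat \<Rightarrow> real"
  assumes sym: "\<And>N i j. 1 \<le> N \<Longrightarrow> i < N \<Longrightarrow> j < N \<Longrightarrow> A N i j = A N j i"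
    and rank: "\<exists>\<delta>>0. (\<lambda>N. real (mrank N (A N))) \<in> O(\<lambda>N. real N powr (1/2 - \<delta>))"
    and bdd: "\<exists>C. \<forall>N\<ge>1. op_norm N (A N) \<le> C"
  shows
    "(\<forall>(c::nat \<Rightarrow> real) (d::nat \<Rightarrow> real) (\<mu>::real measure).
        (\<exists>B. \<forall>N. \<bar>c N\<bar> \<le> B) \<and> real_distribution \<mu> \<and>
        weak_conv_m (\<lambda>N. distr (gauss_vecs N) borel (\<lambda>y. c N * gauss_max N (A N) y + d N)) \<mu>
        \<longrightarrow> weak_conv_m (\<lambda>N. distr (goe N) borel (\<lambda>g. c N * eig_max N (A N) (goe_mat g) + d N)) \<mu>)
     \<and>
     (\<forall>(c'::nat \<Rightarrow> real) (d'::nat \<Rightarrow> real) (\<mu>'::real measure).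
        (\<exists>B. \<forall>N. \<bar>c' N\<bar> \<le> B) \<and> real_distribution \<mu>' \<and>
        weak_conv_m (\<lambda>N. distr (gauss_vecs N) borel (\<lambda>y. c' N * gauss_max_abs N (A N) y + d' N)) \<mu>'
        \<longrightarrow> weak_conv_m (\<lambda>N. distr (goe N) borel (\<lambda>g. c' N * eig_max_abs N (A N) (goe_mat g) + d' N)) \<mu>')"
proof (intro conjI allI impI; elim conjE exE)
  fix c d :: "nat \<Rightarrow> real" and \<mu> :: "real measure" and B
  assume "\<forall>N. \<bar>c N\<bar> \<le> B" "real_distribution \<mu>"
    "weak_conv_m (\<lambda>N. distr (gauss_vecs N) borel (\<lambda>y. c N * gauss_max N (A N) y + d N)) \<mu>"
  then show "weak_conv_m (\<lambda>N. distr (goe N) borel (\<lambda>g. c N * eig_max N (A N) (goe_mat g) + d N)) \<mu>"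
    unfolding gauss_max_eq_gauss_stat eig_max_eq_eig_stat
    by (intro stat_convergence[OF sym rank bdd, where B = B]) auto
next
  fix c d :: "nat \<Rightarrow> real" and \<mu> :: "real measure" and B
  assume "\<forall>N. \<bar>c N\<bar> \<le> B" "real_distribution \<mu>"
    "weak_conv_m (\<lambda>N. distr (gauss_vecs N) borel (\<lambda>y. c N * gauss_max_abs N (A N) y + d N)) \<mu>"
  then show "weak_conv_m (\<lambda>N. distr (goe N) borel (\<lambda>g. c N * eig_max_abs N (A N) (goe_mat g) + d N)) \<mu>"
    unfolding gauss_max_abs_eq_gauss_stat eig_max_abs_eq_eig_stat
    by (intro stat_convergence[OF sym rank bdd, where B = B]) auto
qed


end
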